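(* There is $n_0$ such that the following holds for all $n\ge n_0$. Let $l\in\mathbb{N}$ satisfy $l\ge 10^3\log^2 n$ and $l\mid n$. Let $G$ be a graph on $n$ vertices containing $n/l$ pairwise disjoint vertex pairs $(x_i,y_i)$, $1\le i\le n/l$, and let $W=V(G)\setminus\bigcup_i\{x_i,y_i\}$. Suppose $G$ $d$-expands into $W$, where $d=10^{10}\log^4 n/\log\log n$. Then $V(G)$ can be covered by $n/l$ vertex-disjoint paths $P_1,\dots,P_{n/l}$, each of length $l-1$, such that for each $i$ the path $P_i$ has endpoints $x_i$ and $y_i$.
   Context: For $S\subset V(G)$ and $B\subset V(G)$, let $N_G(S)=\big(\bigcup_{v\in S}N(v)\big)\setminus S$ and $N_G(S,B)=N_G(S)\cap B$; $e_G(X,Y)$ is the number of edges between disjoint sets $X,Y$. For $W\subset V(G)$ and $d>0$, $G$ $d$-expands into $W$ if (1) $|N_G(X,W)|\ge d|X|$ for all $X\subset V(G)$ with $1\le |X|<\lceil |W|/(2d)\rceil$, and (2) $e_G(X,Y)>0$ for all disjoint $X,Y\subset V(G)$ with $|X|=|Y|=\lceil |W|/(2d)\rceil$. The length of a path is its number of edges. $\log$ is the natural logarithm. *)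

theory Defs
  imports Complex_Main "HOL-Library.Disjoint_Sets"
    "Graph_Theory.Pair_Digraph" "Graph_Theory.Vertex_Walk"
begin

text \<open>
  A finite simple graph is a \<^locale>\<open>pair_graph\<close>: a finite vertex set with a symmetric,
  loop-free set of ordered pairs, so that every undirected edge \<open>{u, v}\<close> is present as the
  two arcs \<open>(u, v)\<close> and \<open>(v, u)\<close>.
\<close>

definition nbhd :: "'a pair_pre_digraph \<Rightarrow> 'a \<Rightarrow> 'a set" where
  "nbhd G v = {u. (v, u) \<in> parcs G}"

definition ext_nbhd :: "'a pair_pre_digraph \<Rightarrow> 'a set \<Rightarrow> 'a set" where
  "ext_nbhd G S = (\<Union>v\<in>S. nbhd G v) - S"

definition ext_nbhd_in :: "'a pair_pre_digraph \<Rightarrow> 'a set \<Rightarrow> 'a set \<Rightarrow> 'a set" where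
  "ext_nbhd_in G S B = ext_nbhd G S \<inter> B"

text \<open>
  For disjoint \<open>X\<close> and \<open>Y\<close>, each undirected edge between them is exactly one arc from
  \<open>X\<close> to \<open>Y\<close>, so counting these arcs counts the edges.
\<close>

definition edges_between :: "'a pair_pre_digraph \<Rightarrow> 'a set \<Rightarrow> 'a set \<Rightarrow> nat" where
  "edges_between G X Y = card {(x, y) \<in> parcs G. x \<in> X \<and> y \<in> Y}"

text \<open>Meant for \<open>d > 0\<close> and \<open>W \<subseteq> pverts G\<close>.\<close>

definition expands_into :: "'a pair_pre_digraph \<Rightarrow> real \<Rightarrow> 'a set \<Rightarrow> bool" where
  "expands_into G d W \<longleftrightarrow>
     (\<forall>X \<subseteq> pverts G. 1 \<le> card X \<and> int (card X) < \<lceil>real (card W) / (2 * d)\<rceil> \<longrightarrow>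
        real (card (ext_nbhd_in G X W)) \<ge> d * real (card X)) \<and>
     (\<forall>X \<subseteq> pverts G. \<forall>Y \<subseteq> pverts G. X \<inter> Y = {} \<and>
        int (card X) = \<lceil>real (card W) / (2 * d)\<rceil> \<and>
        int (card Y) = \<lceil>real (card W) / (2 * d)\<rceil> \<longrightarrow>
        edges_between G X Y > 0)"

end

theory Submission
  imports Defs "HOL-Library.Multiset" "HOL-Real_Asymp.Real_Asymp"
begin

text \<open>
  The proof follows Montgomery's absorption method, with extendable embeddings in the sense of
  Friedman and Pippenger as the only embedding tool: as long as somewhat more than a constant times \<open>D m\<close>
  vertices of the target set are free (no two disjoint \<open>m\<close>-sets being without an edge between them),
  prescribed pairs of vertices can be joined by disjoint paths of prescribed lengths, each longer than
  \<open>2 log m / log D\<close>.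

  With \<open>D \<approx> log n\<close>, so that short connections have length \<open>O(log n / log log n)\<close>, we first build absorbers:
  paths of fixed ends that can be rerouted, on the same vertices, through any single one of three further
  vertices. They hang on the paths starting at the \<open>x\<^sub>i\<close> and are
  arranged along a compaction network of depth \<open>O(log n)\<close> over a reservoir \<open>Z\<close>, which makes it possible to
  absorb whatever subset of \<open>Z\<close> of the right size is left over in the end. With \<open>D = 2\<close>, the
  paths are then continued through the remaining vertices until only \<open>O(m)\<close> of these are left. Finally
  the leftover vertices are inserted one by one into a few paths that have been stopped before their end \<open>y\<^sub>i\<close>,
  by short connections through \<open>Z\<close>, and the unused part of \<open>Z\<close> is absorbed.
\<close>

subsection \<open>Extendable embeddings\<close>

text \<open>Which vertices of \<open>Z\<close> remain to be absorbed is known only at the end, but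
  how many is known from the start, since all lengths are prescribed. The network serves every
  subset of that one size. It costs a factor \<open>O(log n)\<close> over \<open>|Z|\<close>, yet
  each of its places is offered to at most nine absorbers, so bounded degrees suffice. Write
  \<open>L\<close> for \<open>log n\<close>. An absorber has \<open>O(k^2)\<close> vertices with
  \<open>k\<close> about \<open>L / log L\<close>, there are \<open>O(L |Z|)\<close> of them, and
  \<open>|Z|\<close> is \<open>O(L n / d)\<close>. For \<open>d\<close> of order
  \<open>L^4 / log L\<close> their total is \<open>o(n)\<close>. The two values of \<open>D\<close>
  answer conflicting needs. With \<open>D = 2\<close> only \<open>O(m)\<close> are left, and
  \<open>O(k m)\<close> fits into \<open>Z\<close> as \<open>k\<close> is small against
  \<open>log n\<close>. Each of the three rounds (absorbers, long paths, last connections) must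
  start with expansion into free vertices, so \<open>W\<close> is first split to give every round an
  expanding set of its own.\<close>

locale joined_graph =
  fixes V :: "'a set" and Nb :: "'a \<Rightarrow> 'a set" and m :: nat
  assumes finite_V: "finite V"
    and Nb_subset: "Nb v \<subseteq> V"
    and Nb_sym: "u \<in> Nb v \<Longrightarrow> v \<in> Nb u"
    and joined: "X \<subseteq> V \<Longrightarrow> Y \<subseteq> V \<Longrightarrow> X \<inter> Y = {} \<Longrightarrow> card X = m \<Longrightarrow> card Y = m \<Longrightarrow>
      \<exists>x\<in>X. \<exists>y\<in>Y. y \<in> Nb x"
    and m_pos: "1 \<le> m"
begin

definition nbhds :: "'a set \<Rightarrow> 'a set" where
  "nbhds U = (\<Union>u\<in>U. Nb u)"

text \<open>
  Here \<open>F\<close> contains the vertices already used and those never to be used, and \<open>g v\<close> is the degree spent at \<open>v\<close>. In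
  contrast to the usual definition, a new leaf does not spend degree by being attached; the natural subtraction
  turns vertices with no degree left into vertices without demand.
\<close>

definition extendable :: "nat \<Rightarrow> 'a set \<Rightarrow> ('a \<Rightarrow> nat) \<Rightarrow> bool" where
  "extendable D F g \<longleftrightarrow> (\<forall>U\<subseteq>V. card U \<le> 2 * m \<longrightarrow> (\<Sum>u\<in>U. D - g u) \<le> card (nbhds U - F))"

lemma nbhds_subset: "nbhds U \<subseteq> V"
  using Nb_subset by (auto simp: nbhds_def)

lemma finite_nbhds [simp]: "finite (nbhds U)"
  using nbhds_subset finite_V by (rule finite_subset)

lemma nbhds_Un: "nbhds (A \<union> B) = nbhds A \<union> nbhds B"
  by (auto simp: nbhds_def)

lemma nbhds_mono: "A \<subseteq> B \<Longrightarrow> nbhds A \<subseteq> nbhds B"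
  by (auto simp: nbhds_def)

lemma extendable_mono:
  assumes "extendable D F g" and "\<And>v. v \<in> V \<Longrightarrow> g v \<le> g' v"
  shows "extendable D F g'"
  unfolding extendable_def
proof (intro allI impI)
  fix U assume U: "U \<subseteq> V" "card U \<le> 2 * m"
  have "(\<Sum>u\<in>U. D - g' u) \<le> (\<Sum>u\<in>U. D - g u)"
    using assms(2) U by (intro sum_mono diff_le_mono2) auto
  also have "\<dots> \<le> card (nbhds U - F)"
    using assms(1) U by (simp add: extendable_def)
  finally show "(\<Sum>u\<in>U. D - g' u) \<le> card (nbhds U - F)" .
qed

text \<open>The vertices outside \<open>F\<close> that lie neither in an \<open>m\<close>-subset of
  \<open>U\<close> nor in its neighbourhood send no edge to it, so there are fewer than
  \<open>m\<close> of them; the subset itself accounts for the other \<open>m\<close>.\<close>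

lemma card_nbhds_large:
  assumes "U \<subseteq> V" "m \<le> card U"
  shows "card (V - F) \<le> card (nbhds U - F) + 2 * m"
proof -
  obtain U' where U': "U' \<subseteq> U" "card U' = m" "finite U'"
    using obtain_subset_with_card_n[OF assms(2)] by metis
  define Y where "Y = V - F - nbhds U' - U'"
  have "card Y < m"
  proof (rule ccontr)
    assume "\<not> card Y < m"
    then obtain Y' where Y': "Y' \<subseteq> Y" "card Y' = m"
      using obtain_subset_with_card_n[of m Y] by auto
    have "\<exists>x\<in>U'. \<exists>y\<in>Y'. y \<in> Nb x"
      using Y' U' assms(1) by (intro joined) (auto simp: Y_def)
    then show False
      using Y' by (auto simp: Y_def nbhds_def)
  qed
  moreover have "card (V - F) \<le> card ((nbhds U - F) \<union> U' \<union> Y)"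
    using nbhds_mono[OF U'(1)] finite_V U' by (intro card_mono) (auto simp: Y_def)
  moreover have "\<dots> \<le> card (nbhds U - F) + card U' + card Y"
    by (meson add_le_mono1 card_Un_le le_trans)
  ultimately show ?thesis using U' by simp
qed

text \<open>Sets below \<open>m\<close> expand into \<open>C\<close>, and sets from \<open>m\<close>
  to \<open>2 * m\<close> are served by joinedness: \<open>room\<close> is their largest demand
  \<open>2 * m * D\<close> plus the \<open>2 * m\<close> vertices lost in
  \<open>card_nbhds_large\<close>.\<close>

lemma extendable_init:
  assumes exp: "\<And>U. U \<subseteq> V \<Longrightarrow> 1 \<le> card U \<Longrightarrow> card U < m \<Longrightarrow> D * card U \<le> card (nbhds U \<inter> C)"
    and "C \<inter> F = {}" and room: "(2 * D + 2) * m \<le> card (V - F)"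
  shows "extendable D F (\<lambda>_. 0)"
  unfolding extendable_def
proof (intro allI impI)
  fix U assume U: "U \<subseteq> V" "card U \<le> 2 * m"
  have fU: "finite U" using U finite_V finite_subset by auto
  consider "card U = 0" | "1 \<le> card U" "card U < m" | "m \<le> card U" by linarith
  then show "(\<Sum>u\<in>U. D - 0) \<le> card (nbhds U - F)"
  proof cases
    case 1
    then show ?thesis using fU by simp
  next
    case 2
    have "card (nbhds U \<inter> C) \<le> card (nbhds U - F)"
      using assms(2) by (intro card_mono) auto
    then show ?thesis using exp[OF U(1) 2] by (simp add: mult.commute)
  next
    case 3
    have "card U * D \<le> 2 * m * D" using U by (intro mult_right_mono) auto
    moreover have "2 * m * D + 2 * m \<le> card (V - F)" using room by (simp add: algebra_simps)
    moreover have "(\<Sum>u\<in>U. D - 0) = card U * D" by simp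
    ultimately show ?thesis using card_nbhds_large[OF U(1) 3, of F] by linarith
  qed
qed

text \<open>Uncrossing: the demand is modular in \<open>U\<close> and the number of free neighbours
  is submodular. Sizes below \<open>m\<close> keep the union within the bound \<open>2 * m\<close>
  of \<open>extendable\<close>.\<close>

lemma tight_union:
  assumes E: "extendable D F g" and A: "A \<subseteq> V" "card A < m" "(\<Sum>u\<in>A. D - g u) = card (nbhds A - F)"
    and B: "B \<subseteq> V" "card B < m" "(\<Sum>u\<in>B. D - g u) = card (nbhds B - F)"
  shows "(\<Sum>u\<in>A \<union> B. D - g u) = card (nbhds (A \<union> B) - F)"
proof -
  have fin: "finite A" "finite B" using A B finite_V finite_subset by auto
  have "card (A \<inter> B) \<le> card A" "card (A \<union> B) \<le> card A + card B"
    using fin by (auto intro: card_mono card_Un_le)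
  then have c: "card (A \<inter> B) \<le> 2 * m" "card (A \<union> B) \<le> 2 * m" using A B by auto
  have 1: "(\<Sum>u\<in>A \<inter> B. D - g u) \<le> card (nbhds (A \<inter> B) - F)"
    using E[unfolded extendable_def, rule_format, of "A \<inter> B"] A c by blast
  have 2: "(\<Sum>u\<in>A \<union> B. D - g u) \<le> card (nbhds (A \<union> B) - F)"
    using E[unfolded extendable_def, rule_format, of "A \<union> B"] A B c by blast
  have 3: "card (nbhds (A \<inter> B) - F) \<le> card ((nbhds A - F) \<inter> (nbhds B - F))"
    by (intro card_mono finite_Int disjI1 finite_Diff finite_nbhds) (auto simp: nbhds_def)
  have 4: "card (nbhds A - F) + card (nbhds B - F)
      = card (nbhds (A \<union> B) - F) + card ((nbhds A - F) \<inter> (nbhds B - F))"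
    using card_Un_Int[of "nbhds A - F" "nbhds B - F"] by (simp add: nbhds_Un Un_Diff)
  have 5: "(\<Sum>u\<in>A. D - g u) + (\<Sum>u\<in>B. D - g u) = (\<Sum>u\<in>A \<union> B. D - g u) + (\<Sum>u\<in>A \<inter> B. D - g u)"
    using sum.union_inter[OF fin] by metis
  show ?thesis using 1 2 3 4 5 A B by linarith
qed

text \<open>The Friedman-Pippenger step. If every free neighbour \<open>y\<close> of
  \<open>s\<close> is a bad choice, each is blocked by a small tight set with \<open>y\<close> in
  its neighbourhood, and by uncrossing one tight set \<open>U\<close> has them all. Adding
  \<open>s\<close> to \<open>U\<close> raises the demand by the positive amount
  \<open>D - g s\<close> and supplies no new free neighbour.\<close>

lemma add_leaf:
  assumes E: "extendable D F g" and s: "s \<in> V" "g s < D"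
    and room: "(2 * D + 2) * m + 1 \<le> card (V - F)"
  shows "\<exists>y\<in>Nb s - F. extendable D (insert y F) (g(s := g s + 1))"
proof (rule ccontr)
  let ?g = "g(s := g s + 1)"
  assume no: "\<not> ?thesis"
  have tight: "\<exists>U\<subseteq>V. card U < m \<and> s \<notin> U \<and> (\<Sum>u\<in>U. D - g u) = card (nbhds U - F) \<and> y \<in> nbhds U"
    if y: "y \<in> Nb s - F" for y
  proof -
    obtain U where U: "U \<subseteq> V" "card U \<le> 2 * m" "card (nbhds U - insert y F) < (\<Sum>u\<in>U. D - ?g u)"
      using no y by (auto simp: extendable_def not_le)
    have fU: "finite U" using U finite_V finite_subset by auto
    have le: "(\<Sum>u\<in>U. D - g u) \<le> card (nbhds U - F)"
      using E U by (auto simp: extendable_def)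
    have eq: "nbhds U - insert y F = (nbhds U - F) - {y}" by auto
    have c1: "card (nbhds U - F) - 1 \<le> card (nbhds U - insert y F)"
      unfolding eq using finite_nbhds by (simp add: card_Diff_singleton_if)
    \<comment> \<open>If \<open>s\<close> were in \<open>U\<close>, the unit of degree spent at
      \<open>s\<close> would pay for the loss of \<open>y\<close>.\<close>
    have sU: "s \<notin> U"
    proof
      assume "s \<in> U"
      then have "(\<Sum>u\<in>U. D - ?g u) = (\<Sum>u\<in>U - {s}. D - g u) + (D - g s - 1)"
        "(\<Sum>u\<in>U. D - g u) = (\<Sum>u\<in>U - {s}. D - g u) + (D - g s)"
        using fU by (auto simp: sum.remove)
      then show False using U(3) c1 le s(2) by linarith
    qed
    then have same: "(\<Sum>u\<in>U. D - ?g u) = (\<Sum>u\<in>U. D - g u)"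
      by (intro sum.cong) auto
    have yU: "y \<in> nbhds U"
    proof (rule ccontr)
      assume "y \<notin> nbhds U"
      then have "nbhds U - insert y F = nbhds U - F" by auto
      then show False using U(3) same le by simp
    qed
    have t: "(\<Sum>u\<in>U. D - g u) = card (nbhds U - F)"
      using U(3) same le c1 by linarith
    \<comment> \<open>With \<open>m\<close> or more vertices, \<open>U\<close> would have nearly all
      of \<open>V - F\<close> as neighbours, more than the demand of at most
      \<open>2 * m * D\<close> that it meets with equality. The \<open>1\<close> in
      \<open>room\<close> makes this strict.\<close>
    have "card U < m"
    proof (rule ccontr)
      assume "\<not> card U < m"
      then have "card (V - F) \<le> card (nbhds U - F) + 2 * m"
        using card_nbhds_large U(1) by simp
      moreover have "(\<Sum>u\<in>U. D - g u) \<le> card U * D"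
        using sum_bounded_above[of U "\<lambda>u. D - g u" D] by simp
      moreover have "card U * D \<le> 2 * m * D" using U by (intro mult_right_mono) auto
      moreover have "2 * m * D + 2 * m + 1 \<le> card (V - F)" using room by (simp add: algebra_simps)
      ultimately show False using t by linarith
    qed
    then show ?thesis using U(1) sU yU t by blast
  qed
  have fin: "finite (Nb s - F)" using Nb_subset finite_V by (meson finite_Diff finite_subset)
  have "\<exists>U\<subseteq>V. card U < m \<and> s \<notin> U \<and> (\<Sum>u\<in>U. D - g u) = card (nbhds U - F) \<and> Y \<subseteq> nbhds U"
    if "finite Y" "Y \<subseteq> Nb s - F" for Y
    using that
  proof (induction Y rule: finite_induct)
    case empty
    show ?case using m_pos by (intro exI[of _ "{}"]) (auto simp: nbhds_def)
  next
    case (insert y Y)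
    obtain A where A: "A \<subseteq> V" "card A < m" "s \<notin> A" "(\<Sum>u\<in>A. D - g u) = card (nbhds A - F)" "Y \<subseteq> nbhds A"
      using insert by auto
    obtain B where B: "B \<subseteq> V" "card B < m" "s \<notin> B" "(\<Sum>u\<in>B. D - g u) = card (nbhds B - F)" "y \<in> nbhds B"
      using tight[of y] insert by auto
    have t: "(\<Sum>u\<in>A \<union> B. D - g u) = card (nbhds (A \<union> B) - F)"
      using tight_union[OF E A(1,2,4) B(1,2,4)] .
    \<comment> \<open>The union may have up to \<open>2 * m - 2\<close> vertices, but being tight it
      falls back below \<open>m\<close> by the same count, and so the induction can
      continue.\<close>
    have "card (A \<union> B) < m"
    proof (rule ccontr)
      assume "\<not> card (A \<union> B) < m"
      then have "card (V - F) \<le> card (nbhds (A \<union> B) - F) + 2 * m"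
        using card_nbhds_large A B by simp
      moreover have "(\<Sum>u\<in>A \<union> B. D - g u) \<le> card (A \<union> B) * D"
        using sum_bounded_above[of "A \<union> B" "\<lambda>u. D - g u" D] by simp
      moreover have "card (A \<union> B) * D \<le> 2 * m * D"
        using card_Un_le[of A B] A B by (intro mult_right_mono) auto
      moreover have "2 * m * D + 2 * m + 1 \<le> card (V - F)" using room by (simp add: algebra_simps)
      ultimately show False using t by linarith
    qed
    then show ?case using A B t by (intro exI[of _ "A \<union> B"]) (auto simp: nbhds_Un)
  qed
  from this[OF fin subset_refl] obtain U where U: "U \<subseteq> V" "card U < m" "s \<notin> U"
    "(\<Sum>u\<in>U. D - g u) = card (nbhds U - F)" "Nb s - F \<subseteq> nbhds U" by blast
  have fU: "finite U" using U finite_V finite_subset by auto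
  have "nbhds (insert s U) - F = nbhds U - F" using U(5) by (auto simp: nbhds_def)
  moreover have "(\<Sum>u\<in>insert s U. D - g u) \<le> card (nbhds (insert s U) - F)"
    using U(2,3) fU m_pos U(1) s(1) by (intro E[unfolded extendable_def, rule_format]) auto
  moreover have "(\<Sum>u\<in>insert s U. D - g u) = (D - g s) + (\<Sum>u\<in>U. D - g u)"
    using U(3) fU by simp
  ultimately show False using U(4) s by simp
qed

section \<open>Growing and pruning forests\<close>

text \<open>
  A forest \<open>T\<close> grown out of \<open>F\<close> is kept as a parent function, so that all superfluous branches can
  be discarded in a single step (lemma \<open>forest_restrict\<close>).
\<close>

definition forest :: "nat \<Rightarrow> 'a set \<Rightarrow> ('a \<Rightarrow> nat) \<Rightarrow> 'a set \<Rightarrow> ('a \<Rightarrow> 'a) \<Rightarrow> bool" where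
  "forest D F g T par \<longleftrightarrow> T \<subseteq> V - F \<and> (\<forall>y\<in>T. y \<in> Nb (par y) \<and> par y \<in> F \<union> T) \<and>
     extendable D (F \<union> T) (\<lambda>v. g v + card {y\<in>T. par y = v})"

lemma forest_finite: "forest D F g T par \<Longrightarrow> finite T"
  using finite_V by (auto simp: forest_def intro: finite_subset)

lemma forest_grow:
  assumes f: "forest D F g T par" and s: "s \<in> V \<inter> (F \<union> T)" "g s + card {y\<in>T. par y = s} < D"
    and room: "(2 * D + 2) * m + 1 + card T \<le> card (V - F)"
  shows "\<exists>y. y \<in> V - F - T \<and> y \<in> Nb s \<and> forest D F g (insert y T) (par(y := s))"
proof -
  have fT: "finite T" using forest_finite[OF f] .
  have "card (V - (F \<union> T)) = card (V - F) - card T"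
    using f fT card_Diff_subset[of T "V - F"] by (simp add: forest_def set_diff_eq conj_ac)
  then have r: "(2 * D + 2) * m + 1 \<le> card (V - (F \<union> T))" using room by simp
  obtain y where y: "y \<in> Nb s - (F \<union> T)" and
    E: "extendable D (insert y (F \<union> T)) ((\<lambda>v. g v + card {y\<in>T. par y = v})(s := g s + card {y\<in>T. par y = s} + 1))"
    using add_leaf[of D "F \<union> T" "\<lambda>v. g v + card {y\<in>T. par y = v}" s] f s r
    by (auto simp: forest_def)
  have cnt: "card {z\<in>insert y T. (par(y := s)) z = v} = card {z\<in>T. par z = v} + (if v = s then 1 else 0)" for v
  proof -
    have "{z\<in>insert y T. (par(y := s)) z = v} = (if v = s then insert y {z\<in>T. par z = v} else {z\<in>T. par z = v})"
      using y by auto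
    then show ?thesis using fT y by simp
  qed
  have "extendable D (F \<union> insert y T) (\<lambda>v. g v + card {z\<in>insert y T. (par(y := s)) z = v})"
    unfolding cnt using extendable_mono[OF E] by simp
  then show ?thesis
    using y f s(1) Nb_subset by (intro exI[of _ y]) (auto simp: forest_def)
qed

text \<open>Discarding \<open>T - P\<close> raises the demand of a vertex by at most the number of
  its discarded children. These are neighbours that become free again, and different parents have
  different children, so the supply grows at least as much as the demand.\<close>

lemma forest_restrict:
  assumes f: "forest D F g T par" and P: "P \<subseteq> T"
  shows "extendable D (F \<union> P) (\<lambda>v. g v + card {y\<in>P. par y = v})"
  unfolding extendable_def
proof (intro allI impI)
  fix U assume U: "U \<subseteq> V" "card U \<le> 2 * m"
  have fT: "finite T" using forest_finite[OF f] .
  have fU: "finite U" using U finite_V finite_subset by auto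
  let ?c = "\<lambda>S v. card {y\<in>S. par y = v}"
  have split: "?c T v = ?c P v + ?c (T - P) v" for v
  proof -
    have "{y\<in>T. par y = v} = {y\<in>P. par y = v} \<union> {y\<in>T - P. par y = v}" using P by auto
    moreover have "card ({y\<in>P. par y = v} \<union> {y\<in>T - P. par y = v}) = ?c P v + ?c (T - P) v"
      using fT finite_subset[OF P fT] by (intro card_Un_disjoint) auto
    ultimately show ?thesis by simp
  qed
  have "(\<Sum>u\<in>U. D - (g u + ?c P u)) \<le> (\<Sum>u\<in>U. (D - (g u + ?c T u)) + ?c (T - P) u)"
    by (intro sum_mono) (auto simp: split)
  also have "\<dots> = (\<Sum>u\<in>U. D - (g u + ?c T u)) + (\<Sum>u\<in>U. ?c (T - P) u)"
    by (simp add: sum.distrib)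
  also have "(\<Sum>u\<in>U. ?c (T - P) u) = card (\<Union>u\<in>U. {y\<in>T - P. par y = u})"
    using fU fT by (intro card_UN_disjoint[symmetric]) auto
  also have "\<dots> \<le> card (nbhds U \<inter> (T - P))"
    using f by (intro card_mono finite_Int disjI1 finite_nbhds) (auto simp: forest_def nbhds_def)
  also have "(\<Sum>u\<in>U. D - (g u + ?c T u)) \<le> card (nbhds U - (F \<union> T))"
    using f U by (auto simp: forest_def extendable_def)
  finally have "(\<Sum>u\<in>U. D - (g u + ?c P u)) \<le> card (nbhds U - (F \<union> T)) + card (nbhds U \<inter> (T - P))"
    by simp
  also have "\<dots> = card ((nbhds U - (F \<union> T)) \<union> (nbhds U \<inter> (T - P)))"
    by (intro card_Un_disjoint[symmetric]) auto
  also have "\<dots> \<le> card (nbhds U - (F \<union> P))"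
    using f P by (intro card_mono) (auto simp: forest_def)
  finally show "(\<Sum>u\<in>U. D - (g u + ?c P u)) \<le> card (nbhds U - (F \<union> P))" .
qed

text \<open>A vertex occurs in \<open>ss\<close> once for each child it is to get, so
  \<open>count_list\<close> is the degree about to be spent there.\<close>

lemma forest_grow_many:
  assumes "forest D F g T par" "set ss \<subseteq> V \<inter> (F \<union> T)"
    and "\<And>s. s \<in> set ss \<Longrightarrow> g s + card {y\<in>T. par y = s} + count_list ss s \<le> D"
    and "(2 * D + 2) * m + length ss + card T \<le> card (V - F)"
  shows "\<exists>ys par'. length ys = length ss \<and> distinct ys \<and> set ys \<subseteq> V - F - T \<and>
    (\<forall>i<length ss. par' (ys ! i) = ss ! i) \<and> (\<forall>t\<in>T. par' t = par t) \<and>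
    forest D F g (T \<union> set ys) par'"
  using assms
proof (induction ss arbitrary: T par)
  case Nil
  then show ?case by (intro exI[of _ "[]"] exI[of _ par]) auto
next
  case (Cons s ss)
  have fT: "finite T" using forest_finite[OF Cons.prems(1)] .
  have "g s + card {y\<in>T. par y = s} < D" using Cons.prems(3)[of s] by simp
  then obtain y where y: "y \<in> V - F - T" "y \<in> Nb s" "forest D F g (insert y T) (par(y := s))"
    using forest_grow[OF Cons.prems(1), of s] Cons.prems(2,4) by auto
  have cnt: "card {z\<in>insert y T. (par(y := s)) z = v} = card {z\<in>T. par z = v} + (if v = s then 1 else 0)" for v
  proof -
    have "{z\<in>insert y T. (par(y := s)) z = v} = (if v = s then insert y {z\<in>T. par z = v} else {z\<in>T. par z = v})"
      using y by auto
    then show ?thesis using fT y by simp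
  qed
  have "\<exists>ys par'. length ys = length ss \<and> distinct ys \<and> set ys \<subseteq> V - F - insert y T \<and>
    (\<forall>i<length ss. par' (ys ! i) = ss ! i) \<and> (\<forall>t\<in>insert y T. par' t = (par(y := s)) t) \<and>
    forest D F g (insert y T \<union> set ys) par'"
  proof (rule Cons.IH[OF y(3)])
    show "set ss \<subseteq> V \<inter> (F \<union> insert y T)" using Cons.prems(2) by auto
    show "(2 * D + 2) * m + length ss + card (insert y T) \<le> card (V - F)"
      using Cons.prems(4) y(1) fT by simp
    fix t assume "t \<in> set ss"
    then show "g t + card {z\<in>insert y T. (par(y := s)) z = t} + count_list ss t \<le> D"
      using Cons.prems(3)[of t] unfolding cnt by (auto split: if_splits)
  qed
  then obtain ys par' where ys: "length ys = length ss" "distinct ys" "set ys \<subseteq> V - F - insert y T"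
    "\<forall>i<length ss. par' (ys ! i) = ss ! i" "\<forall>t\<in>insert y T. par' t = (par(y := s)) t"
    "forest D F g (insert y T \<union> set ys) par'" by blast
  have "forest D F g (T \<union> set (y # ys)) par'" using ys(6) by simp
  moreover have "\<forall>t\<in>T. par' t = par t" using ys(5) y(1) by auto
  moreover have "\<forall>i<length (s # ss). par' ((y # ys) ! i) = (s # ss) ! i"
    using ys(4,5) by (auto simp: nth_Cons split: nat.split)
  ultimately show ?case using ys y by (intro exI[of _ "y # ys"] exI[of _ par']) auto
qed

text \<open>The childless last vertex is what a tree needs as its root: by \<open>g0\<close> nothing
  is spent outside \<open>F\<close>, so its whole degree is left.\<close>

lemma forest_grow_path:
  assumes f: "forest D F g T par" and s: "s \<in> V \<inter> (F \<union> T)" "g s + card {y\<in>T. par y = s} < D"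
    and g0: "\<And>v. v \<notin> F \<Longrightarrow> g v = 0"
    and room: "(2 * D + 2) * m + Suc r + card T \<le> card (V - F)"
  shows "\<exists>ps par'. length ps = Suc r \<and> distinct ps \<and> set ps \<subseteq> V - F - T \<and>
    successively (\<lambda>u v. par' v = u) (s # ps) \<and> (\<forall>t\<in>T. par' t = par t) \<and>
    forest D F g (T \<union> set ps) par' \<and> {y\<in>T \<union> set ps. par' y = last ps} = {}"
  using room
proof (induction r)
  case 0
  obtain y where y: "y \<in> V - F - T" "y \<in> Nb s" "forest D F g (insert y T) (par(y := s))"
    using forest_grow[OF f s] 0 by auto
  have "\<forall>t\<in>T. par t \<in> F \<union> T" using f by (simp add: forest_def)
  then have "{z\<in>T \<union> set [y]. (par(y := s)) z = last [y]} = {}" using y(1) s(1) by auto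
  moreover have "forest D F g (T \<union> set [y]) (par(y := s))" using y(3) by simp
  moreover have "\<forall>t\<in>T. (par(y := s)) t = par t" using y(1) by auto
  moreover have "successively (\<lambda>u v. (par(y := s)) v = u) (s # [y])" by simp
  ultimately show ?case using y(1)
    by (intro exI[of _ "[y]"] exI[of _ "par(y := s)"] conjI) (auto simp del: fun_upd_apply)
next
  case (Suc r)
  then obtain ps par' where ps: "length ps = Suc r" "distinct ps" "set ps \<subseteq> V - F - T"
    "successively (\<lambda>u v. par' v = u) (s # ps)" "\<forall>t\<in>T. par' t = par t"
    "forest D F g (T \<union> set ps) par'" "{y\<in>T \<union> set ps. par' y = last ps} = {}" by auto
  have ne: "ps \<noteq> []" using ps(1) by auto
  have fT: "finite T" using forest_finite[OF f] .
  have cT: "card (T \<union> set ps) = card T + Suc r"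
    using ps fT by (subst card_Un_disjoint) (auto simp: distinct_card)
  have l: "last ps \<in> set ps" using ne by simp
  then have "last ps \<notin> F" "last ps \<in> V" using ps(3) by auto
  then have "g (last ps) + card {y\<in>T \<union> set ps. par' y = last ps} < D"
    using g0 s(2) unfolding ps(7) by simp
  then obtain y where y: "y \<in> V - F - (T \<union> set ps)" "y \<in> Nb (last ps)"
    "forest D F g (insert y (T \<union> set ps)) (par'(y := last ps))"
    using forest_grow[OF ps(6), of "last ps"] Suc.prems cT l \<open>last ps \<in> V\<close> by auto
  have "\<forall>t\<in>T \<union> set ps. par' t \<in> F \<union> (T \<union> set ps)" using ps(6) by (simp add: forest_def)
  then have "{z\<in>T \<union> set (ps @ [y]). (par'(y := last ps)) z = last (ps @ [y])} = {}"
    using y(1) l by auto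
  moreover have "successively (\<lambda>u v. (par'(y := last ps)) v = u) (s # (ps @ [y]))"
  proof -
    have "successively (\<lambda>u v. (par'(y := last ps)) v = u) (s # ps)"
      using y(1) s(1) by (intro successively_mono[OF ps(4)]) auto
    then show ?thesis using ne by (auto simp: successively_append_iff successively_Cons)
  qed
  moreover have "\<forall>t\<in>T. (par'(y := last ps)) t = par t" using y(1) ps(5) by auto
  moreover have "forest D F g (T \<union> set (ps @ [y])) (par'(y := last ps))" using y(3) by simp
  ultimately show ?case using ps y
    by (intro exI[of _ "ps @ [y]"] exI[of _ "par'(y := last ps)"] conjI) (auto simp del: fun_upd_apply)
qed

lemma count_list_concat_replicate:
  "count_list (concat (map (replicate D) ls)) v = D * count_list ls v"
proof (induction ls)
  case (Cons a ls)
  have "count_list (replicate D a) v = (if a = v then D else 0)" by (induction D) auto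
  then show ?case using Cons by simp
qed simp

lemma count_list_take_le: "count_list (take n xs) v \<le> count_list xs v"
  by (metis append_take_drop_id count_list_append le_add1)

text \<open>The leaves lie at the exact depth \<open>k\<close> because path lengths are prescribed.
  The last level hangs on about \<open>M / D\<close> leaves one level up, so with \<open>D\<close>
  at least \<open>2\<close> the levels halve up to rounding and the whole tree costs at most
  \<open>2 * M + k\<close> vertices.\<close>

lemma forest_grow_tree:
  assumes f: "forest D F g T par" and s: "s \<in> T" "{y\<in>T. par y = s} = {}"
    and g0: "\<And>v. v \<notin> F \<Longrightarrow> g v = 0"
    and D: "2 \<le> D" and M: "1 \<le> M" "M \<le> D ^ k"
    and room: "(2 * D + 2) * m + (2 * M + k) + card T \<le> card (V - F)"
  shows "\<exists>T' par' L. forest D F g T' par' \<and> T \<subseteq> T' \<and> card T' \<le> card T + (2 * M + k) \<and>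
    (\<forall>t\<in>T. par' t = par t) \<and> (\<forall>t\<in>T' - T. par' t \<in> T') \<and> L \<subseteq> T' \<and> card L = M \<and>
    (\<forall>u\<in>L. {y\<in>T'. par' y = u} = {}) \<and>
    (\<forall>u\<in>L. \<exists>ps. length ps = Suc k \<and> hd ps = s \<and> last ps = u \<and> distinct ps \<and>
       set (tl ps) \<subseteq> T' - T \<and> successively (\<lambda>u v. par' v = u) ps)"
  using M room
proof (induction k arbitrary: M)
  case 0
  then have "M = 1" by simp
  then show ?case using f s
    by (intro exI[of _ T] exI[of _ par] exI[of _ "{s}"]) (auto intro!: exI[of _ "[s]"])
next
  case (Suc k)
  \<comment> \<open>\<open>M / D\<close> rounded up, the least number of parents that can carry
    \<open>M\<close> children.\<close>
  define M' where "M' = (M + D - 1) div D"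
  have M'1: "1 \<le> M'" using Suc.prems D by (simp add: M'_def div_greater_zero_iff Suc_le_eq)
  have M'2: "M \<le> D * M'"
  proof -
    have "D * ((M + D - 1) div D) + (M + D - 1) mod D = M + D - 1" by simp
    moreover have "(M + D - 1) mod D < D" using D by simp
    ultimately show ?thesis unfolding M'_def using D by linarith
  qed
  have M'3: "M' \<le> D ^ k"
  proof -
    have "M + D - 1 < D * (D ^ k + 1)" using Suc.prems(2) D by simp
    then have "M' < D ^ k + 1" unfolding M'_def using D
      by (simp add: less_mult_imp_div_less mult.commute)
    then show ?thesis by simp
  qed
  \<comment> \<open>This closes the budget: \<open>2 * M' + k\<close> for the smaller tree and
    \<open>M\<close> for the new leaves make at most \<open>2 * M + Suc k\<close>.\<close>
  have M'4: "2 * M' \<le> M + 1"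
  proof -
    have "D * M' \<le> M + D - 1" unfolding M'_def by simp
    moreover have "2 * (M' - 1) \<le> D * (M' - 1)" using D by simp
    moreover have "D * (M' - 1) = D * M' - D" by (simp add: diff_mult_distrib2)
    moreover have "2 * (M' - 1) = 2 * M' - 2" by simp
    ultimately show ?thesis using D M'1 Suc.prems(1) by linarith
  qed
  have "(2 * D + 2) * m + (2 * M' + k) + card T \<le> card (V - F)" using Suc.prems(3) M'4 by simp
  from Suc.IH[OF M'1 M'3 this] obtain T1 par1 L where
    1: "forest D F g T1 par1" "T \<subseteq> T1" "card T1 \<le> card T + (2 * M' + k)"
    "\<forall>t\<in>T. par1 t = par t" "\<forall>t\<in>T1 - T. par1 t \<in> T1" "L \<subseteq> T1" "card L = M'"
    "\<forall>u\<in>L. {y\<in>T1. par1 y = u} = {}" and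
    paths: "\<forall>u\<in>L. \<exists>ps. length ps = Suc k \<and> hd ps = s \<and> last ps = u \<and> distinct ps \<and>
       set (tl ps) \<subseteq> T1 - T \<and> successively (\<lambda>u v. par1 v = u) ps" by blast
  have fT1: "finite T1" using forest_finite[OF 1(1)] .
  obtain ls where ls: "set ls = L" "distinct ls" using finite_distinct_list finite_subset[OF 1(6) fT1] by blast
  have len: "length ls = M'" using ls 1(7) distinct_card by fastforce
  \<comment> \<open>\<open>D\<close> slots for each parent, cut off after \<open>M\<close>; the last
    parent may get fewer children.\<close>
  define ss where "ss = take M (concat (map (replicate D) ls))"
  have "length (concat (map (replicate D) ls)) = D * M'"
    by (simp add: length_concat comp_def sum_list_triv len mult.commute)
  then have lss: "length ss = M" using M'2 by (simp add: ss_def)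
  have sss: "set ss \<subseteq> L"
    using set_take_subset[of M "concat (map (replicate D) ls)"] ls by (auto simp: ss_def)
  have LV: "L \<subseteq> V - F" using 1 by (auto simp: forest_def)
  have cnt: "count_list ss t \<le> D" for t
  proof -
    have "count_list ss t \<le> D * count_list ls t"
      unfolding ss_def using count_list_take_le count_list_concat_replicate by metis
    moreover have "count_list ls t \<le> 1" using ls(2)
      by (induction ls) auto
    ultimately show ?thesis using mult_le_mono2[of "count_list ls t" 1 D] by linarith
  qed
  have "\<exists>ys par'. length ys = length ss \<and> distinct ys \<and> set ys \<subseteq> V - F - T1 \<and>
    (\<forall>i<length ss. par' (ys ! i) = ss ! i) \<and> (\<forall>t\<in>T1. par' t = par1 t) \<and>
    forest D F g (T1 \<union> set ys) par'"
  proof (rule forest_grow_many[OF 1(1)])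
    show "set ss \<subseteq> V \<inter> (F \<union> T1)" using sss LV 1(6) by auto
    show "(2 * D + 2) * m + length ss + card T1 \<le> card (V - F)"
      using Suc.prems(3) M'4 1(3) lss by linarith
    fix t assume "t \<in> set ss"
    then have "t \<in> L" using sss by auto
    then have "g t = 0" "{y\<in>T1. par1 y = t} = {}" using g0 LV 1(8) by auto
    then show "g t + card {y\<in>T1. par1 y = t} + count_list ss t \<le> D"
      using cnt[of t] by (simp del: Collect_empty_eq)
  qed
  then obtain ys par' where ys: "length ys = M" "distinct ys" "set ys \<subseteq> V - F - T1"
    "\<forall>i<M. par' (ys ! i) = ss ! i" "\<forall>t\<in>T1. par' t = par1 t"
    "forest D F g (T1 \<union> set ys) par'" using lss by auto
  have parys: "par' y \<in> L" if "y \<in> set ys" for y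
    using that ys lss sss by (metis in_set_conv_nth nth_mem subsetD)
  have par1T: "\<forall>t\<in>T1. par1 t \<in> F \<union> T1" using 1(1) by (simp add: forest_def)
  show ?case
  proof (rule exI[of _ "T1 \<union> set ys"], rule exI[of _ par'], rule exI[of _ "set ys"], intro conjI ballI)
    show "forest D F g (T1 \<union> set ys) par'" by fact
    show "T \<subseteq> T1 \<union> set ys" using 1(2) by auto
    have "card (T1 \<union> set ys) \<le> card T1 + M" using card_Un_le[of T1 "set ys"] ys
      by (simp add: distinct_card)
    then show "card (T1 \<union> set ys) \<le> card T + (2 * M + Suc k)" using 1(3) M'4 by simp
    show "par' t = par t" if "t \<in> T" for t using that ys(5) 1(2,4) by auto
    show "par' t \<in> T1 \<union> set ys" if "t \<in> T1 \<union> set ys - T" for t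
      using that ys(5) 1(5,6) parys by auto
    show "card (set ys) = M" using ys by (simp add: distinct_card)
    show "{y \<in> T1 \<union> set ys. par' y = u} = {}" if "u \<in> set ys" for u
      using that ys(3,5) par1T parys 1(6) by fastforce
    fix u assume u: "u \<in> set ys"
    obtain ps where ps: "length ps = Suc k" "hd ps = s" "last ps = par' u" "distinct ps"
       "set (tl ps) \<subseteq> T1 - T" "successively (\<lambda>u v. par1 v = u) ps"
      using paths parys[OF u] by blast
    have ne: "ps \<noteq> []" using ps(1) by auto
    have sub: "set ps \<subseteq> T1" using ne ps(2,5) s(1) 1(2) by (cases ps) auto
    have "successively (\<lambda>u v. par' v = u) ps"
      using ys(5) sub by (intro successively_mono[OF ps(6)]) auto
    then have "successively (\<lambda>u v. par' v = u) (ps @ [u])"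
      using ps(3) by (simp add: successively_append_iff)
    then show "\<exists>ps. length ps = Suc (Suc k) \<and> hd ps = s \<and> last ps = u \<and> distinct ps \<and>
       set (tl ps) \<subseteq> T1 \<union> set ys - T \<and> successively (\<lambda>u v. par' v = u) ps"
      using ps sub u ys(3) ne 1(2) by (intro exI[of _ "ps @ [u]"]) auto
  qed auto
qed

section \<open>Disjoint connections of prescribed lengths\<close>

lemma card_par_path:
  assumes "successively (\<lambda>u v. par v = u) (a # xs)" "distinct xs" "a \<notin> set xs"
  shows "card {y\<in>set xs. par y = v} \<le> (if v = a \<or> v \<in> set xs then 1 else 0)"
  using assms
proof (induction xs arbitrary: a)
  case (Cons x xs)
  have IH: "card {y\<in>set xs. par y = v} \<le> (if v = x \<or> v \<in> set xs then 1 else 0)"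
    using Cons by (intro Cons.IH) (auto simp: successively_Cons)
  have px: "par x = a" using Cons.prems by simp
  have pin: "par y \<in> insert x (set xs)" if "y \<in> set xs" for y
  proof -
    have "par y \<in> insert z (set ws)" if "successively (\<lambda>u v. par v = u) (z # ws)" "y \<in> set ws" for z ws
      using that by (induction ws arbitrary: z) (auto simp: successively_Cons)
    then show ?thesis using Cons.prems(1) that by (auto simp: successively_Cons)
  qed
  show ?case
  proof (cases "v = a")
    case True
    then have "{y\<in>set (x # xs). par y = v} = {x}"
      using Cons.prems(3) pin px by fastforce
    then show ?thesis using True by simp
  next
    case False
    then have "{y\<in>set (x # xs). par y = v} = {y\<in>set xs. par y = v}" using px by auto
    then show ?thesis using IH False by auto
  qed
qed simp

definition walk :: "'a list \<Rightarrow> bool" where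
  "walk = successively (\<lambda>u v. v \<in> Nb u)"

lemma walk_rev [simp]: "walk (rev xs) = walk xs"
  unfolding walk_def successively_rev by (rule successively_cong) (auto intro: Nb_sym)

text \<open>Trees with \<open>m\<close> leaves at depth \<open>k\<close> are grown from both ends,
  and joinedness gives an edge between the two sets of leaves. A path of \<open>Suc r\<close>
  vertices in front of the tree at \<open>a\<close> brings the length to exactly \<open>l\<close>;
  all other branches are then pruned. The trees need up to \<open>4 * m\<close> vertices besides the
  \<open>l\<close>, which together with the \<open>(2 * D + 2) * m\<close> of
  \<open>add_leaf\<close> makes \<open>(2 * D + 6) * m\<close>. The case \<open>a = b\<close> closes
  a cycle and spends two at \<open>a\<close>.\<close>

lemma connect:
  assumes E: "extendable D F g" and ab: "a \<in> V \<inter> F" "b \<in> V \<inter> F"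
    and deg: "g a + (if a = b then 2 else 1) \<le> D" "g b + 1 \<le> D"
    and g0: "\<And>v. v \<notin> F \<Longrightarrow> g v = 0"
    and D: "2 \<le> D" "m \<le> D ^ k" and l: "2 * k + 3 \<le> l"
    and room: "(2 * D + 6) * m + l \<le> card (V - F)"
  shows "\<exists>Q. length Q = l - 1 \<and> distinct Q \<and> set Q \<subseteq> V - F \<and> walk (a # Q @ [b]) \<and>
    extendable D (F \<union> set Q)
      (\<lambda>v. g v + (if v = a then 1 else 0) + (if v = b then 1 else 0) + (if v \<in> set Q then 1 else 0))"
proof -
  define r where "r = l - 2 * k - 3"
  have lr: "l = r + 2 * k + 3" using l by (simp add: r_def)
  have f0: "forest D F g {} id" using E by (simp add: forest_def)
  have rm: "(2 * D + 2) * m + 4 * m + l \<le> card (V - F)" using room by (simp add: algebra_simps)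
  obtain psA par1 where A: "length psA = Suc r" "distinct psA" "set psA \<subseteq> V - F - {}"
    "successively (\<lambda>u v. par1 v = u) (a # psA)" "forest D F g ({} \<union> set psA) par1"
    "{y\<in>{} \<union> set psA. par1 y = last psA} = {}"
    using forest_grow_path[OF f0, of a r] ab(1) deg(1) g0 rm lr by (auto split: if_splits)
  have neA: "psA \<noteq> []" using A(1) by auto
  have cA: "card (set psA) = Suc r" using A distinct_card by fastforce
  have "\<exists>T' par' L. forest D F g T' par' \<and> set psA \<subseteq> T' \<and> card T' \<le> card (set psA) + (2 * m + k) \<and>
    (\<forall>t\<in>set psA. par' t = par1 t) \<and> (\<forall>t\<in>T' - set psA. par' t \<in> T') \<and> L \<subseteq> T' \<and> card L = m \<and>
    (\<forall>u\<in>L. {y\<in>T'. par' y = u} = {}) \<and>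
    (\<forall>u\<in>L. \<exists>ps. length ps = Suc k \<and> hd ps = last psA \<and> last ps = u \<and> distinct ps \<and>
       set (tl ps) \<subseteq> T' - set psA \<and> successively (\<lambda>u v. par' v = u) ps)"
    using A neA m_pos D g0 rm lr cA by (intro forest_grow_tree) auto
  then obtain T2 par2 LA where B: "forest D F g T2 par2" "set psA \<subseteq> T2" "card T2 \<le> Suc r + (2 * m + k)"
    "\<forall>t\<in>set psA. par2 t = par1 t" "\<forall>t\<in>T2 - set psA. par2 t \<in> T2" "LA \<subseteq> T2" "card LA = m"
    and BL: "\<forall>u\<in>LA. \<exists>ps. length ps = Suc k \<and> hd ps = last psA \<and> last ps = u \<and> distinct ps \<and>
       set (tl ps) \<subseteq> T2 - set psA \<and> successively (\<lambda>u v. par2 v = u) ps"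
    unfolding cA by blast
  have T2F: "T2 \<subseteq> V - F" using B(1) by (simp add: forest_def)
  \<comment> \<open>Vertices added by the tree have their parents in \<open>T2\<close>, hence not
    \<open>b\<close>. Only the first vertex of the path can be a child of \<open>b\<close>, namely
    when \<open>a = b\<close>.\<close>
  have cb: "card {y\<in>T2. par2 y = b} \<le> (if a = b then 1 else 0)"
  proof -
    have "{y\<in>T2. par2 y = b} = {y\<in>set psA. par1 y = b}"
      using B(2,4,5) T2F ab by auto
    also have "card \<dots> \<le> (if b = a \<or> b \<in> set psA then 1 else 0)"
      using A ab by (intro card_par_path) auto
    finally show ?thesis using A(3) ab by (auto split: if_splits)
  qed
  have "g b + card {y\<in>T2. par2 y = b} < D" using cb deg by (auto split: if_splits)
  then obtain psB par3 where C: "length psB = Suc 0" "distinct psB" "set psB \<subseteq> V - F - T2"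
    "successively (\<lambda>u v. par3 v = u) (b # psB)" "\<forall>t\<in>T2. par3 t = par2 t"
    "forest D F g (T2 \<union> set psB) par3" "{y\<in>T2 \<union> set psB. par3 y = last psB} = {}"
    using forest_grow_path[OF B(1), of b 0] ab(2) g0 rm lr B(3) by auto
  obtain b' where b': "psB = [b']" using C(1) by (auto simp: length_Suc_conv)
  let ?T3 = "T2 \<union> {b'}"
  have cT3: "card ?T3 \<le> Suc (Suc r + (2 * m + k))"
    using B(3) card_Un_le[of T2 "{b'}"] by simp
  have "\<exists>T' par' L. forest D F g T' par' \<and> ?T3 \<subseteq> T' \<and> card T' \<le> card ?T3 + (2 * m + k) \<and>
    (\<forall>t\<in>?T3. par' t = par3 t) \<and> (\<forall>t\<in>T' - ?T3. par' t \<in> T') \<and> L \<subseteq> T' \<and> card L = m \<and>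
    (\<forall>u\<in>L. {y\<in>T'. par' y = u} = {}) \<and>
    (\<forall>u\<in>L. \<exists>ps. length ps = Suc k \<and> hd ps = b' \<and> last ps = u \<and> distinct ps \<and>
       set (tl ps) \<subseteq> T' - ?T3 \<and> successively (\<lambda>u v. par' v = u) ps)"
    using C b' m_pos D g0 rm lr cT3 by (intro forest_grow_tree) auto
  then obtain T4 par4 LB where G: "forest D F g T4 par4" "?T3 \<subseteq> T4" "\<forall>t\<in>?T3. par4 t = par3 t"
    "LB \<subseteq> T4" "card LB = m"
    and GL: "\<forall>u\<in>LB. \<exists>ps. length ps = Suc k \<and> hd ps = b' \<and> last ps = u \<and> distinct ps \<and>
       set (tl ps) \<subseteq> T4 - ?T3 \<and> successively (\<lambda>u v. par4 v = u) ps" by blast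
  have T4F: "T4 \<subseteq> V - F" using G(1) by (simp add: forest_def)
  have b'T: "b' \<notin> T2" using C(3) b' by auto
  have LBT: "u \<notin> T2" if u: "u \<in> LB" for u
  proof -
    obtain ps where ps: "length ps = Suc k" "hd ps = b'" "last ps = u" "set (tl ps) \<subseteq> T4 - ?T3"
      using GL u by blast
    have "u \<in> set ps" using ps(1,3) by (cases ps) auto
    then show ?thesis using b'T ps(2,4) by (cases ps) auto
  qed
  have "\<exists>u\<in>LA. \<exists>w\<in>LB. w \<in> Nb u"
    using B T2F T4F G LBT by (intro joined) auto
  then obtain u w where uw: "u \<in> LA" "w \<in> LB" "w \<in> Nb u" by blast
  obtain pA where pA: "length pA = Suc k" "hd pA = last psA" "last pA = u" "distinct pA"
       "set (tl pA) \<subseteq> T2 - set psA" "successively (\<lambda>u v. par2 v = u) pA" using BL uw by blast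
  obtain pB where pB: "length pB = Suc k" "hd pB = b'" "last pB = w" "distinct pB"
       "set (tl pB) \<subseteq> T4 - ?T3" "successively (\<lambda>u v. par4 v = u) pB" using GL uw by blast
  have pA_ne: "pA \<noteq> []" and pB_ne: "pB \<noteq> []" using pA(1) pB(1) by auto
  define XA where "XA = psA @ tl pA"
  define Q where "Q = XA @ rev pB"
  have sB: "set pB \<subseteq> T4 - T2"
    using pB(2,5) pB_ne b'T G(2) by (cases pB) auto
  have sA: "set XA \<subseteq> T2" using pA(5) B(2) by (auto simp: XA_def)
  have dA: "distinct XA" using A(2) pA(4,5) by (auto simp: XA_def distinct_tl)
  have lenQ: "length Q = l - 1"
    using A(1) pA(1) pB(1) by (simp add: Q_def XA_def lr)
  have dQ: "distinct Q" using dA pB(4) sA sB by (auto simp: Q_def)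
  have sQ: "set Q \<subseteq> T4" using sA sB G(2) by (auto simp: Q_def)
  have lastXA: "last XA = u"
    using pA(2,3) pA_ne neA by (cases pA) (auto simp: XA_def)
  have hdXA: "hd XA = hd psA" using neA by (simp add: XA_def)
  have sXA: "successively (\<lambda>u v. par2 v = u) (a # XA)"
  proof -
    have "successively (\<lambda>u v. par2 v = u) (a # psA)"
      using A(4) B(4) neA unfolding successively_Cons
      by (auto intro: successively_mono)
    moreover have "successively (\<lambda>u v. par2 v = u) (tl pA)" "tl pA \<noteq> [] \<Longrightarrow> par2 (hd (tl pA)) = last psA"
      using pA(2,6) pA_ne by (cases pA; auto simp: successively_Cons)+
    ultimately show ?thesis using neA
      by (auto simp: XA_def successively_Cons successively_append_iff)
  qed
  have sXA4: "successively (\<lambda>u v. par4 v = u) (a # XA)"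
    using sXA sA G(3) C(5) subsetD[OF sA hd_in_set[of XA]] unfolding successively_Cons
    by (auto elim!: successively_mono)
  have sB4: "successively (\<lambda>u v. par4 v = u) (b # pB)"
    using pB(2,6) pB_ne C(4) b' G(3) by (auto simp: successively_Cons)
  have edge: "y \<in> Nb (par4 y)" if "y \<in> T4" for y
    using G(1) that by (simp add: forest_def)
  have wA: "walk (a # XA)"
    unfolding walk_def using sXA4 sA G(2) edge
    by (induction XA arbitrary: a) (auto simp: successively_Cons)
  have wB: "walk (b # pB)"
    unfolding walk_def using sB4 sB edge
    by (induction pB arbitrary: b) (auto simp: successively_Cons)
  have "walk ((a # XA) @ rev (b # pB))"
    using wA wB walk_rev[of "b # pB"] uw(3) lastXA pB(3) neA pB_ne
    unfolding walk_def successively_append_iff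
    by (auto simp: hd_rev XA_def hd_append split: if_splits)
  then have wQ: "walk (a # Q @ [b])" by (simp add: Q_def)
  \<comment> \<open>Both halves are directed away from their ends \<open>a\<close> and
    \<open>b\<close>, so on each half a vertex is a parent at most once; the edge between
    \<open>u\<close> and \<open>w\<close> is not a parent edge.\<close>
  have cnt: "card {y\<in>set Q. par4 y = v} \<le>
      (if v = a then 1 else 0) + (if v = b then 1 else 0) + (if v \<in> set Q then 1 else 0)" for v
  proof -
    have "{y\<in>set Q. par4 y = v} = {y\<in>set XA. par4 y = v} \<union> {y\<in>set pB. par4 y = v}"
      by (auto simp: Q_def)
    then have "card {y\<in>set Q. par4 y = v} \<le> card {y\<in>set XA. par4 y = v} + card {y\<in>set pB. par4 y = v}"
      by (simp add: card_Un_le)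
    also have "card {y\<in>set XA. par4 y = v} \<le> (if v = a \<or> v \<in> set XA then 1 else 0)"
      using sXA4 dA sA T2F ab by (intro card_par_path) auto
    also have "card {y\<in>set pB. par4 y = v} \<le> (if v = b \<or> v \<in> set pB then 1 else 0)"
      using sB4 pB(4) sB T4F ab by (intro card_par_path) auto
    finally show ?thesis using sA sB T2F T4F ab by (auto simp: Q_def split: if_splits)
  qed
  have "extendable D (F \<union> set Q) (\<lambda>v. g v + card {y\<in>set Q. par4 y = v})"
    using forest_restrict[OF G(1) sQ] .
  then have "extendable D (F \<union> set Q)
      (\<lambda>v. g v + (if v = a then 1 else 0) + (if v = b then 1 else 0) + (if v \<in> set Q then 1 else 0))"
    by (rule extendable_mono) (use cnt in \<open>auto simp: add.assoc\<close>)
  then show ?thesis using lenQ dQ sQ T4F wQ by blast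
qed

text \<open>The degrees spent are stated exactly so that another round can start from
  \<open>g'\<close>. The \<open>1\<close> in \<open>room\<close> restores the full \<open>l\<close>
  that \<open>connect\<close> requires for the pair in hand, while the finished pairs only occupy
  \<open>l i - 1\<close> vertices each.\<close>

lemma multi_connect:
  assumes fin: "finite I" and E: "extendable D F g"
    and ab: "\<And>i. i \<in> I \<Longrightarrow> a i \<in> V \<inter> F" "\<And>i. i \<in> I \<Longrightarrow> b i \<in> V \<inter> F"
    and deg: "\<And>v. g v + card {i\<in>I. a i = v} + card {i\<in>I. b i = v} \<le> D"
    and g0: "\<And>v. v \<notin> F \<Longrightarrow> g v = 0"
    and D: "2 \<le> D" "m \<le> D ^ k" and l: "\<And>i. i \<in> I \<Longrightarrow> 2 * k + 3 \<le> l i"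
    and room: "(2 * D + 6) * m + 1 + (\<Sum>i\<in>I. l i - 1) \<le> card (V - F)"
  shows "\<exists>Q g'. (\<forall>i\<in>I. length (Q i) = l i - 1 \<and> distinct (Q i) \<and> set (Q i) \<subseteq> V - F \<and>
      walk (a i # Q i @ [b i])) \<and> disjoint_family_on (\<lambda>i. set (Q i)) I \<and>
    extendable D (F \<union> (\<Union>i\<in>I. set (Q i))) g' \<and>
    (\<forall>v. g' v = g v + card {i\<in>I. a i = v} + card {i\<in>I. b i = v} +
        (if v \<in> (\<Union>i\<in>I. set (Q i)) then 1 else 0))"
  using fin ab deg l room
proof (induction I rule: finite_induct)
  case empty
  then show ?case using E by (intro exI[of _ "\<lambda>_. []"] exI[of _ g]) (auto simp: disjoint_family_on_def)
next
  case (insert j I)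
  have cnt: "card {i\<in>insert j I. f i = v} = card {i\<in>I. f i = v} + (if f j = v then 1 else 0)"
    for v and f :: "'b \<Rightarrow> 'a"
  proof -
    have "{i\<in>insert j I. f i = v} = (if f j = v then insert j {i\<in>I. f i = v} else {i\<in>I. f i = v})"
      by auto
    then show ?thesis using insert.hyps by simp
  qed
  have "\<exists>Q g'. (\<forall>i\<in>I. length (Q i) = l i - 1 \<and> distinct (Q i) \<and> set (Q i) \<subseteq> V - F \<and>
      walk (a i # Q i @ [b i])) \<and> disjoint_family_on (\<lambda>i. set (Q i)) I \<and>
    extendable D (F \<union> (\<Union>i\<in>I. set (Q i))) g' \<and>
    (\<forall>v. g' v = g v + card {i\<in>I. a i = v} + card {i\<in>I. b i = v} +
        (if v \<in> (\<Union>i\<in>I. set (Q i)) then 1 else 0))"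
  proof (rule insert.IH)
    show "g v + card {i\<in>I. a i = v} + card {i\<in>I. b i = v} \<le> D" for v
      using insert.prems(3)[of v] unfolding cnt by (auto split: if_splits)
    show "(2 * D + 6) * m + 1 + (\<Sum>i\<in>I. l i - 1) \<le> card (V - F)"
      using insert.prems(5) insert.hyps by simp
  qed (use insert.prems in auto)
  then obtain Q g' where Q: "\<And>i. i \<in> I \<Longrightarrow> length (Q i) = l i - 1 \<and> distinct (Q i) \<and>
      set (Q i) \<subseteq> V - F \<and> walk (a i # Q i @ [b i])" "disjoint_family_on (\<lambda>i. set (Q i)) I"
    and E': "extendable D (F \<union> (\<Union>i\<in>I. set (Q i))) g'"
    and g': "\<And>v. g' v = g v + card {i\<in>I. a i = v} + card {i\<in>I. b i = v} +
        (if v \<in> (\<Union>i\<in>I. set (Q i)) then 1 else 0)" by blast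
  define N where "N = (\<Union>i\<in>I. set (Q i))"
  have NF: "N \<subseteq> V - F" using Q(1) by (auto simp: N_def)
  have fN: "finite N" using insert.hyps by (simp add: N_def)
  have "card N = (\<Sum>i\<in>I. card (set (Q i)))"
    unfolding N_def using insert.hyps Q(2)
    by (intro card_UN_disjoint) (auto simp: disjoint_family_on_def)
  also have "\<dots> = (\<Sum>i\<in>I. l i - 1)"
    using Q(1) by (intro sum.cong) (auto simp: distinct_card)
  finally have cN: "card N = (\<Sum>i\<in>I. l i - 1)" .
  have cVN: "card (V - (F \<union> N)) = card (V - F) - (\<Sum>i\<in>I. l i - 1)"
    using card_Diff_subset[OF fN NF] cN by (simp add: set_diff_eq conj_ac)
  have jF: "a j \<in> V \<inter> F" "b j \<in> V \<inter> F" "a j \<notin> N" "b j \<notin> N"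
    using insert.prems(1,2)[of j] NF by auto
  have lj: "2 * k + 3 \<le> l j" using insert.prems(4) by simp
  have "\<exists>P. length P = l j - 1 \<and> distinct P \<and> set P \<subseteq> V - (F \<union> N) \<and> walk (a j # P @ [b j]) \<and>
    extendable D ((F \<union> N) \<union> set P)
      (\<lambda>v. g' v + (if v = a j then 1 else 0) + (if v = b j then 1 else 0) + (if v \<in> set P then 1 else 0))"
  proof (rule connect)
    show "extendable D (F \<union> N) g'" using E' by (simp add: N_def)
    show "g' (a j) + (if a j = b j then 2 else 1) \<le> D"
      using insert.prems(3)[of "a j"] jF unfolding cnt g' N_def[symmetric] by (auto split: if_splits)
    show "g' (b j) + 1 \<le> D"
      using insert.prems(3)[of "b j"] jF unfolding cnt g' N_def[symmetric] by (auto split: if_splits)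
    show "g' v = 0" if "v \<notin> F \<union> N" for v
    proof -
      have "{i\<in>I. a i = v} = {}" "{i\<in>I. b i = v} = {}" using insert.prems(1,2) that by auto
      then show ?thesis unfolding g' N_def[symmetric] using that g0 by (simp del: Collect_empty_eq)
    qed
    show "(2 * D + 6) * m + l j \<le> card (V - (F \<union> N))"
      using insert.prems(5) insert.hyps lj unfolding cVN by simp
  qed (use jF D lj in auto)
  then obtain P where P: "length P = l j - 1" "distinct P" "set P \<subseteq> V - (F \<union> N)"
    "walk (a j # P @ [b j])" and EP: "extendable D ((F \<union> N) \<union> set P)
      (\<lambda>v. g' v + (if v = a j then 1 else 0) + (if v = b j then 1 else 0) + (if v \<in> set P then 1 else 0))"
    by blast
  define Q' where "Q' = Q(j := P)"
  have Q'I: "Q' i = Q i" if "i \<in> I" for i using that insert.hyps by (auto simp: Q'_def)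
  have Q'j: "Q' j = P" by (simp add: Q'_def)
  have U: "(\<Union>i\<in>insert j I. set (Q' i)) = N \<union> set P"
    using Q'I Q'j by (auto simp: N_def)
  show ?case
  proof (rule exI[of _ Q'], rule exI, intro conjI ballI allI)
    show "extendable D (F \<union> (\<Union>i\<in>insert j I. set (Q' i))) (\<lambda>v. g' v + (if v = a j then 1 else 0) +
      (if v = b j then 1 else 0) + (if v \<in> set P then 1 else 0))"
      using EP unfolding U by (simp add: Un_assoc)
    show "g' v + (if v = a j then 1 else 0) + (if v = b j then 1 else 0) + (if v \<in> set P then 1 else 0)
      = g v + card {i\<in>insert j I. a i = v} + card {i\<in>insert j I. b i = v} +
        (if v \<in> (\<Union>i\<in>insert j I. set (Q' i)) then 1 else 0)" for v
      unfolding cnt U g' N_def[symmetric] using P(3) by auto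
    show "disjoint_family_on (\<lambda>i. set (Q' i)) (insert j I)"
      using Q(2) P(3) insert.hyps Q'I Q'j unfolding disjoint_family_on_def N_def by auto
    fix i assume i: "i \<in> insert j I"
    show "length (Q' i) = l i - 1" "distinct (Q' i)" "set (Q' i) \<subseteq> V - F" "walk (a i # Q' i @ [b i])"
      using i P Q(1)[of i] Q'I[of i] Q'j insert.hyps by (cases "i = j"; auto)+
  qed
qed

end

subsection \<open>Splitting an expander\<close>

lemma exists_le_average:
  fixes s :: "'i \<Rightarrow> real"
  assumes "finite J" "J \<noteq> {}"
  shows "\<exists>j\<in>J. card J * s j \<le> sum s J"
proof (rule ccontr)
  assume "\<not> ?thesis"
  then have "\<And>j. j \<in> J \<Longrightarrow> sum s J / card J < s j"
    using assms by (auto simp: not_le field_simps card_gt_0_iff)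
  then have "(\<Sum>j\<in>J. sum s J / card J) < sum s J"
    using assms by (intro sum_strict_mono)
  then show False using assms by simp
qed

text \<open>The method of conditional expectations: the colour of each vertex is chosen so that the
  potential does not exceed its mean over a uniformly random colour.\<close>

lemma colouring_potential:
  fixes w :: "'i \<Rightarrow> real" and c :: "'i \<Rightarrow> nat"
  assumes "finite W" "finite I" "1 \<le> B"
    and "\<And>i. i \<in> I \<Longrightarrow> 0 \<le> w i" "\<And>i. i \<in> I \<Longrightarrow> c i < B"
  shows "\<exists>f. (\<forall>v. f v < B) \<and>
    (\<Sum>i\<in>I. w i * (1/2) ^ card {v\<in>W. v \<in> S i \<and> f v = c i}) \<le>
    (\<Sum>i\<in>I. w i * (1 - 1 / (2 * real B)) ^ card (W \<inter> S i))"
  using assms(1,4)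
proof (induction W arbitrary: w rule: finite_induct)
  case empty
  show ?case using assms(3) by (intro exI[of _ "\<lambda>_. 0"]) auto
next
  case (insert v W)
  let ?q = "1 - 1 / (2 * real B)"
  let ?h = "\<lambda>k i. (if v \<in> S i \<and> c i = k then 1/2 else 1) :: real"
  let ?A = "\<lambda>k. \<Sum>i\<in>I. w i * ?h k i * ?q ^ card (W \<inter> S i)"
  have "\<exists>k\<in>{..<B}. card {..<B} * ?A k \<le> sum ?A {..<B}"
    using assms(3) by (intro exists_le_average) (auto simp: lessThan_empty_iff)
  then obtain k where k: "k < B" "B * ?A k \<le> sum ?A {..<B}" by auto
  \<comment> \<open>The total over all colours of the factor contributed by \<open>v\<close>:
    exactly one of the \<open>B\<close> colours halves it if \<open>v\<close> lies in
    \<open>S i\<close>.\<close>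
  have hsum: "(\<Sum>k<B. ?h k i) = B * (if v \<in> S i then ?q else 1)" if "i \<in> I" for i
  proof (cases "v \<in> S i")
    case True
    have "(\<Sum>k<B. ?h k i) = (\<Sum>k<B. 1 - (if k = c i then 1/2 else 0))"
      using True by (intro sum.cong) auto
    also have "\<dots> = B - 1/2" using assms(5)[OF that] by (simp add: sum_subtractf)
    also have "\<dots> = B * ?q" using assms(3) by (simp add: field_simps)
    finally show ?thesis using True by simp
  qed simp
  have "sum ?A {..<B} = (\<Sum>i\<in>I. \<Sum>k<B. w i * ?h k i * ?q ^ card (W \<inter> S i))"
    by (rule sum.swap)
  also have "\<dots> = (\<Sum>i\<in>I. w i * (\<Sum>k<B. ?h k i) * ?q ^ card (W \<inter> S i))"
    by (simp only: sum_distrib_left sum_distrib_right)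
  also have "\<dots> = (\<Sum>i\<in>I. B * (w i * ?q ^ card (insert v W \<inter> S i)))"
    using insert.hyps by (intro sum.cong) (auto simp: hsum)
  also have "\<dots> = B * (\<Sum>i\<in>I. w i * ?q ^ card (insert v W \<inter> S i))"
    by (simp add: sum_distrib_left)
  finally have A: "?A k \<le> (\<Sum>i\<in>I. w i * ?q ^ card (insert v W \<inter> S i))"
    using k(2) assms(3) by simp
  obtain f where f: "\<forall>v. f v < B"
    "(\<Sum>i\<in>I. w i * ?h k i * (1/2) ^ card {v\<in>W. v \<in> S i \<and> f v = c i}) \<le> ?A k"
    using insert.IH[of "\<lambda>i. w i * ?h k i"] insert.prems by auto
  have eq: "{u\<in>insert v W. u \<in> S i \<and> (f(v := k)) u = c i} =
    (if v \<in> S i \<and> c i = k then insert v {u\<in>W. u \<in> S i \<and> f u = c i} else {u\<in>W. u \<in> S i \<and> f u = c i})" for i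
    using insert.hyps by auto
  have "(\<Sum>i\<in>I. w i * (1/2) ^ card {u\<in>insert v W. u \<in> S i \<and> (f(v := k)) u = c i}) =
    (\<Sum>i\<in>I. w i * ?h k i * (1/2) ^ card {v\<in>W. v \<in> S i \<and> f v = c i})"
    unfolding eq using insert.hyps by (intro sum.cong) auto
  then show ?case using f A k(1) by (intro exI[of _ "f(v := k)"]) auto
qed

lemma sum_Pow_power:
  fixes r :: real
  assumes "finite A"
  shows "(\<Sum>X\<in>Pow A. r ^ card X) = (1 + r) ^ card A"
  using prod_add[OF assms, of "\<lambda>_. r" "\<lambda>_. 1"] by (simp add: add.commute)

text \<open>If \<open>U\<close> sees fewer than \<open>D * card U\<close> vertices of colour
  \<open>c\<close>, its term \<open>2 ^ (D * card U) * (1/2) ^ count\<close> is at least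
  \<open>1\<close>, so a potential below \<open>1\<close> excludes this for all pairs at once. In
  the mean the term is at most \<open>r ^ card U\<close>, and summing over all nonempty sets gives
  \<open>(1 + r) ^ card V - 1\<close>, at most \<open>2 * card V * r\<close> as
  \<open>card V * r\<close> is at most \<open>1\<close>.\<close>

lemma expanding_colouring:
  fixes N :: "'a set \<Rightarrow> 'a set" and d :: real and B D :: nat
  assumes V: "finite V" "W \<subseteq> V" and B: "1 \<le> B"
    and exp: "\<And>U. U \<subseteq> V \<Longrightarrow> P U \<Longrightarrow> 1 \<le> card U \<and> d * card U \<le> card (N U \<inter> W)"
    and small: "2 * real B * real (card V) * (2 ^ D * exp (- d / (2 * real B))) < 1"
  shows "\<exists>f. (\<forall>v. f v < B) \<and>
    (\<forall>U\<subseteq>V. \<forall>c<B. P U \<longrightarrow> D * card U \<le> card {v\<in>W. v \<in> N U \<and> f v = c})"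
proof -
  define r where "r = 2 ^ D * exp (- d / (2 * real B))"
  define FF where "FF = {U. U \<subseteq> V \<and> P U}"
  have fFF: "finite FF" using V by (auto simp: FF_def)
  have fW: "finite W" using V finite_subset by auto
  have r0: "0 \<le> r" by (simp add: r_def)
  obtain f where f: "\<forall>v. f v < B"
    "(\<Sum>(U, c)\<in>FF \<times> {..<B}. 2 ^ (D * card U) * (1/2::real) ^ card {v\<in>W. v \<in> N U \<and> f v = c}) \<le>
    (\<Sum>(U, c)\<in>FF \<times> {..<B}. 2 ^ (D * card U) * (1 - 1 / (2 * real B)) ^ card (W \<inter> N U))"
    using colouring_potential[of W "FF \<times> {..<B}" B "\<lambda>(U, c). 2 ^ (D * card U)" snd "\<lambda>(U, c). N U"]
      fW fFF B by (auto simp: case_prod_unfold)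
  have term_le: "2 ^ (D * card U) * (1 - 1 / (2 * real B)) ^ card (W \<inter> N U) \<le> r ^ card U" if U: "U \<in> FF" for U
  proof -
    have "(1 - 1 / (2 * real B)) ^ card (W \<inter> N U) \<le> exp (- (1 / (2 * real B))) ^ card (W \<inter> N U)"
      using B exp_ge_add_one_self[of "- (1 / (2 * real B))"] by (intro power_mono) (auto simp: field_simps)
    also have "\<dots> = exp (- (card (N U \<inter> W) / (2 * real B)))"
      by (simp add: exp_of_nat_mult[symmetric] Int_commute)
    also have "\<dots> \<le> exp (- (d * card U / (2 * real B)))"
      using exp[of U] U B by (auto simp: FF_def divide_right_mono)
    also have "\<dots> = exp (- d / (2 * real B)) ^ card U"
      by (simp add: exp_of_nat_mult[symmetric] mult.commute)
    finally show ?thesis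
      by (simp add: r_def power_mult_distrib power_mult[symmetric] mult_left_mono)
  qed
  have "(\<Sum>(U, c)\<in>FF \<times> {..<B}. 2 ^ (D * card U) * (1 - 1 / (2 * real B)) ^ card (W \<inter> N U)) \<le>
      (\<Sum>(U, c)\<in>FF \<times> {..<B}. r ^ card U)"
    using term_le by (intro sum_mono) auto
  also have "\<dots> = B * (\<Sum>U\<in>FF. r ^ card U)"
    by (simp add: sum.cartesian_product[symmetric] sum_distrib_left)
  finally have le1: "(\<Sum>(U, c)\<in>FF \<times> {..<B}. 2 ^ (D * card U) * (1 - 1 / (2 * real B)) ^ card (W \<inter> N U))
      \<le> B * (\<Sum>U\<in>FF. r ^ card U)" .
  have "(\<Sum>U\<in>FF. r ^ card U) \<le> (\<Sum>U\<in>Pow V - {{}}. r ^ card U)"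
    using V r0 exp[of "{}"] by (intro sum_mono2) (auto simp: FF_def)
  also have "\<dots> = (1 + r) ^ card V - 1"
    using V by (simp add: sum_diff1 sum_Pow_power)
  also have "(1 + r) ^ card V \<le> exp r ^ card V"
    using r0 by (intro power_mono) auto
  also have "\<dots> = exp (card V * r)" by (simp add: exp_of_nat_mult)
  also have "exp (card V * r) \<le> 1 + 2 * (card V * r)"
  proof -
    have nr: "card V * r \<le> 1"
    proof -
      have "card V * r \<le> 2 * real B * (card V * r)"
        using B r0 mult_right_mono[of 1 "2 * real B" "card V * r"] by simp
      then show ?thesis using small by (simp add: r_def mult_ac)
    qed
    have "exp (card V * r) \<le> 1 + card V * r + (card V * r)\<^sup>2"
      using nr r0 by (intro exp_bound) auto
    also have "(card V * r)\<^sup>2 \<le> card V * r * 1"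
      unfolding power2_eq_square using nr r0 by (intro mult_left_mono) auto
    finally show ?thesis by linarith
  qed
  finally have "B * (\<Sum>U\<in>FF. r ^ card U) \<le> B * (2 * (card V * r))"
    by (intro mult_left_mono) auto
  also have "\<dots> < 1" using small by (simp add: r_def mult_ac)
  finally have lt1: "(\<Sum>(U, c)\<in>FF \<times> {..<B}. 2 ^ (D * card U) * (1/2::real) ^ card {v\<in>W. v \<in> N U \<and> f v = c}) < 1"
    using f(2) le1 by simp
  have "D * card U \<le> card {v\<in>W. v \<in> N U \<and> f v = c}" if "U \<in> FF" "c < B" for U c
  proof (rule ccontr)
    assume n: "\<not> ?thesis"
    let ?k = "card {v\<in>W. v \<in> N U \<and> f v = c}"
    have "(1::real) = 2 ^ ?k * (1/2) ^ ?k" by (simp add: power_mult_distrib[symmetric])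
    also have "\<dots> \<le> 2 ^ (D * card U) * (1/2) ^ ?k"
      using n by (intro mult_right_mono power_increasing) auto
    also have "\<dots> \<le> (\<Sum>(U, c)\<in>FF \<times> {..<B}. 2 ^ (D * card U) * (1/2::real) ^ card {v\<in>W. v \<in> N U \<and> f v = c})"
      using that fFF member_le_sum[of "(U, c)" "FF \<times> {..<B}"
          "\<lambda>(U, c). 2 ^ (D * card U) * (1/2::real) ^ card {v\<in>W. v \<in> N U \<and> f v = c}"] by auto
    finally show False using lt1 by simp
  qed
  then show ?thesis using f(1) by (intro exI[of _ f]) (auto simp: FF_def)
qed

lemma exists_small:
  fixes s :: "nat \<Rightarrow> nat"
  assumes "finite J" "b \<le> card J" "1 \<le> b" "sum s J \<le> w"
  shows "\<exists>j\<in>J. b * s j \<le> w"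
proof (rule ccontr)
  assume "\<not> ?thesis"
  then have "\<And>j. j \<in> J \<Longrightarrow> w < b * s j" by auto
  then have "(\<Sum>j\<in>J. w) < (\<Sum>j\<in>J. b * s j)"
    using assms by (intro sum_strict_mono) auto
  also have "\<dots> = b * sum s J" by (simp add: sum_distrib_left)
  also have "\<dots> \<le> card J * w" using assms by (intro mult_mono) auto
  finally show False by simp
qed

text \<open>Every colour class expands, so three small ones can be picked: with up to two classes
  already taken, at least \<open>B - 2\<close> remain, and one of them has at most the average
  size.\<close>

lemma expanding_triple:
  fixes N :: "'a set \<Rightarrow> 'a set" and d :: real and B D :: nat
  assumes V: "finite V" "W \<subseteq> V" and B: "3 \<le> B"
    and exp: "\<And>U. U \<subseteq> V \<Longrightarrow> P U \<Longrightarrow> 1 \<le> card U \<and> d * card U \<le> card (N U \<inter> W)"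
    and small: "2 * real B * real (card V) * (2 ^ D * exp (- d / (2 * real B))) < 1"
  shows "\<exists>Z C1 C2. Z \<subseteq> W \<and> C1 \<subseteq> W \<and> C2 \<subseteq> W \<and> Z \<inter> C1 = {} \<and> Z \<inter> C2 = {} \<and> C1 \<inter> C2 = {} \<and>
    (B - 2) * card Z \<le> card W \<and> (B - 2) * card C1 \<le> card W \<and> (B - 2) * card C2 \<le> card W \<and>
    (\<forall>C\<in>{Z, C1, C2}. \<forall>U\<subseteq>V. P U \<longrightarrow> D * card U \<le> card (N U \<inter> C))"
proof -
  have fW: "finite W" using V finite_subset by auto
  have B1: "1 \<le> B" using B by simp
  obtain f where f: "\<forall>v. f v < B"
    "\<forall>U\<subseteq>V. \<forall>c<B. P U \<longrightarrow> D * card U \<le> card {v\<in>W. v \<in> N U \<and> f v = c}"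
    using expanding_colouring[OF V B1 exp small, of P] by blast
  define K where "K c = {v\<in>W. f v = c}" for c
  have KK: "N U \<inter> K c = {v\<in>W. v \<in> N U \<and> f v = c}" for U c by (auto simp: K_def)
  have total: "(\<Sum>c\<in>J. card (K c)) \<le> card W" if "finite J" for J
  proof -
    have "(\<Sum>c\<in>J. card (K c)) = card (\<Union>c\<in>J. K c)"
      using that fW by (intro card_UN_disjoint[symmetric]) (auto simp: K_def)
    also have "\<dots> \<le> card W" using fW by (intro card_mono) (auto simp: K_def)
    finally show ?thesis .
  qed
  have pick: "\<exists>c\<in>J. (B - 2) * card (K c) \<le> card W" if "J \<subseteq> {..<B}" "B - 2 \<le> card J" for J
    using that B finite_subset[OF that(1)] by (intro exists_small total) auto
  obtain c0 where c0: "c0 < B" "(B - 2) * card (K c0) \<le> card W"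
    using pick[of "{..<B}"] by force
  obtain c1 where c1: "c1 < B" "c1 \<noteq> c0" "(B - 2) * card (K c1) \<le> card W"
    using pick[of "{..<B} - {c0}"] c0(1) by force
  have "card ({..<B} - {c0, c1}) = B - 2" using c0 c1 by (subst card_Diff_subset) auto
  then obtain c2 where c2: "c2 < B" "c2 \<noteq> c0" "c2 \<noteq> c1" "(B - 2) * card (K c2) \<le> card W"
    using pick[of "{..<B} - {c0, c1}"] by force
  have sub: "K c \<subseteq> W" and disj: "c \<noteq> c' \<Longrightarrow> K c \<inter> K c' = {}" for c c'
    by (auto simp: K_def)
  have "\<forall>C\<in>{K c0, K c1, K c2}. \<forall>U\<subseteq>V. P U \<longrightarrow> D * card U \<le> card (N U \<inter> C)"
    using f(2) c0(1) c1(1) c2(1) by (simp add: KK)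
  then show ?thesis
    using sub disj c0 c1 c2
    by (intro exI[of _ "K c0"] exI[of _ "K c1"] exI[of _ "K c2"] conjI) simp_all
qed

subsection \<open>The compaction network\<close>

text \<open>
  A code \<open>c\<close> stands for the place \<open>c mod N\<close> on level \<open>c div N\<close>; level \<open>0\<close> is the reservoir, and of the
  \<open>L + 1\<close> levels only the places with a code below \<open>R\<close> exist. The node \<open>\<nu>\<close> may be matched to its own place, one level up, to the
  same place on its level, or to the place \<open>2 ^ (\<nu> div N)\<close> below that. A missing choice is replaced by \<open>\<nu>\<close>.
\<close>

definition node_choice :: "nat \<Rightarrow> nat \<Rightarrow> nat \<Rightarrow> nat \<Rightarrow> nat" where
  "node_choice N R \<nu> j = (if j = 0 then if \<nu> + N < R then \<nu> + N else \<nu>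
     else if j = 1 then \<nu>
     else if 2 ^ (\<nu> div N) \<le> \<nu> mod N then \<nu> - 2 ^ (\<nu> div N) else \<nu>)"

text \<open>Sparseness seen from the places: a place is offered to at most three nodes. This bounds
  the number of absorbers at a vertex.\<close>

lemma node_choice_preimage:
  assumes "0 < N" "node_choice N R \<nu> j = c"
  shows "\<nu> \<in> {c, c - N, c + 2 ^ (c div N)}"
proof -
  have "c + 2 ^ (c div N) = \<nu>" if h: "2 ^ (\<nu> div N) \<le> \<nu> mod N" "c = \<nu> - 2 ^ (\<nu> div N)"
  proof -
    let ?p = "2 ^ (\<nu> div N) :: nat"
    have "(\<nu> div N) * N + \<nu> mod N = \<nu>" by simp
    then have "c = (\<nu> div N) * N + (\<nu> mod N - ?p)" using h by linarith
    moreover have "\<nu> mod N - ?p < N" using assms(1) by (simp add: less_imp_diff_less)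
    ultimately have "c div N = \<nu> div N" using assms(1) by simp
    then show ?thesis using h by (metis le_add_diff_inverse2 le_trans mod_less_eq_dividend)
  qed
  moreover have "c = \<nu> + N \<or> c = \<nu> \<or> (2 ^ (\<nu> div N) \<le> \<nu> mod N \<and> c = \<nu> - 2 ^ (\<nu> div N))"
    using assms(2) unfolding node_choice_def by metis
  ultimately show ?thesis by force
qed

text \<open>A set \<open>S\<close> of \<open>R'\<close> tokens in \<open>{..<N}\<close> is compacted to the top of the interval in \<open>L\<close>
  rounds, the token \<open>q\<close> having to move up by the number \<open>s q\<close> of vacant places above it: in round \<open>j\<close>
  it moves by \<open>2 ^ j\<close> or not at all, according to the \<open>j\<close>-th binary digit of \<open>s q\<close>. No two tokens
  ever collide since \<open>s\<close> is decreasing. A node on the trajectory of a token is matched to the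
  token's previous place and every other node to its own place.\<close>

lemma robust_matching:
  assumes N: "0 < N" "N \<le> 2 ^ L" and S: "S \<subseteq> {..<N}"
  defines "R \<equiv> (L + 1) * N - card S"
  shows "\<exists>f. inj_on f {..<L * N} \<and> (\<forall>\<nu><L * N. f \<nu> \<in> node_choice N R \<nu> ` {..<3} \<and> f \<nu> < R \<and>
    (f \<nu> < N \<longrightarrow> f \<nu> \<in> S))"
proof -
  have fS: "finite S" using S finite_subset by auto
  have cS: "card S \<le> N" using card_mono[OF _ S] by simp
  define s where "s q = card ({q<..<N} - S)" for q
  define pos where "pos j q = q + s q mod 2 ^ j" for j q
  have s_bound: "q + s q < N" if "q < N" for q
  proof -
    have "s q \<le> card {q<..<N}" unfolding s_def by (intro card_mono) auto
    then show ?thesis using that by simp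
  qed
  have s_anti: "s q' \<le> s q" if "q < q'" for q q'
    unfolding s_def using that by (intro card_mono) auto
  \<comment> \<open>Vacancies above \<open>q\<close> that are not above \<open>q'\<close> lie
    strictly between the two.\<close>
  have s_step: "s q \<le> s q' + (q' - q - 1)" if "q < q'" "q' \<in> S" "q' < N" for q q'
  proof -
    have "{q<..<N} - S \<subseteq> ({q'<..<N} - S) \<union> {q<..<q'}"
      using that(2) by (auto simp: not_less order.order_iff_strict)
    then have "s q \<le> card (({q'<..<N} - S) \<union> {q<..<q'})" unfolding s_def by (intro card_mono) auto
    also have "\<dots> \<le> s q' + card {q<..<q'}" unfolding s_def by (rule card_Un_le)
    finally show ?thesis by simp
  qed
  \<comment> \<open>Tokens keep their order in every round. From \<open>q\<close> to
    \<open>q'\<close> the total displacement \<open>s\<close> drops by less than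
    \<open>q' - q\<close>; its part not yet carried out, a multiple of \<open>2 ^ j\<close>, does
    not grow, so the part carried out also drops by less than \<open>q' - q\<close>.\<close>
  have pos_less: "pos j q < pos j q'" if "q < q'" "q' \<in> S" for j q q'
  proof -
    let ?p = "2 ^ j :: nat"
    have "q' < N" using S that by auto
    then have 1: "s q < s q' + (q' - q)" using s_step[OF that] that by linarith
    have 2: "s q' div ?p \<le> s q div ?p" using s_anti[OF that(1)] by (rule div_le_mono)
    then have "?p * (s q' div ?p) \<le> ?p * (s q div ?p)" by simp
    moreover have "?p * (s q' div ?p) + s q' mod ?p = s q'" "?p * (s q div ?p) + s q mod ?p = s q" by simp_all
    ultimately have "s q mod ?p < s q' mod ?p + (q' - q)" using 1 by linarith
    then show ?thesis using that by (simp add: pos_def)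
  qed
  have pos_inj: "inj_on (pos j) S" for j
    by (rule inj_onI) (metis pos_less less_irrefl linorder_neqE_nat)
  have pos_bound: "pos j q < N" if "q < N" for j q
    using s_bound[OF that] mod_less_eq_dividend[of "s q" "2 ^ j"] unfolding pos_def by linarith
  have pos_last: "pos L q = q + s q" if "q < N" for q
    using s_bound[OF that] N by (simp add: pos_def)
  \<comment> \<open>At most \<open>card S - 1\<close> tokens lie above \<open>q\<close>, so the
    vacancies above it carry \<open>q\<close> to \<open>N - card S\<close> or higher; equality of
    the two sets follows by counting.\<close>
  have occ_last: "pos L ` S = {N - card S..<N}"
  proof (rule card_subset_eq)
    show "pos L ` S \<subseteq> {N - card S..<N}"
    proof
      fix z assume "z \<in> pos L ` S"
      then obtain q where q: "q \<in> S" "z = q + s q" "q < N" using pos_last S by auto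
      have "{q<..<N} \<inter> S \<subseteq> S - {q}" by auto
      then have "card ({q<..<N} \<inter> S) \<le> card S - 1"
        using fS q card_mono[of "S - {q}" "{q<..<N} \<inter> S"] by simp
      moreover have "card {q<..<N} = s q + card ({q<..<N} \<inter> S)"
        unfolding s_def using card_Diff_subset_Int[of "{q<..<N}" S] card_mono[of "{q<..<N}" "{q<..<N} \<inter> S"]
        by simp
      moreover have "card S > 0" using q fS by (auto simp: card_gt_0_iff)
      ultimately show "z \<in> {N - card S..<N}" using q s_bound[of q] by simp
    qed
    show "card (pos L ` S) = card {N - card S..<N}" using cS by (simp add: card_image pos_inj)
  qed simp
  define tok where "tok j x = the_inv_into S (pos j) x" for j x
  have tok: "tok j (pos j q) = q" if "q \<in> S" for j q
    unfolding tok_def using that pos_inj by (simp add: the_inv_into_f_f)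
  define f where "f \<nu> = (if \<nu> mod N \<in> pos (Suc (\<nu> div N)) ` S
    then (\<nu> div N) * N + pos (\<nu> div N) (tok (Suc (\<nu> div N)) (\<nu> mod N)) else \<nu> + N)" for \<nu>
  have moved: "\<exists>q\<in>S. q < N \<and> \<nu> mod N = pos (Suc (\<nu> div N)) q \<and> f \<nu> = (\<nu> div N) * N + pos (\<nu> div N) q"
    if m: "\<nu> mod N \<in> pos (Suc (\<nu> div N)) ` S" for \<nu>
  proof -
    obtain q where q: "q \<in> S" "\<nu> mod N = pos (Suc (\<nu> div N)) q" using m by blast
    then have "f \<nu> = (\<nu> div N) * N + pos (\<nu> div N) q" using m tok by (simp only: f_def if_True)
    then show ?thesis using q S by blast
  qed
  \<comment> \<open>Whether the place \<open>f \<nu>\<close> holds a token at its own level tells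
    which case of \<open>f\<close> produced it, and hence the level of \<open>\<nu>\<close>.
    Injectivity rests on this.\<close>
  have f_div: "f \<nu> div N = (if \<nu> mod N \<in> pos (Suc (\<nu> div N)) ` S then \<nu> div N else Suc (\<nu> div N))"
    and f_mod: "f \<nu> mod N \<in> pos (f \<nu> div N) ` S \<longleftrightarrow> \<nu> mod N \<in> pos (Suc (\<nu> div N)) ` S" for \<nu>
  proof -
    have "(f \<nu> div N = (if \<nu> mod N \<in> pos (Suc (\<nu> div N)) ` S then \<nu> div N else Suc (\<nu> div N))) \<and>
      (f \<nu> mod N \<in> pos (f \<nu> div N) ` S \<longleftrightarrow> \<nu> mod N \<in> pos (Suc (\<nu> div N)) ` S)"
    proof (cases "\<nu> mod N \<in> pos (Suc (\<nu> div N)) ` S")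
      case True
      from moved[OF True] obtain q where q: "q \<in> S" "q < N" "f \<nu> = (\<nu> div N) * N + pos (\<nu> div N) q" by blast
      have lt: "pos (\<nu> div N) q < N" using pos_bound[OF q(2)] .
      have dv: "f \<nu> div N = \<nu> div N" "f \<nu> mod N = pos (\<nu> div N) q"
        unfolding q(3) using lt N by simp_all
      show ?thesis unfolding dv using True q(1) by simp
    next
      case False
      then have "f \<nu> = \<nu> + N" by (simp only: f_def if_False)
      then have "f \<nu> div N = Suc (\<nu> div N)" "f \<nu> mod N = \<nu> mod N"
        using N by (simp_all add: div_add_self2)
      then show ?thesis using False by simp
    qed
    then show "f \<nu> div N = (if \<nu> mod N \<in> pos (Suc (\<nu> div N)) ` S then \<nu> div N else Suc (\<nu> div N))"
      "f \<nu> mod N \<in> pos (f \<nu> div N) ` S \<longleftrightarrow> \<nu> mod N \<in> pos (Suc (\<nu> div N)) ` S" by auto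
  qed
  have "inj_on f {..<L * N}"
  proof (rule inj_onI)
    fix \<mu> \<nu> assume eq: "f \<mu> = f \<nu>"
    then have iff: "\<mu> mod N \<in> pos (Suc (\<mu> div N)) ` S \<longleftrightarrow> \<nu> mod N \<in> pos (Suc (\<nu> div N)) ` S"
      using f_mod[of \<mu>] f_mod[of \<nu>] by simp
    then have d: "\<mu> div N = \<nu> div N" using f_div[of \<mu>] f_div[of \<nu>] eq by (auto split: if_splits)
    show "\<mu> = \<nu>"
    proof (cases "\<nu> mod N \<in> pos (Suc (\<nu> div N)) ` S")
      case True
      obtain q where q: "q \<in> S" "\<nu> mod N = pos (Suc (\<nu> div N)) q" "f \<nu> = (\<nu> div N) * N + pos (\<nu> div N) q"
        using moved[OF True] by blast
      obtain q' where q': "q' \<in> S" "\<mu> mod N = pos (Suc (\<mu> div N)) q'" "f \<mu> = (\<mu> div N) * N + pos (\<mu> div N) q'"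
        using moved iff True by blast
      have "pos (\<nu> div N) q = pos (\<nu> div N) q'" using q(3) q'(3) d eq by simp
      then have "q = q'" using pos_inj q(1) q'(1) by (metis inj_onD)
      then have "\<mu> mod N = \<nu> mod N" using q q' d by simp
      then show ?thesis using d by (metis div_mod_decomp)
    next
      case False
      then have "f \<nu> = \<nu> + N" "f \<mu> = \<mu> + N" using iff by (simp_all only: f_def if_False)
      then show ?thesis using eq by simp
    qed
  qed
  moreover have "f \<nu> \<in> node_choice N R \<nu> ` {..<3} \<and> f \<nu> < R \<and> (f \<nu> < N \<longrightarrow> f \<nu> \<in> S)" if \<nu>: "\<nu> < L * N" for \<nu>
  proof -
    have d: "\<nu> div N < L" using \<nu> N by (simp add: less_mult_imp_div_less)
    have dec: "(\<nu> div N) * N + \<nu> mod N = \<nu>" by simp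
    have R: "L * N \<le> R" unfolding R_def using cS by (simp add: algebra_simps)
    show ?thesis
    proof (cases "\<nu> mod N \<in> pos (Suc (\<nu> div N)) ` S")
      case True
      from moved[OF True] obtain q where q: "q \<in> S" "q < N" "\<nu> mod N = pos (Suc (\<nu> div N)) q"
        "f \<nu> = (\<nu> div N) * N + pos (\<nu> div N) q" by blast
      let ?j = "\<nu> div N"
      \<comment> \<open>The binary digit of \<open>s q\<close> at the current level decides between
        choice \<open>1\<close> (stay) and choice \<open>2\<close> (come from \<open>2 ^ ?j\<close>
        below).\<close>
      have "s q mod 2 ^ Suc ?j = s q mod 2 ^ ?j + 2 ^ ?j * (s q div 2 ^ ?j mod 2)"
        using mod_mult2_eq[of "s q" "2 ^ ?j" 2] by (simp add: mult.commute)
      then have pp: "pos (Suc ?j) q = pos ?j q + 2 ^ ?j * (s q div 2 ^ ?j mod 2)"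
        by (simp add: pos_def)
      have 1: "f \<nu> = \<nu> \<or> (2 ^ ?j \<le> \<nu> mod N \<and> f \<nu> = \<nu> - 2 ^ ?j)"
      proof (cases "s q div 2 ^ ?j mod 2 = 0")
        case True
        then have "pos ?j q = \<nu> mod N" using pp q(3) by simp
        then show ?thesis using q(4) dec by presburger
      next
        case False
        then have "s q div 2 ^ ?j mod 2 = 1" by simp
        then have "\<nu> mod N = pos ?j q + 2 ^ ?j" using pp q(3) by simp
        then show ?thesis using q(4) dec by linarith
      qed
      have 2: "f \<nu> \<in> node_choice N R \<nu> ` {..<3}"
        using 1
      proof
        assume "f \<nu> = \<nu>"
        then show ?thesis by (intro image_eqI[of _ _ 1]) (auto simp: node_choice_def)
      next
        assume "2 ^ ?j \<le> \<nu> mod N \<and> f \<nu> = \<nu> - 2 ^ ?j"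
        then show ?thesis by (intro image_eqI[of _ _ 2]) (auto simp: node_choice_def)
      qed
      have 3: "f \<nu> < R" using 1 \<nu> R by auto
      \<comment> \<open>Only nodes of level \<open>0\<close> on a trajectory are matched into level
        \<open>0\<close>, and there the previous place of a token is its initial one.\<close>
      have 4: "f \<nu> \<in> S" if "f \<nu> < N"
      proof -
        have "f \<nu> div N = 0" using that by simp
        then have "\<nu> div N = 0" using f_div[of \<nu>] True by simp
        then show ?thesis using q by (simp add: pos_def)
      qed
      show ?thesis using 2 3 4 by blast
    next
      case False
      have fe: "f \<nu> = \<nu> + N" using False by (simp only: f_def if_False)
      \<comment> \<open>The top level lacks exactly the last \<open>card S\<close> places, and these
        are occupied after round \<open>L\<close>, so that no node is sent up to them.\<close>
      have lt: "\<nu> + N < R"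
      proof (cases "Suc (\<nu> div N) = L")
        case True
        have "\<nu> mod N < N - card S"
        proof (rule ccontr)
          assume "\<not> ?thesis"
          then have "\<nu> mod N \<in> {N - card S..<N}" using N by simp
          then show False using occ_last False True by simp
        qed
        moreover have "L * N = (\<nu> div N) * N + N" using True by (metis add.commute mult_Suc)
        moreover have "R = L * N + N - card S" by (simp add: R_def)
        ultimately show ?thesis using dec cS by linarith
      next
        case False
        then have "Suc (Suc (\<nu> div N)) \<le> L" using d by simp
        then have "Suc (Suc (\<nu> div N)) * N \<le> L * N" by (rule mult_le_mono1)
        moreover have "\<nu> mod N < N" using N by simp
        moreover have "Suc (Suc (\<nu> div N)) * N = N + (N + (\<nu> div N) * N)" by simp
        ultimately show ?thesis using dec R by linarith
      qed
      then have "f \<nu> \<in> node_choice N R \<nu> ` {..<3}" using fe by (intro image_eqI[of _ _ 0]) (auto simp: node_choice_def)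
      then show ?thesis using fe lt by simp
    qed
  qed
  ultimately show ?thesis by blast
qed

subsection \<open>Absorbers\<close>

text \<open>
  Let \<open>w, u\<^sub>1, \<dots>, u\<^sub>r, v\<^sub>r, \<dots>, v\<^sub>1\<close> be a cycle and \<open>s\<^sub>i\<close> the interior of a path from \<open>u\<^sub>i\<close> to \<open>v\<^bsub>i+1\<^esub>\<close>. Both
  \<open>zigzag_off\<close> and \<open>v\<^sub>1, w\<close> followed by \<open>zigzag_on\<close> are paths from \<open>v\<^sub>1\<close> to \<open>u\<^sub>r\<close>; they use the edges of the two rails
  alternately and differ, as vertex sets, exactly in \<open>w\<close>.
\<close>

fun zigzag_off zigzag_on :: "'a list \<Rightarrow> 'a list \<Rightarrow> 'a list list \<Rightarrow> 'a list" where
  "zigzag_off (u # us) (v # vs) [] = [v, u]"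
| "zigzag_off (u # us) (v # v' # vs) (s # ss) = v # v' # rev s @ u # zigzag_on us (v' # vs) ss"
| "zigzag_off _ _ _ = []"
| "zigzag_on (u # us) vs [] = [u]"
| "zigzag_on (u # us) (v # vs) (s # ss) = u # s @ zigzag_off us vs ss"
| "zigzag_on _ _ _ = []"

text \<open>Multisets yield lengths and vertex sets at once. \<open>zigzag_on\<close> omits
  \<open>hd vs\<close> because the piece in front of it has already visited that vertex.\<close>

lemma mset_zigzag:
  assumes "length us = Suc (length ss)" "length vs = Suc (length ss)"
  shows "mset (zigzag_off us vs ss) = mset us + mset vs + mset (concat ss)"
    and "add_mset (hd vs) (mset (zigzag_on us vs ss)) = mset us + mset vs + mset (concat ss)"
proof -
  have "mset (zigzag_off us vs ss) = mset us + mset vs + mset (concat ss) \<and>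
    add_mset (hd vs) (mset (zigzag_on us vs ss)) = mset us + mset vs + mset (concat ss)"
    using assms
  proof (induction ss arbitrary: us vs)
    case Nil
    then show ?case by (auto simp: length_Suc_conv)
  next
    case (Cons s ss)
    then obtain u us' v vs' where e: "us = u # us'" "vs = v # vs'"
      "length us' = Suc (length ss)" "length vs' = Suc (length ss)"
      by (auto simp: length_Suc_conv)
    then obtain v' vs'' where e': "vs' = v' # vs''" by (auto simp: length_Suc_conv)
    show ?case using Cons.IH[OF e(3,4)] by (simp add: e e' add_ac)
  qed
  then show "mset (zigzag_off us vs ss) = mset us + mset vs + mset (concat ss)"
    "add_mset (hd vs) (mset (zigzag_on us vs ss)) = mset us + mset vs + mset (concat ss)" by auto
qed

context joined_graph begin

lemma walk_append: "walk (xs @ ys) \<longleftrightarrow>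
    walk xs \<and> walk ys \<and> (xs \<noteq> [] \<longrightarrow> ys \<noteq> [] \<longrightarrow> hd ys \<in> Nb (last xs))"
  unfolding walk_def by (auto simp: successively_append_iff)

lemma walk_Cons: "walk (x # xs) \<longleftrightarrow> xs = [] \<or> hd xs \<in> Nb x \<and> walk xs"
  unfolding walk_def by (auto simp: successively_Cons)

lemma walk_Nil [simp]: "walk []" by (simp add: walk_def)

text \<open>Each round crosses one \<open>s\<close>, moves on along a rail and exchanges the two
  modes. The edge between the far ends of the rails is used by the path that finishes in the off
  mode.\<close>

lemma walk_zigzag:
  assumes "length us = Suc (length ss)" "length vs = Suc (length ss)"
    and "walk us" "walk vs" "last us \<in> Nb (last vs)"
    and "\<And>i. i < length ss \<Longrightarrow> walk (us ! i # ss ! i @ [vs ! Suc i])"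
  shows "walk (zigzag_off us vs ss) \<and> walk (zigzag_on us vs ss) \<and> zigzag_off us vs ss \<noteq> [] \<and> zigzag_on us vs ss \<noteq> [] \<and>
    hd (zigzag_off us vs ss) = hd vs \<and> last (zigzag_off us vs ss) = last us \<and>
    hd (zigzag_on us vs ss) = hd us \<and> last (zigzag_on us vs ss) = last us"
  using assms
proof (induction ss arbitrary: us vs)
  case Nil
  then show ?case by (auto simp: length_Suc_conv walk_Cons)
next
  case (Cons s ss)
  then obtain u us' v vs' where e: "us = u # us'" "vs = v # vs'"
    "length us' = Suc (length ss)" "length vs' = Suc (length ss)"
    by (auto simp: length_Suc_conv)
  then obtain u' us'' v' vs'' where e': "us' = u' # us''" "vs' = v' # vs''" by (auto simp: length_Suc_conv)
  have "walk (us' ! i # ss ! i @ [vs' ! Suc i])" if "i < length ss" for i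
    using Cons.prems(6)[of "Suc i"] that by (simp add: e)
  then have IH: "walk (zigzag_off us' vs' ss) \<and> walk (zigzag_on us' vs' ss) \<and> zigzag_off us' vs' ss \<noteq> [] \<and> zigzag_on us' vs' ss \<noteq> [] \<and>
    hd (zigzag_off us' vs' ss) = hd vs' \<and> last (zigzag_off us' vs' ss) = last us' \<and>
    hd (zigzag_on us' vs' ss) = hd us' \<and> last (zigzag_on us' vs' ss) = last us'"
    using Cons.prems by (intro Cons.IH) (auto simp: e e' walk_Cons)
  have s: "walk (u # s @ [v'])" using Cons.prems(6)[of 0] by (simp add: e e')
  then have rs: "walk (v' # rev s @ [u])" using walk_rev[of "u # s @ [v']"] by simp
  have e2: "u' \<in> Nb u" "v' \<in> Nb v" using Cons.prems(3,4) by (auto simp: e e' walk_Cons)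
  have A: "zigzag_off us vs ss' = v # v' # rev s @ u # zigzag_on us' vs' ss" if "ss' = s # ss" for ss'
    using that by (simp add: e e')
  have B: "zigzag_on us vs ss' = u # s @ zigzag_off us' vs' ss" if "ss' = s # ss" for ss'
    using that by (simp add: e e')
  have wA: "walk ((v' # rev s @ [u]) @ zigzag_on us' vs' ss)"
    using rs IH e2 unfolding walk_append[of "v' # rev s @ [u]"] by (simp add: e')
  have wB: "walk ((u # s) @ zigzag_off us' vs' ss)"
    using s IH unfolding walk_append[of "u # s"]
    using walk_append[of "u # s" "[v']"] by (simp add: e')
  have "walk (zigzag_off us vs (s # ss))" using wA e2 unfolding A[OF refl] by (simp add: walk_Cons[of v])
  moreover have "walk (zigzag_on us vs (s # ss))" using wB unfolding B[OF refl] by simp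
  ultimately show ?case using IH unfolding A[OF refl] B[OF refl] by (auto simp: e e')
qed

text \<open>\<open>Q\<close> is a cycle through \<open>w\<close> with \<open>w\<close> removed; its
  first half is one rail and its reversed second half the other. When active, the path enters at the
  end of \<open>Q\<close> and passes over \<open>w\<close> to the start of \<open>Q\<close>.\<close>

definition gadget :: "nat \<Rightarrow> 'a list \<Rightarrow> 'a list list \<Rightarrow> 'a \<Rightarrow> bool \<Rightarrow> 'a list" where
  "gadget k Q ss w b = (if b then last Q # w # zigzag_on (take (Suc k) Q) (rev (drop (Suc k) Q)) ss
     else zigzag_off (take (Suc k) Q) (rev (drop (Suc k) Q)) ss)"

text \<open>The two ends do not depend on \<open>b\<close>, so absorbers can be linked before it is
  known which of them are active. On the reversed second half, \<open>Q ! (2 * k - i)\<close> has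
  index \<open>Suc i\<close>.\<close>

lemma gadget:
  assumes Q: "length Q = 2 * Suc k" "walk (w # Q @ [w])"
    and ss: "length ss = k" "\<And>i. i < k \<Longrightarrow> walk (Q ! i # ss ! i @ [Q ! (2 * k - i)])"
  shows "walk (gadget k Q ss w b)" "gadget k Q ss w b \<noteq> []" "hd (gadget k Q ss w b) = last Q"
    "last (gadget k Q ss w b) = Q ! k"
    "mset (gadget k Q ss w b) = mset Q + mset (concat ss) + (if b then {#w#} else {#})"
proof -
  define us where "us = take (Suc k) Q"
  define vs where "vs = rev (drop (Suc k) Q)"
  have Quv: "Q = us @ rev vs" by (simp add: us_def vs_def)
  have len: "length us = Suc (length ss)" "length vs = Suc (length ss)"
    using Q ss by (auto simp: us_def vs_def)
  then have ne: "us \<noteq> []" "vs \<noteq> []" by auto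
  have "walk (w # us @ rev vs @ [w])" using Q(2) by (simp add: Quv)
  then have w: "walk us" "walk vs" "hd us \<in> Nb w" "last us \<in> Nb (last vs)" "hd vs \<in> Nb w" "w \<in> Nb (hd vs)"
    using ne Nb_sym by (auto simp: walk_append walk_Cons hd_rev last_rev hd_append)
  have lastQ: "last Q = hd vs" using ne by (simp add: Quv last_rev)
  have lastus: "last us = Q ! k" using ne len ss by (simp add: Quv last_conv_nth nth_append)
  have nth: "us ! i = Q ! i" "vs ! Suc i = Q ! (2 * k - i)" if "i < k" for i
  proof -
    show "us ! i = Q ! i" using that by (simp add: us_def)
    have "vs ! Suc i = drop (Suc k) Q ! (k - Suc i)"
      using that Q(1) by (simp add: vs_def rev_nth)
    also have "\<dots> = Q ! (Suc k + (k - Suc i))" using that Q(1) by (subst nth_drop) auto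
    also have "Suc k + (k - Suc i) = 2 * k - i" using that by simp
    finally show "vs ! Suc i = Q ! (2 * k - i)" .
  qed
  have z: "walk (zigzag_off us vs ss) \<and> walk (zigzag_on us vs ss) \<and> zigzag_off us vs ss \<noteq> [] \<and> zigzag_on us vs ss \<noteq> [] \<and>
    hd (zigzag_off us vs ss) = hd vs \<and> last (zigzag_off us vs ss) = last us \<and>
    hd (zigzag_on us vs ss) = hd us \<and> last (zigzag_on us vs ss) = last us"
    using walk_zigzag[OF len w(1,2,4)] ss nth by simp
  have g: "gadget k Q ss w b = (if b then hd vs # w # zigzag_on us vs ss else zigzag_off us vs ss)"
    unfolding gadget_def us_def[symmetric] vs_def[symmetric] lastQ ..
  show "walk (gadget k Q ss w b)" "gadget k Q ss w b \<noteq> []" "hd (gadget k Q ss w b) = last Q"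
    "last (gadget k Q ss w b) = Q ! k"
    using z w unfolding g lastQ lastus[symmetric] by (auto simp: walk_Cons)
  have "mset Q = mset us + mset vs" by (simp add: Quv)
  then show "mset (gadget k Q ss w b) = mset Q + mset (concat ss) + (if b then {#w#} else {#})"
    using mset_zigzag[OF len] unfolding g by (auto simp: add_ac)
qed

end

section \<open>Chains of absorbers\<close>

lemma card_fibre_le: "inj_on a I \<Longrightarrow> card {i\<in>I. a i = v} \<le> 1"
proof -
  assume inj: "inj_on a I"
  show ?thesis
  proof (cases "\<exists>j\<in>I. a j = v")
    case True
    then obtain j where "j \<in> I" "a j = v" by blast
    then have "{i\<in>I. a i = v} = {j}" using inj by (auto dest: inj_onD)
    then show ?thesis by simp
  next
    case False
    then have "{i\<in>I. a i = v} = {}" by auto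
    then show ?thesis by (simp del: Collect_empty_eq)
  qed
qed

lemma card_fibre_notin: "v \<notin> a ` I \<Longrightarrow> card {i\<in>I. a i = v} = 0"
proof -
  assume "v \<notin> a ` I"
  then have "{i\<in>I. a i = v} = {}" by auto
  then show ?thesis by (simp del: Collect_empty_eq)
qed

lemma card_UN_lists:
  assumes "finite I" "disjoint_family_on (\<lambda>i. set (Q i)) I" "\<And>i. i \<in> I \<Longrightarrow> distinct (Q i)"
  shows "card (\<Union>i\<in>I. set (Q i)) = (\<Sum>i\<in>I. length (Q i))"
proof -
  have "card (\<Union>i\<in>I. set (Q i)) = (\<Sum>i\<in>I. card (set (Q i)))"
    using assms by (intro card_UN_disjoint) (auto simp: disjoint_family_on_def)
  then show ?thesis using assms(3) by (simp add: distinct_card)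
qed

context joined_graph begin

text \<open>Three rounds of connections, all of the shortest length \<open>2 * k + 3\<close>
  available: cycles \<open>Q\<close> through the \<open>w i\<close>, rungs \<open>S\<close> between
  the halves of each cycle, and links \<open>T\<close> from absorber to absorber, with
  \<open>p\<close> absorbers to a path. Each absorber thus takes \<open>1 + k + 1\<close> pieces of
  \<open>2 * k + 2\<close> vertices. A vertex lies on at most nine of the cycles as
  \<open>w i\<close> and spends two on each; \<open>20\<close> covers these \<open>18\<close> and
  the start and end of a link.\<close>

lemma absorber_chain:
  fixes n p M k D :: nat and w x :: "nat \<Rightarrow> 'a"
  assumes E: "extendable D F (\<lambda>_. 0)" and D: "20 \<le> D" "m \<le> D ^ k"
    and w: "\<And>i. i < n \<Longrightarrow> w i \<in> V \<inter> F" "\<And>v. card {i\<in>{..<n}. w i = v} \<le> 9"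
    and x: "\<And>i. i < M \<Longrightarrow> x i \<in> V \<inter> F" "inj_on x {..<M}" and p: "0 < p" "n \<le> p * M"
    and room: "(2 * D + 6) * m + 1 + n * ((k + 2) * (2 * k + 2)) \<le> card (V - F)"
  shows "\<exists>lk gd. 
    (\<forall>i<n. \<forall>c. length (lk i) = 2 * k + 2 \<and> gd i c \<noteq> [] \<and> last (gd i c) = last (gd i False) \<and>
       length (gd i c) = (k + 1) * (2 * k + 2) + of_bool c \<and>
       set (gd i c) = set (gd i False) \<union> (if c then {w i} else {}) \<and>
       walk ((if i mod p = 0 then x (i div p) else last (gd (i - 1) False)) # lk i @ gd i c)) \<and>
    inj_on (\<lambda>i. last (gd i False)) {..<n} \<and>
    (\<Union>i<n. set (lk i) \<union> set (gd i False)) \<subseteq> V - F \<and>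
    card (\<Union>i<n. set (lk i) \<union> set (gd i False)) = n * ((k + 2) * (2 * k + 2))"
proof -
  let ?h = "2 * k + 3"
  have D2: "2 \<le> D" using D by simp
  have room': "(2 * D + 6) * m + 1 + (n * (2 * k + 2) + n * (k * (2 * k + 2)) + n * (2 * k + 2)) \<le> card (V - F)"
    using room by (simp add: algebra_simps)
  have "\<exists>Q g'. (\<forall>i\<in>{..<n}. length (Q i) = ?h - 1 \<and> distinct (Q i) \<and> set (Q i) \<subseteq> V - F \<and>
      walk (w i # Q i @ [w i])) \<and> disjoint_family_on (\<lambda>i. set (Q i)) {..<n} \<and>
    extendable D (F \<union> (\<Union>i\<in>{..<n}. set (Q i))) g' \<and>
    (\<forall>v. g' v = 0 + card {i\<in>{..<n}. w i = v} + card {i\<in>{..<n}. w i = v} +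
        (if v \<in> (\<Union>i\<in>{..<n}. set (Q i)) then 1 else 0))"
  proof (rule multi_connect)
    show "0 + card {i\<in>{..<n}. w i = v} + card {i\<in>{..<n}. w i = v} \<le> D" for v
      using w(2)[of v] D by simp
    have "(\<Sum>i\<in>{..<n}. ?h - 1) = n * (2 * k + 2)" by simp
    then show "(2 * D + 6) * m + 1 + (\<Sum>i\<in>{..<n}. ?h - 1) \<le> card (V - F)" using room' by linarith
  qed (use E w D D2 in auto)
  then obtain Q g1 where Q: "\<And>i. i < n \<Longrightarrow> length (Q i) = 2 * Suc k \<and> distinct (Q i) \<and>
      set (Q i) \<subseteq> V - F \<and> walk (w i # Q i @ [w i])"
    and Qd: "disjoint_family_on (\<lambda>i. set (Q i)) {..<n}"
    and E1: "extendable D (F \<union> (\<Union>i\<in>{..<n}. set (Q i))) g1"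
    and g1: "\<And>v. g1 v = 0 + card {i\<in>{..<n}. w i = v} + card {i\<in>{..<n}. w i = v} +
        (if v \<in> (\<Union>i\<in>{..<n}. set (Q i)) then 1 else 0)" by auto
  define N1 where "N1 = (\<Union>i\<in>{..<n}. set (Q i))"
  have N1: "N1 \<subseteq> V - F" using Q by (auto simp: N1_def)
  have cN1: "card N1 = n * (2 * k + 2)"
    unfolding N1_def using Q Qd by (subst card_UN_lists) auto
  have fin1: "finite N1" using N1 finite_V finite_subset by blast
  have Qin: "Q i ! j \<in> N1" if "i < n" "j < 2 * k + 2" for i j
    using that Q[of i] by (force simp: N1_def)
  have Qinj: "i = i' \<and> j = j'"
    if "i < n" "i' < n" "j < 2 * k + 2" "j' < 2 * k + 2" "Q i ! j = Q i' ! j'" for i i' j j'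
  proof -
    have "Q i ! j \<in> set (Q i)" using Q[of i] that(1,3) by (intro nth_mem) simp
    moreover have "Q i' ! j' \<in> set (Q i')" using Q[of i'] that(2,4) by (intro nth_mem) simp
    ultimately have "i = i'" using Qd that unfolding disjoint_family_on_def by (metis IntI emptyE lessThan_iff)
    then show ?thesis using that Q[of i] by (auto simp: nth_eq_iff_index_eq)
  qed
  have g1F: "g1 v \<le> 18" if "v \<in> F" for v
    unfolding g1 N1_def[symmetric] using w(2)[of v] that N1 by auto
  have g1N: "g1 v = (if v \<in> N1 then 1 else 0)" if "v \<notin> F" for v
    unfolding g1 N1_def[symmetric] using w(1) that by (subst (1 2) card_fibre_notin) auto
  have c1: "card (V - (F \<union> N1)) = card (V - F) - n * (2 * k + 2)"
    using card_Diff_subset[OF fin1 N1] cN1 by (simp add: set_diff_eq conj_ac)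
  let ?I = "{..<n} \<times> {..<k}"
  let ?a = "\<lambda>(i, j). Q i ! j" and ?b = "\<lambda>(i, j). Q i ! (2 * k - j)"
  have inja1: "inj_on ?a ?I"
  proof (rule inj_onI)
    fix ij ij' assume *: "ij \<in> ?I" "ij' \<in> ?I" "?a ij = ?a ij'"
    obtain i j i' j' where e: "ij = (i, j)" "ij' = (i', j')" by (metis prod.exhaust)
    have "i = i' \<and> j = j'" using * unfolding e by (intro Qinj) auto
    then show "ij = ij'" using e by auto
  qed
  have inja2: "inj_on ?b ?I"
  proof (rule inj_onI)
    fix ij ij' assume *: "ij \<in> ?I" "ij' \<in> ?I" "?b ij = ?b ij'"
    obtain i j i' j' where e: "ij = (i, j)" "ij' = (i', j')" by (metis prod.exhaust)
    have "i = i' \<and> 2 * k - j = 2 * k - j'" using * unfolding e by (intro Qinj) auto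
    then show "ij = ij'" using * e by auto
  qed
  note inja = inja1 inja2
  have aN: "?a ij \<in> N1" "?b ij \<in> N1" if "ij \<in> ?I" for ij
    using that by (auto intro!: Qin)
  have degA2: "g1 v + card {i\<in>?I. ?a i = v} + card {i\<in>?I. ?b i = v} \<le> (if v \<in> F then 18 else if v \<in> N1 then 3 else 0)" for v
  proof (cases "v \<in> N1")
    case True
    then show ?thesis using card_fibre_le[OF inja(1), of v] card_fibre_le[OF inja(2), of v] g1N[of v] N1 by auto
  next
    case False
    then have z: "card {i\<in>?I. ?a i = v} = 0" "card {i\<in>?I. ?b i = v} = 0"
      using aN by (intro card_fibre_notin; blast)+
    show ?thesis unfolding z using g1F[of v] g1N[of v] False by simp
  qed
  have "\<exists>S g'. (\<forall>i\<in>?I. length (S i) = ?h - 1 \<and> distinct (S i) \<and> set (S i) \<subseteq> V - (F \<union> N1) \<and>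
      walk (?a i # S i @ [?b i])) \<and> disjoint_family_on (\<lambda>i. set (S i)) ?I \<and>
    extendable D ((F \<union> N1) \<union> (\<Union>i\<in>?I. set (S i))) g' \<and>
    (\<forall>v. g' v = g1 v + card {i\<in>?I. ?a i = v} + card {i\<in>?I. ?b i = v} +
        (if v \<in> (\<Union>i\<in>?I. set (S i)) then 1 else 0))"
  proof (rule multi_connect)
    show "extendable D (F \<union> N1) g1" using E1 by (simp add: N1_def)
    show "?a i \<in> V \<inter> (F \<union> N1)" "?b i \<in> V \<inter> (F \<union> N1)" if "i \<in> ?I" for i
      using aN[OF that] N1 by auto
    show "g1 v + card {i\<in>?I. ?a i = v} + card {i\<in>?I. ?b i = v} \<le> D" for v
      by (rule order.trans[OF degA2]) (use D in auto)
    show "g1 v = 0" if "v \<notin> F \<union> N1" for v using g1N that by simp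
    show "(2 * D + 6) * m + 1 + (\<Sum>i\<in>?I. ?h - 1) \<le> card (V - (F \<union> N1))"
    proof -
      have "(\<Sum>i\<in>?I. ?h - 1) = n * (k * (2 * k + 2))" by (simp add: card_cartesian_product algebra_simps)
      then show ?thesis using room' unfolding c1 by linarith
    qed
  qed (use D D2 in auto)
  then obtain S g2 where S0: "\<forall>i\<in>?I. length (S i) = ?h - 1 \<and> distinct (S i) \<and>
      set (S i) \<subseteq> V - (F \<union> N1) \<and> walk (?a i # S i @ [?b i])"
    and Sd: "disjoint_family_on (\<lambda>i. set (S i)) ?I"
    and E2: "extendable D ((F \<union> N1) \<union> (\<Union>i\<in>?I. set (S i))) g2"
    and g2': "\<forall>v. g2 v = g1 v + card {i\<in>?I. ?a i = v} + card {i\<in>?I. ?b i = v} +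
        (if v \<in> (\<Union>i\<in>?I. set (S i)) then 1 else 0)" by blast
  note g2 = g2'[rule_format]
  have S: "length (S i) = 2 * k + 2 \<and> distinct (S i) \<and>
      set (S i) \<subseteq> V - (F \<union> N1) \<and> walk (?a i # S i @ [?b i])" if "i \<in> ?I" for i
    using S0[rule_format, OF that] by simp
  define N2 where "N2 = (\<Union>i\<in>?I. set (S i))"
  have N2: "N2 \<subseteq> V - (F \<union> N1)" using S unfolding N2_def by blast
  have cN2: "card N2 = n * (k * (2 * k + 2))"
  proof -
    have "card N2 = (\<Sum>i\<in>?I. length (S i))"
      unfolding N2_def using S Sd by (intro card_UN_lists) auto
    also have "\<dots> = (\<Sum>i\<in>?I. 2 * k + 2)" using S by (intro sum.cong) auto
    finally show ?thesis by (simp add: card_cartesian_product algebra_simps)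
  qed
  have fin2: "finite N2" using N2 finite_V finite_subset by blast
  have g2b: "g2 v \<le> (if v \<in> F then 18 else if v \<in> N1 then 3 else if v \<in> N2 then 1 else 0)" for v
    using degA2[of v] N2 unfolding g2 N2_def[symmetric] by (auto split: if_splits)
  have c2: "card (V - (F \<union> N1 \<union> N2)) = card (V - F) - n * (2 * k + 2) - n * (k * (2 * k + 2))"
    using card_Diff_subset[OF fin2 N2] cN2 c1 by (simp add: set_diff_eq conj_ac)
  \<comment> \<open>\<open>Q (i - 1) ! k\<close> is the exit of the preceding absorber, active or
    not; at multiples of \<open>p\<close> a new path begins.\<close>
  define pr where "pr i = (if i mod p = 0 then x (i div p) else Q (i - 1) ! k)" for i
  define en where "en i = last (Q i)" for i
  have divM: "i div p < M" if "i < n" for i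
    using that p by (simp add: less_mult_imp_div_less mult.commute)
  have en: "en i = Q i ! (2 * k + 1)" if "i < n" for i
    using Q[OF that] unfolding en_def by (subst last_conv_nth) auto
  have injen: "inj_on en {..<n}"
    using Qinj by (intro inj_onI) (force simp: en)
  have prF: "pr i \<in> F \<longleftrightarrow> i mod p = 0" "pr i \<in> V \<inter> (F \<union> N1)" if "i < n" for i
  proof -
    have "Q (i - 1) ! k \<in> N1" using that by (intro Qin) auto
    then show "pr i \<in> F \<longleftrightarrow> i mod p = 0" "pr i \<in> V \<inter> (F \<union> N1)"
      using x(1)[OF divM[OF that]] N1 by (auto simp: pr_def)
  qed
  have injpr: "inj_on pr {..<n}"
  proof (rule inj_onI)
    fix i j assume ij: "i \<in> {..<n}" "j \<in> {..<n}" "pr i = pr j"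
    then have iff: "i mod p = 0 \<longleftrightarrow> j mod p = 0" using prF by (metis lessThan_iff)
    show "i = j"
    proof (cases "i mod p = 0")
      case True
      then have "x (i div p) = x (j div p)" using ij iff by (simp add: pr_def)
      then have "i div p = j div p" using x(2) divM ij by (auto dest: inj_onD)
      then show ?thesis using True iff by (metis div_mod_decomp)
    next
      case False
      then have "Q (i - 1) ! k = Q (j - 1) ! k" using ij iff by (simp add: pr_def)
      then have "i - 1 = j - 1" using Qinj[of "i - 1" "j - 1" k k] ij by simp
      moreover have "i \<noteq> 0" "j \<noteq> 0" using False iff by (auto intro: gr0I)
      ultimately show ?thesis by simp
    qed
  qed
  have enN: "en i \<in> N1" if "i < n" for i using Qin[OF that] en[OF that] by simp
  have "\<exists>T g'. (\<forall>i\<in>{..<n}. length (T i) = ?h - 1 \<and> distinct (T i) \<and> set (T i) \<subseteq> V - (F \<union> N1 \<union> N2) \<and>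
      walk (pr i # T i @ [en i])) \<and> disjoint_family_on (\<lambda>i. set (T i)) {..<n} \<and>
    extendable D ((F \<union> N1 \<union> N2) \<union> (\<Union>i\<in>{..<n}. set (T i))) g' \<and>
    (\<forall>v. g' v = g2 v + card {i\<in>{..<n}. pr i = v} + card {i\<in>{..<n}. en i = v} +
        (if v \<in> (\<Union>i\<in>{..<n}. set (T i)) then 1 else 0))"
  proof (rule multi_connect)
    show "extendable D (F \<union> N1 \<union> N2) g2" using E2 by (simp add: N2_def)
    show "pr i \<in> V \<inter> (F \<union> N1 \<union> N2)" if "i \<in> {..<n}" for i using prF that by auto
    show "en i \<in> V \<inter> (F \<union> N1 \<union> N2)" if "i \<in> {..<n}" for i using enN that N1 by auto
    show "g2 v + card {i\<in>{..<n}. pr i = v} + card {i\<in>{..<n}. en i = v} \<le> D" for v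
      using g2b[of v] D card_fibre_le[OF injpr, of v] card_fibre_le[OF injen, of v]
      by (auto split: if_splits)
    show "g2 v = 0" if "v \<notin> F \<union> N1 \<union> N2" for v using g2b[of v] that by simp
    show "(2 * D + 6) * m + 1 + (\<Sum>i\<in>{..<n}. ?h - 1) \<le> card (V - (F \<union> N1 \<union> N2))"
    proof -
      have "(\<Sum>i\<in>{..<n}. ?h - 1) = n * (2 * k + 2)" by simp
      then show ?thesis using room' unfolding c2 by linarith
    qed
  qed (use D D2 in auto)
  then obtain T where T: "\<And>i. i < n \<Longrightarrow> length (T i) = 2 * k + 2 \<and> distinct (T i) \<and>
      set (T i) \<subseteq> V - (F \<union> N1 \<union> N2) \<and> walk (pr i # T i @ [en i])"
    and Td: "disjoint_family_on (\<lambda>i. set (T i)) {..<n}" by auto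
  define N3 where "N3 = (\<Union>i\<in>{..<n}. set (T i))"
  have N3: "N3 \<subseteq> V - (F \<union> N1 \<union> N2)" using T unfolding N3_def by blast
  have cN3: "card N3 = n * (2 * k + 2)"
    unfolding N3_def using T Td by (subst card_UN_lists) auto
  have fin3: "finite N3" using N3 finite_V finite_subset by blast
  define ss where "ss i = map (\<lambda>j. S (i, j)) [0..<k]" for i
  define gd where "gd i c = gadget k (Q i) (ss i) (w i) c" for i c
  have G: "walk (gd i c)" "gd i c \<noteq> []" "hd (gd i c) = last (Q i)" "last (gd i c) = Q i ! k"
    "mset (gd i c) = mset (Q i) + mset (concat (ss i)) + (if c then {#w i#} else {#})" if i: "i < n" for i c
  proof -
    have h: "length (Q i) = 2 * Suc k" "walk (w i # Q i @ [w i])" "length (ss i) = k"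
      using Q[OF i] by (auto simp: ss_def)
    have h4: "walk (Q i ! j # ss i ! j @ [Q i ! (2 * k - j)])" if "j < k" for j
      using S[of "(i, j)"] i that by (simp add: ss_def)
    show "walk (gd i c)" "gd i c \<noteq> []" "hd (gd i c) = last (Q i)" "last (gd i c) = Q i ! k"
      "mset (gd i c) = mset (Q i) + mset (concat (ss i)) + (if c then {#w i#} else {#})"
      by (simp_all only: gd_def gadget[OF h h4] not_False_eq_True)
  qed
  have len: "length (gd i c) = (k + 1) * (2 * k + 2) + of_bool c" if i: "i < n" for i c
  proof -
    have "length (gd i c) = size (mset (gd i c))" by simp
    also have "\<dots> = length (Q i) + length (concat (ss i)) + of_bool c" unfolding G(5)[OF i] by simp
    also have "length (concat (ss i)) = (\<Sum>j\<leftarrow>[0..<k]. 2 * k + 2)"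
      unfolding length_concat ss_def map_map comp_def using S i by (intro arg_cong[where f = sum_list] map_cong) auto
    finally show ?thesis using Q[OF i] by (simp add: sum_list_triv algebra_simps)
  qed
  have set: "set (gd i c) = set (Q i) \<union> (\<Union>j<k. set (S (i, j))) \<union> (if c then {w i} else {})" if i: "i < n" for i c
  proof -
    have "set (gd i c) = set_mset (mset (gd i c))" by simp
    also have "\<dots> = set (Q i) \<union> set (concat (ss i)) \<union> (if c then {w i} else {})" unfolding G(5)[OF i] by auto
    also have "set (concat (ss i)) = (\<Union>j<k. set (S (i, j)))" by (auto simp: ss_def)
    finally show ?thesis .
  qed
  have U: "(\<Union>i<n. set (T i) \<union> set (gd i False)) = N1 \<union> N2 \<union> N3"
    using set by (auto simp: N1_def N2_def N3_def)
  have "card (N1 \<union> N2 \<union> N3) = n * (2 * k + 2) + n * (k * (2 * k + 2)) + n * (2 * k + 2)"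
    using N2 N3 fin1 fin2 fin3 cN1 cN2 cN3 by (subst card_Un_disjoint; (subst card_Un_disjoint)?) auto
  also have "\<dots> = n * ((k + 2) * (2 * k + 2))" by (simp add: algebra_simps)
  finally have cU: "card (N1 \<union> N2 \<union> N3) = n * ((k + 2) * (2 * k + 2))" .
  have lastinj: "inj_on (\<lambda>i. last (gd i False)) {..<n}"
  proof (rule inj_onI)
    fix i j assume *: "i \<in> {..<n}" "j \<in> {..<n}" "last (gd i False) = last (gd j False)"
    then have "Q i ! k = Q j ! k" by (simp add: G(4))
    then show "i = j" using Qinj[of i j k k] * by simp
  qed
  have wk: "walk ((if i mod p = 0 then x (i div p) else last (gd (i - 1) False)) # T i @ gd i c)" if i: "i < n" for i c
  proof -
    have pe: "(if i mod p = 0 then x (i div p) else last (gd (i - 1) False)) = pr i"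
      using i by (auto simp: pr_def G(4))
    have "walk ((pr i # T i) @ [en i])" using T[OF i] by simp
    then have "walk ((pr i # T i) @ gd i c)"
      using G(1,2,3)[OF i, of c] unfolding walk_append[of "pr i # T i"] by (simp add: en_def)
    then show ?thesis unfolding pe by simp
  qed
  show ?thesis
  proof (rule exI[of _ T], rule exI[of _ gd], intro conjI allI impI)
    show "(\<Union>i<n. set (T i) \<union> set (gd i False)) \<subseteq> V - F" unfolding U using N1 N2 N3 by auto
    show "card (\<Union>i<n. set (T i) \<union> set (gd i False)) = n * ((k + 2) * (2 * k + 2))" unfolding U by fact
  qed (use T G len set wk lastinj in auto)
qed

end

subsection \<open>Assembling the paths\<close>

text \<open>The lists have as many entries in total as \<open>V\<close> has elements, so covering
  \<open>V\<close> leaves no entry for a repetition. For the assembled paths only lengths and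
  covering then have to be checked.\<close>

lemma covering_imp_partition:
  assumes len: "\<And>i. i < M \<Longrightarrow> length (P i) = l" and V: "finite V" "card V = M * l"
    and cover: "V \<subseteq> (\<Union>i<M. set (P i))"
  shows "(\<Union>i<M. set (P i)) = V" "\<And>i. i < M \<Longrightarrow> distinct (P i)"
    "disjoint_family_on (\<lambda>i. set (P i)) {..<M}"
proof -
  define xs where "xs = concat (map P [0..<M])"
  have sxs: "set xs = (\<Union>i<M. set (P i))" by (auto simp: xs_def)
  have "length xs = (\<Sum>i\<leftarrow>[0..<M]. length (P i))" by (simp add: xs_def length_concat comp_def)
  also have "\<dots> = (\<Sum>i<M. l)" unfolding sum_list_distinct_conv_sum_set[OF distinct_upt]
    using len by (intro sum.cong) auto
  finally have lxs: "length xs = card V" using V by simp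
  have "card V \<le> card (set xs)" using cover sxs by (intro card_mono) auto
  then have eq: "card (set xs) = card V" using card_length[of xs] lxs by simp
  then have d: "distinct xs" using lxs by (intro card_distinct) simp
  have "V = set xs" using cover sxs eq by (intro card_subset_eq) auto
  then show "(\<Union>i<M. set (P i)) = V" using sxs by simp
  have both: "distinct (P i) \<and> (\<forall>j<M. j \<noteq> i \<longrightarrow> set (P i) \<inter> set (P j) = {})" if i: "i < M" for i
  proof -
    obtain ys zs where s: "[0..<M] = ys @ i # zs" using split_list[of i "[0..<M]"] i by auto
    have "j \<in> set ys \<union> set zs" if "j < M" "j \<noteq> i" for j
    proof -
      have "j \<in> set [0..<M]" using that by simp
      then show ?thesis unfolding s using that by auto
    qed
    moreover have d': "distinct (concat (map P (ys @ i # zs)))" using d unfolding xs_def s .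
    moreover have "set (P i) \<inter> set (P j) = {}" if "j \<in> set ys \<union> set zs" for j
    proof -
      have "set (P i) \<inter> set (concat (map P ys)) = {}" "set (P i) \<inter> set (concat (map P zs)) = {}"
        using d' by auto
      moreover have "set (P j) \<subseteq> set (concat (map P ys)) \<union> set (concat (map P zs))" using that by auto
      ultimately show ?thesis by blast
    qed
    ultimately show ?thesis by auto
  qed
  then show "distinct (P i)" if "i < M" for i using that by simp
  show "disjoint_family_on (\<lambda>i. set (P i)) {..<M}"
    using both by (auto simp: disjoint_family_on_def)
qed

text \<open>The nodes below \<open>K\<close> are dealt out to the paths in blocks of
  \<open>q\<close>; beyond \<open>K\<close> the truncated subtraction makes the blocks
  empty.\<close>

lemma sum_interval_pieces: "(\<Sum>i<j. min (q * Suc i) K - q * i) = min (q * j) (K::nat)"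
  by (induction j) (auto simp: min_def algebra_simps)

lemma node_choice_less: "\<nu> < L * N \<Longrightarrow> L * N \<le> R \<Longrightarrow> node_choice N R \<nu> j < R"
  by (auto simp: node_choice_def)

text \<open>Three nodes can reach a place, each by at most three choices; coinciding default choices
  are included in this count.\<close>

lemma card_node_choice_fibre:
  assumes N: "0 < N" and inj: "inj_on vtx {..<R}" and R: "L * N \<le> R"
  shows "card {g\<in>{..<3 * (L * N)}. vtx (node_choice N R (g div 3) (g mod 3)) = v} \<le> 9"
proof (cases "\<exists>c<R. vtx c = v")
  case True
  then obtain c where c: "c < R" "vtx c = v" by blast
  let ?X = "{c, c - N, c + 2 ^ (c div N)}"
  have "{g\<in>{..<3 * (L * N)}. vtx (node_choice N R (g div 3) (g mod 3)) = v} \<subseteq> (\<lambda>(a, b). 3 * a + b) ` (?X \<times> {..<3})"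
  proof
    fix g assume g: "g \<in> {g\<in>{..<3 * (L * N)}. vtx (node_choice N R (g div 3) (g mod 3)) = v}"
    then have "g div 3 < L * N" by auto
    then have "node_choice N R (g div 3) (g mod 3) < R" using R by (intro node_choice_less) auto
    then have "node_choice N R (g div 3) (g mod 3) = c" using inj g c by (auto dest: inj_onD)
    then have "g div 3 \<in> ?X" using node_choice_preimage[OF N] by blast
    then show "g \<in> (\<lambda>(a, b). 3 * a + b) ` (?X \<times> {..<3})"
      by (intro image_eqI[of _ _ "(g div 3, g mod 3)"]) auto
  qed
  then have "card {g\<in>{..<3 * (L * N)}. vtx (node_choice N R (g div 3) (g mod 3)) = v}
      \<le> card ((\<lambda>(a, b). 3 * a + b) ` (?X \<times> {..<3::nat}))" by (intro card_mono) auto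
  also have "\<dots> \<le> card (?X \<times> {..<3::nat})" by (intro card_image_le) auto
  also have "\<dots> = card ?X * 3" by (simp add: card_cartesian_product)
  also have "\<dots> \<le> 3 * 3" by (intro mult_right_mono) (auto simp: card_insert_if)
  finally show ?thesis by simp
next
  case False
  have "{g\<in>{..<3 * (L * N)}. vtx (node_choice N R (g div 3) (g mod 3)) = v} = {}"
    using False node_choice_less[OF _ R] by (auto simp: less_mult_imp_div_less mult.commute)
  then show ?thesis by (simp del: Collect_empty_eq)
qed

text \<open>A node \<open>\<nu>\<close> owns the absorbers \<open>3 * \<nu>\<close>,
  \<open>3 * \<nu> + 1\<close> and \<open>3 * \<nu> + 2\<close>, one per choice. Only their joint
  length is independent of which one is active.\<close>

lemma sum_nodes:
  assumes "\<And>\<nu>. a \<le> \<nu> \<Longrightarrow> \<nu> < a + c \<Longrightarrow> u (3 * \<nu>) + u (3 * \<nu> + 1) + u (3 * \<nu> + 2) = (B::nat)"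
  shows "(\<Sum>g\<leftarrow>[3 * a..<3 * (a + c)]. u g) = c * B"
  using assms
proof (induction c)
  case (Suc c)
  have "[3 * a..<3 * (a + Suc c)] = [3 * a..<3 * (a + c)] @ [3 * (a + c), 3 * (a + c) + 1, 3 * (a + c) + 2]"
  proof -
    have "3 * (a + Suc c) = Suc (Suc (Suc (3 * (a + c))))" by simp
    then show ?thesis unfolding upt_Suc[of _ "Suc (Suc (3 * (a + c)))"]
        upt_Suc[of _ "Suc (3 * (a + c))"] upt_Suc[of _ "3 * (a + c)"] by (simp only: upt_Suc) simp
  qed
  moreover have "u (3 * (a + c)) + u (3 * (a + c) + 1) + u (3 * (a + c) + 2) = B"
    by (rule Suc.prems) auto
  moreover have "(\<Sum>g\<leftarrow>[3 * a..<3 * (a + c)]. u g) = c * B"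
    by (rule Suc.IH) (rule Suc.prems, auto)
  ultimately show ?case by simp
qed simp

context joined_graph begin

lemma walk_chain:
  assumes n: "a * p + r \<le> n" "r \<le> p" "0 < p"
    and g: "\<And>i. i < n \<Longrightarrow> g i \<noteq> [] \<and> last (g i) = en i \<and>
      walk ((if i mod p = 0 then x (i div p) else en (i - 1)) # lk i @ g i)"
  shows "walk (x a # concat (map (\<lambda>i. lk i @ g i) [a * p..<a * p + r])) \<and>
    last (x a # concat (map (\<lambda>i. lk i @ g i) [a * p..<a * p + r])) = (if r = 0 then x a else en (a * p + r - 1))"
  using n(1,2)
proof (induction r)
  case 0
  then show ?case by (simp add: walk_Cons)
next
  case (Suc r)
  let ?xs = "x a # concat (map (\<lambda>i. lk i @ g i) [a * p..<a * p + r])"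
  let ?i = "a * p + r"
  have IH: "walk ?xs" "last ?xs = (if r = 0 then x a else en (?i - 1))" using Suc by auto
  have i: "?i < n" "?i mod p = r" "?i div p = a" using Suc.prems n by auto
  have w: "walk ((if r = 0 then x a else en (?i - 1)) # lk ?i @ g ?i)" "g ?i \<noteq> []" "last (g ?i) = en ?i"
    using g[OF i(1)] i by auto
  have "walk (?xs @ lk ?i @ g ?i)"
    using IH w unfolding walk_append[of ?xs] by (auto simp: walk_Cons)
  then show ?case using w by simp
qed

lemma walk_hops:
  assumes "\<And>r. r < e \<Longrightarrow> walk (jv r # H r @ [jv (Suc r)])"
  shows "walk (jv 0 # concat (map (\<lambda>r. H r @ [jv (Suc r)]) [0..<e])) \<and>
    last (jv 0 # concat (map (\<lambda>r. H r @ [jv (Suc r)]) [0..<e])) = jv e"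
  using assms
proof (induction e)
  case 0
  then show ?case by (simp add: walk_Cons)
next
  case (Suc e)
  let ?xs = "jv 0 # concat (map (\<lambda>r. H r @ [jv (Suc r)]) [0..<e])"
  have IH: "walk ?xs" "last ?xs = jv e" using Suc by auto
  have "walk (jv e # H e @ [jv (Suc e)])" using Suc by simp
  then have "walk (?xs @ H e @ [jv (Suc e)])"
    using IH unfolding walk_append[of ?xs] by (auto simp: walk_Cons)
  then show ?case by simp
qed

end

context joined_graph begin

lemma walk_glue:
  assumes "walk xs" "xs \<noteq> []" "walk (last xs # ys)"
  shows "walk (xs @ ys)" "last (xs @ ys) = last (last xs # ys)"
  using assms by (auto simp: walk_append walk_Cons)

text \<open>\<open>L\<close> is the number of levels carrying nodes, \<open>K\<close> the number of
  nodes and \<open>q\<close> a bound for the nodes on one path. The first \<open>p\<close> paths are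
  stopped early and take up \<open>e\<close> leftover vertices each. \<open>C1\<close>,
  \<open>C2\<close> and \<open>Z\<close> supply the expansion for the absorbers, the long paths and
  the last connections. Since all lengths are fixed, the sizes of all leftover sets are determined
  in advance.\<close>

theorem path_partition:
  fixes M l D k kB L p e :: nat and x y :: "nat \<Rightarrow> 'a" and Z C1 C2 :: "'a set"
  defines "A \<equiv> (k + 2) * (2 * k + 2)" and "W \<equiv> V - x ` {..<M} - y ` {..<M}"
    and "K \<equiv> L * card Z"
  defines "q \<equiv> K div M + 1"
  assumes V: "card V = M * l" and xV: "x ` {..<M} \<subseteq> V" and yV: "y ` {..<M} \<subseteq> V"
    and xi: "inj_on x {..<M}" and yi: "inj_on y {..<M}" and xy: "x ` {..<M} \<inter> y ` {..<M} = {}"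
    and sub: "Z \<subseteq> W" "C1 \<subseteq> W" "C2 \<subseteq> W" and disj: "Z \<inter> C1 = {}" "Z \<inter> C2 = {}" "C1 \<inter> C2 = {}"
    and exp: "\<And>C U. C \<in> {Z, C1, C2} \<Longrightarrow> U \<subseteq> V \<Longrightarrow> 1 \<le> card U \<Longrightarrow> card U < m \<Longrightarrow>
      D * card U \<le> card (nbhds U \<inter> C)"
    and D: "20 \<le> D" "m \<le> D ^ k" and kB: "m \<le> 2 ^ kB" and L: "card Z \<le> 2 ^ L"
    and Mp: "0 < M" "p \<le> M"
    and Zroom: "(2 * D + 6) * m + 1 + p * (e + 1) * (2 * k + 2) \<le> card Z"
    and Oroom: "K + p + card Z + card C1 + card C2 \<le> card W"
    and Aroom: "(2 * D + 6) * m + 1 + 3 * K * A + K + p + card Z + card C2 \<le> card W"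
    and Jroom: "10 * m + 1 \<le> p * e"
    and lroom: "1 + q * (3 * A + 1) + (e + 1) * (2 * k + 3) + 2 * kB + 3 \<le> l"
  shows "\<exists>P. (\<forall>i<M. walk (P i) \<and> P i \<noteq> [] \<and> distinct (P i) \<and> length (P i) = l \<and> hd (P i) = x i \<and> last (P i) = y i) \<and>
    disjoint_family_on (\<lambda>i. set (P i)) {..<M} \<and> (\<Union>i<M. set (P i)) = V"
proof -
  define N where "N = card Z"
  define h where "h = 2 * k + 2"
  define used where "used = p * (e + 1) * h"
  \<comment> \<open>The number of vertices of \<open>Z\<close> that will survive. Together with the
    \<open>K - N'\<close> places above level \<open>0\<close> they match the \<open>K\<close> nodes
    exactly, which determines \<open>R\<close>.\<close>
  define N' where "N' = N - used"
  define R where "R = (L + 1) * N - N'"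
  have usedN: "used \<le> N" using Zroom by (simp add: used_def h_def N_def)
  have "1 * 1 \<le> (2 * D + 6) * m" using m_pos by (intro mult_le_mono) auto
  moreover have "(2 * D + 6) * m + 1 \<le> N" unfolding N_def by (rule order.trans[OF le_add1 Zroom])
  ultimately have N2: "2 \<le> N" by linarith
  have Npos: "0 < N" using N2 by simp
  have L1: "1 \<le> L" using L N2 by (cases L) (auto simp: N_def)
  have KN: "N \<le> K" using L1 by (simp add: K_def N_def)
  have N'N: "N' \<le> N" by (simp add: N'_def)
  have "R = K + N - N'" by (simp add: R_def K_def N_def algebra_simps)
  then have Req: "R + N' = K + N" "K \<le> R" "N \<le> R" "R = N + (K - N')"
    using N'N KN by linarith+
  have finW: "finite W" using finite_V by (simp add: W_def)
  have WV: "W \<subseteq> V" by (auto simp: W_def)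
  have fins: "finite Z" "finite C1" "finite C2"
    using finite_subset[OF sub(1) finW] finite_subset[OF sub(2) finW] finite_subset[OF sub(3) finW] by auto
  define O1 where "O1 = W - Z - C1 - C2"
  have cO: "card O1 + N + card C1 + card C2 = card W"
  proof -
    have "W = O1 \<union> (Z \<union> (C1 \<union> C2))" using sub by (auto simp: O1_def)
    moreover have "card (O1 \<union> (Z \<union> (C1 \<union> C2))) = card O1 + (card Z + (card C1 + card C2))"
      using fins finW disj by (subst card_Un_disjoint; (subst card_Un_disjoint)?; (subst card_Un_disjoint)?)
        (auto simp: O1_def)
    ultimately show ?thesis by (simp add: N_def)
  qed
  have finO: "finite O1" using finW by (simp add: O1_def)
  have "K - N' + p \<le> card O1" using Oroom cO by (simp add: N_def)
  then obtain X where X: "X \<subseteq> O1" "card X = K - N' + p" "finite X"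
    using obtain_subset_with_card_n by metis
  \<comment> \<open>\<open>Vl\<close> provides the vertices for the places above level
    \<open>0\<close>; the \<open>p\<close> remaining vertices of \<open>X\<close> become the points
    where paths are stopped.\<close>
  then obtain Vl where Vl: "Vl \<subseteq> X" "card Vl = K - N'" "finite Vl"
    using obtain_subset_with_card_n[of "K - N'" X] by auto
  define Tm where "Tm = X - Vl"
  have Tm: "card Tm = p" "finite Tm" "Tm \<subseteq> O1" "Vl \<subseteq> O1" "Tm \<inter> Vl = {}"
    using X Vl by (auto simp: Tm_def card_Diff_subset)
  obtain t where t: "bij_betw t {..<p} Tm"
    using ex_bij_betw_nat_finite[OF Tm(2)] Tm(1) by (auto simp: lessThan_atLeast0)
  obtain z1 where z1: "bij_betw z1 {..<N} Z"
    using ex_bij_betw_nat_finite[OF fins(1)] by (auto simp: lessThan_atLeast0 N_def)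
  have "card {N..<R} = card Vl" using Req Vl by simp
  then obtain z2 where z2: "bij_betw z2 {N..<R} Vl"
    using finite_same_card_bij[OF _ Vl(3)] by blast
  define vtx where "vtx c = (if c < N then z1 c else z2 c)" for c
  have vtxZ: "bij_betw vtx {..<N} Z"
    using z1 by (rule bij_betw_cong[THEN iffD1, rotated]) (simp add: vtx_def)
  have vtxV: "bij_betw vtx {N..<R} Vl"
    using z2 by (rule bij_betw_cong[THEN iffD1, rotated]) (simp add: vtx_def)
  have ZVl: "Z \<inter> Vl = {}" using Tm by (auto simp: O1_def)
  have "{..<R} = {..<N} \<union> {N..<R}" using Req by auto
  then have vtxR: "bij_betw vtx {..<R} (Z \<union> Vl)"
    using bij_betw_combine[OF vtxZ vtxV ZVl] by simp
  \<comment> \<open>Absorber \<open>g\<close> serves choice \<open>g mod 3\<close> of node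
    \<open>g div 3\<close>.\<close>
  define w where "w g = vtx (node_choice N R (g div 3) (g mod 3))" for g
  have optR: "node_choice N R \<nu> j < R" if "\<nu> < K" for \<nu> j
    using node_choice_less[of \<nu> L N R j] that Req by (simp add: K_def N_def)
  \<comment> \<open>\<open>C2\<close> and \<open>Z\<close> stay untouched, since their expansion
    starts the later rounds.\<close>
  define TA where "TA = (C1 \<union> O1) - Vl - Tm"
  have TAV: "TA \<subseteq> V" using sub WV by (auto simp: TA_def O1_def)
  have cTA: "card TA + K + p + N + card C2 = card W + N'"
  proof -
    have "card (C1 \<union> O1) = card C1 + card O1" using fins finO by (intro card_Un_disjoint) (auto simp: O1_def)
    moreover have "TA = (C1 \<union> O1) - X" using Vl by (auto simp: TA_def Tm_def)
    moreover have "card ((C1 \<union> O1) - X) + card X = card (C1 \<union> O1)"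
    proof -
      have "X \<subseteq> C1 \<union> O1" "finite (C1 \<union> O1)" using X fins finO by auto
      then show ?thesis using X card_mono[of "C1 \<union> O1" X] by (simp add: card_Diff_subset)
    qed
    ultimately show ?thesis using cO X KN by (simp add: N'_def)
  qed
  define FA where "FA = V - TA"
  have VFA: "V - FA = TA" using TAV by (auto simp: FA_def)
  have C1T: "C1 \<subseteq> TA" using Tm by (auto simp: TA_def O1_def)
  have EA: "extendable D FA (\<lambda>_. 0)"
  proof (rule extendable_init)
    show "C1 \<inter> FA = {}" using C1T by (auto simp: FA_def)
    show "(2 * D + 2) * m \<le> card (V - FA)" using Aroom cTA unfolding VFA by (simp add: N_def algebra_simps)
  qed (use exp in auto)
  let ?n = "3 * K"
  have qpos: "0 < q" by (simp add: q_def)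
  have KqM: "K \<le> q * M"
  proof -
    have "K = M * (K div M) + K mod M" by simp
    moreover have "K mod M < M" using Mp by simp
    ultimately have "K \<le> M * (K div M) + M" by linarith
    then show ?thesis by (simp add: q_def algebra_simps)
  qed
  have wZV: "w g \<in> Z \<union> Vl" if "g < ?n" for g
    using optR[of "g div 3" "g mod 3"] that vtxR by (auto simp: w_def bij_betw_def)
  have ZVlF: "Z \<union> Vl \<subseteq> V \<inter> FA" using sub WV Tm disj by (auto simp: FA_def TA_def O1_def)
  have wc: "card {g\<in>{..<?n}. w g = v} \<le> 9" for v
    unfolding w_def K_def N_def[symmetric]
    using vtxR Req by (intro card_node_choice_fibre[OF Npos]) (auto simp: bij_betw_def K_def N_def)
  have xF: "x i \<in> V \<inter> FA" "y i \<in> V \<inter> FA" if "i < M" for i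
    using that xV yV sub by (auto simp: FA_def TA_def O1_def W_def)
  have "\<exists>lk gd.
    (\<forall>i<?n. \<forall>c. length (lk i) = 2 * k + 2 \<and> gd i c \<noteq> [] \<and> last (gd i c) = last (gd i False) \<and>
       length (gd i c) = (k + 1) * (2 * k + 2) + of_bool c \<and>
       set (gd i c) = set (gd i False) \<union> (if c then {w i} else {}) \<and>
       walk ((if i mod (3 * q) = 0 then x (i div (3 * q)) else last (gd (i - 1) False)) # lk i @ gd i c)) \<and>
    inj_on (\<lambda>i. last (gd i False)) {..<?n} \<and>
    (\<Union>i<?n. set (lk i) \<union> set (gd i False)) \<subseteq> V - FA \<and>
    card (\<Union>i<?n. set (lk i) \<union> set (gd i False)) = ?n * ((k + 2) * (2 * k + 2))"
  proof (rule absorber_chain[OF EA D])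
    show "w i \<in> V \<inter> FA" if "i < ?n" for i using wZV[OF that] ZVlF by auto
    show "?n \<le> 3 * q * M" using KqM by simp
    show "(2 * D + 6) * m + 1 + ?n * ((k + 2) * (2 * k + 2)) \<le> card (V - FA)"
      using Aroom cTA unfolding VFA A_def[symmetric] N_def by linarith
  qed (use wc xF xi qpos in auto)
  then obtain lk gd where
    lkgd: "\<forall>i<?n. \<forall>c. length (lk i) = 2 * k + 2 \<and> gd i c \<noteq> [] \<and> last (gd i c) = last (gd i False) \<and>
       length (gd i c) = (k + 1) * (2 * k + 2) + of_bool c \<and>
       set (gd i c) = set (gd i False) \<union> (if c then {w i} else {}) \<and>
       walk ((if i mod (3 * q) = 0 then x (i div (3 * q)) else last (gd (i - 1) False)) # lk i @ gd i c)"
    and lastinj: "inj_on (\<lambda>i. last (gd i False)) {..<?n}"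
    and UA0: "(\<Union>i<?n. set (lk i) \<union> set (gd i False)) \<subseteq> V - FA"
      "card (\<Union>i<?n. set (lk i) \<union> set (gd i False)) = ?n * ((k + 2) * (2 * k + 2))" by blast
  define UA where "UA = (\<Union>i<?n. set (lk i) \<union> set (gd i False))"
  have UA: "UA \<subseteq> TA" "card UA = 3 * K * A"
    using UA0 VFA by (auto simp: UA_def A_def)
  have finUA: "finite UA" by (simp add: UA_def)
  define TB where "TB = W - Z - Vl - Tm - UA"
  have cTB: "card TB + N + (K - N') + p + 3 * K * A = card W"
  proof -
    have "W = TB \<union> (Z \<union> (Vl \<union> (Tm \<union> UA)))"
      using sub Tm UA by (auto simp: TB_def O1_def TA_def)
    moreover have "card (TB \<union> (Z \<union> (Vl \<union> (Tm \<union> UA)))) = card TB + (card Z + (card Vl + (card Tm + card UA)))"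
    proof -
      have d: "Tm \<inter> UA = {}" "Vl \<inter> (Tm \<union> UA) = {}" "Z \<inter> (Vl \<union> (Tm \<union> UA)) = {}"
        "TB \<inter> (Z \<union> (Vl \<union> (Tm \<union> UA))) = {}"
        using UA Tm disj by (auto simp: TA_def O1_def TB_def)
      have f: "finite TB" using finW by (simp add: TB_def)
      show ?thesis using d f fins Tm Vl finUA by (simp add: card_Un_disjoint)
    qed
    ultimately show ?thesis using UA Tm Vl by (simp add: N_def)
  qed
  have TBV: "TB \<subseteq> V" using WV by (auto simp: TB_def)
  define FB where "FB = V - TB"
  have VFB: "V - FB = TB" using TBV by (auto simp: FB_def)
  have C2T: "C2 \<subseteq> TB" using sub disj Tm UA by (auto simp: TB_def O1_def TA_def)
  define c where "c i = min (q * Suc i) K - q * i" for i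
  have cq: "c i \<le> q" for i by (simp add: c_def)
  have cK: "q * i + c i \<le> K" if "0 < c i" for i using that by (simp add: c_def)
  have csum: "(\<Sum>i<M. c i) = K"
    unfolding c_def using sum_interval_pieces[of q K M] KqM by (simp add: min_def)
  define s where "s i = (if c i = 0 then x i else last (gd (3 * (q * i + c i) - 1) False))" for i
  define \<tau> where "\<tau> i = (if i < p then t i else y i)" for i
  define fin where "fin i = (if i < p then (e + 1) * (2 * k + 3) else 0)" for i
  \<comment> \<open>Makes path \<open>i\<close> have \<open>l\<close> vertices: \<open>x i\<close>,
    \<open>c i\<close> nodes with \<open>3 * A + 1\<close> each, \<open>lam i - 1\<close> inner
    vertices of the long connection, \<open>\<tau> i\<close>, and \<open>fin i\<close> more. The
    \<open>1\<close> in \<open>3 * A + 1\<close> is the vertex absorbed by the one active absorber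
    of a node.\<close>
  define lam where "lam i = l - 1 - c i * (3 * A + 1) - fin i" for i
  have lamb: "lam i + c i * (3 * A + 1) + fin i + 1 = l" "2 * kB + 3 \<le> lam i" for i
  proof -
    have "c i * (3 * A + 1) \<le> q * (3 * A + 1)" using cq by (intro mult_le_mono1)
    moreover have "fin i \<le> (e + 1) * (2 * k + 3)" by (simp add: fin_def)
    ultimately show "lam i + c i * (3 * A + 1) + fin i + 1 = l" "2 * kB + 3 \<le> lam i"
      unfolding lam_def using lroom by linarith+
  qed
  have finsum: "(\<Sum>i<M. fin i) = p * ((e + 1) * (2 * k + 3))"
  proof -
    have "(\<Sum>i<M. fin i) = (\<Sum>i\<in>{..<p}. (e + 1) * (2 * k + 3))"
      unfolding fin_def using Mp by (intro sum.mono_neutral_cong_right) auto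
    then show ?thesis by simp
  qed
  have cW: "card W + 2 * M = M * l"
  proof -
    have "card (x ` {..<M} \<union> y ` {..<M}) = 2 * M"
      using xi yi xy by (subst card_Un_disjoint) (auto simp: card_image)
    moreover have "W = V - (x ` {..<M} \<union> y ` {..<M})" by (auto simp: W_def)
    moreover have "card (V - (x ` {..<M} \<union> y ` {..<M})) + card (x ` {..<M} \<union> y ` {..<M}) = card V"
      using xV yV finite_V card_mono[of V "x ` {..<M} \<union> y ` {..<M}"] by (subst card_Diff_subset) auto
    ultimately show ?thesis using V by simp
  qed
  have lamsum: "(\<Sum>i<M. lam i - 1) + K * (3 * A + 1) + p * ((e + 1) * (2 * k + 3)) + 2 * M = M * l"
  proof -
    have "(\<Sum>i<M. (lam i - 1) + c i * (3 * A + 1) + fin i + 2) = (\<Sum>i<M. l)"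
    proof (intro sum.cong refl)
      fix i
      have "L - 1 + a + f + 2 = l" if "L + a + f + 1 = l" "2 * kB + 3 \<le> L" for L a f
        using that by linarith
      then show "lam i - 1 + c i * (3 * A + 1) + fin i + 2 = l" using lamb by blast
    qed
    also have "\<dots> = M * l" by simp
    also have "(\<Sum>i<M. (lam i - 1) + c i * (3 * A + 1) + fin i + 2) =
      (\<Sum>i<M. lam i - 1) + (\<Sum>i<M. c i * (3 * A + 1)) + (\<Sum>i<M. fin i) + 2 * M"
      by (simp only: sum.distrib) simp
    also have "(\<Sum>i<M. c i * (3 * A + 1)) = K * (3 * A + 1)"
      by (simp only: sum_distrib_right[symmetric] csum)
    finally show ?thesis unfolding finsum .
  qed
  \<comment> \<open>By exact counting the long connections will leave \<open>p * e\<close> vertices,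
    and by \<open>Jroom\<close> this is the slack that \<open>multi_connect\<close> requires for
    degree bound \<open>2\<close>.\<close>
  have TBJ: "card TB = (\<Sum>i<M. lam i - 1) + p * e"
  proof -
    have "used + N' = N" using usedN by (simp add: N'_def)
    moreover have "K - N' + N' = K" using KN by (simp add: N'_def)
    moreover have "p * ((e + 1) * (2 * k + 3)) = used + p * e + p" by (simp add: used_def h_def algebra_simps)
    moreover have "K * (3 * A + 1) = 3 * K * A + K" by (simp add: algebra_simps)
    ultimately show ?thesis using lamsum cW cTB by linarith
  qed
  have sx: "s i \<in> V \<inter> FB" if "i < M" for i
  proof (cases "c i = 0")
    case True
    then show ?thesis using xF(1)[OF that] that by (auto simp: s_def FB_def TB_def W_def)
  next
    case False
    let ?g = "3 * (q * i + c i) - 1"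
    have "?g < ?n" using cK[of i] False by auto
    then have "gd ?g False \<noteq> []" using lkgd by blast
    then have "last (gd ?g False) \<in> UA" using \<open>?g < ?n\<close> unfolding UA_def by force
    then show ?thesis using False UA TAV by (auto simp: s_def FB_def TB_def)
  qed
  have tauF: "\<tau> i \<in> V \<inter> FB" if "i < M" for i
  proof (cases "i < p")
    case True
    then have "t i \<in> Tm" using t by (auto simp: bij_betw_def)
    then show ?thesis using True Tm WV by (auto simp: \<tau>_def FB_def TB_def O1_def)
  next
    case False
    then show ?thesis using xF(2)[OF that] that by (auto simp: \<tau>_def FB_def TB_def W_def)
  qed
  have injs: "inj_on s {..<M}"
  proof (rule inj_onI)
    fix i j assume ij: "i \<in> {..<M}" "j \<in> {..<M}" "s i = s j"
    have sU: "s i \<in> UA" if "0 < c i" for i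
    proof -
      let ?g = "3 * (q * i + c i) - 1"
      have "?g < ?n" using cK[of i] that by auto
      then have "gd ?g False \<noteq> []" using lkgd by blast
      then show ?thesis using that \<open>?g < ?n\<close> unfolding UA_def s_def by force
    qed
    have xU: "x i \<notin> UA" if "i < M" for i using xF(1)[OF that] UA by (auto simp: FA_def)
    have zz: "c i = 0 \<longleftrightarrow> c j = 0"
    proof -
      have "0 < c i \<longleftrightarrow> s i \<in> UA" if "i < M" for i
        using sU[of i] xU[OF that] by (cases "c i = 0") (auto simp: s_def)
      then show ?thesis using ij by (metis gr0I lessThan_iff less_irrefl)
    qed
    show "i = j"
    proof (cases "c i = 0")
      case True
      then show ?thesis using ij zz xi by (auto simp: s_def dest: inj_onD)
    next
      case False
      then have "last (gd (3 * (q * i + c i) - 1) False) = last (gd (3 * (q * j + c j) - 1) False)"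
        using ij zz by (simp add: s_def)
      then have "3 * (q * i + c i) - 1 = 3 * (q * j + c j) - 1"
        using inj_onD[OF lastinj] cK[of i] cK[of j] False zz by fastforce
      then have eq: "q * i + c i = q * j + c j" using False zz by simp
      have key: "i = (q * i + c i - 1) div q" if "c i \<noteq> 0" for i
      proof -
        have "q * i + c i - 1 = q * i + (c i - 1)" "c i - 1 < q" using that cq[of i] by auto
        then show ?thesis using qpos by simp
      qed
      show ?thesis using key[of i] key[of j] eq False zz by simp
    qed
  qed
  have injtau: "inj_on \<tau> {..<M}"
  proof (rule inj_onI)
    fix i j assume ij: "i \<in> {..<M}" "j \<in> {..<M}" "\<tau> i = \<tau> j"
    have yT: "y i \<notin> Tm" if "i < M" for i using Tm that by (auto simp: O1_def W_def)
    have tT: "t i \<in> Tm" if "i < p" for i using t that by (auto simp: bij_betw_def)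
    have "i < p \<longleftrightarrow> j < p" using ij yT[of i] yT[of j] tT[of i] tT[of j] by (auto simp: \<tau>_def split: if_splits)
    then show "i = j" using ij t yi by (auto simp: \<tau>_def bij_betw_def split: if_splits dest: inj_onD)
  qed
  have EB: "extendable 2 FB (\<lambda>_. 0)"
  proof (rule extendable_init)
    show "C2 \<inter> FB = {}" using C2T by (auto simp: FB_def)
    show "(2 * 2 + 2) * m \<le> card (V - FB)" using TBJ Jroom unfolding VFB by simp
    fix U assume U: "U \<subseteq> V" "1 \<le> card U" "card U < m"
    have "2 * card U \<le> D * card U" using D(1) by (intro mult_le_mono1) simp
    also have "\<dots> \<le> card (nbhds U \<inter> C2)" using U by (intro exp) auto
    finally show "2 * card U \<le> card (nbhds U \<inter> C2)" .
  qed
  have "\<exists>Q g'. (\<forall>i\<in>{..<M}. length (Q i) = lam i - 1 \<and> distinct (Q i) \<and> set (Q i) \<subseteq> V - FB \<and>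
      walk (s i # Q i @ [\<tau> i])) \<and> disjoint_family_on (\<lambda>i. set (Q i)) {..<M} \<and>
    extendable 2 (FB \<union> (\<Union>i\<in>{..<M}. set (Q i))) g' \<and>
    (\<forall>v. g' v = 0 + card {i\<in>{..<M}. s i = v} + card {i\<in>{..<M}. \<tau> i = v} +
        (if v \<in> (\<Union>i\<in>{..<M}. set (Q i)) then 1 else 0))"
  proof (rule multi_connect[OF _ EB _ _ _ _ _ kB])
    show "0 + card {i\<in>{..<M}. s i = v} + card {i\<in>{..<M}. \<tau> i = v} \<le> 2" for v
      using card_fibre_le[OF injs, of v] card_fibre_le[OF injtau, of v] by simp
    show "(2 * 2 + 6) * m + 1 + (\<Sum>i\<in>{..<M}. lam i - 1) \<le> card (V - FB)"
      using TBJ Jroom unfolding VFB by simp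
  qed (use sx tauF lamb in auto)
  then obtain Bq where Bq: "\<forall>i\<in>{..<M}. length (Bq i) = lam i - 1 \<and> distinct (Bq i) \<and> set (Bq i) \<subseteq> V - FB \<and>
      walk (s i # Bq i @ [\<tau> i])" "disjoint_family_on (\<lambda>i. set (Bq i)) {..<M}" by blast
  define UB where "UB = (\<Union>i\<in>{..<M}. set (Bq i))"
  have UBT: "UB \<subseteq> TB" using Bq(1) VFB by (auto simp: UB_def)
  have cUB: "card UB = (\<Sum>i<M. lam i - 1)"
    unfolding UB_def using Bq by (subst card_UN_lists) auto
  define J where "J = TB - UB"
  have cJ: "card J = p * e"
    using UBT cUB TBJ finite_subset[OF TBV finite_V] finite_subset[OF UBT]
    by (simp add: J_def card_Diff_subset)
  have finJ: "finite J" using finite_subset[OF TBV finite_V] by (simp add: J_def)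
  obtain jn where jn: "bij_betw jn {..<p * e} J"
    using ex_bij_betw_nat_finite[OF finJ] cJ by (auto simp: lessThan_atLeast0)
  \<comment> \<open>The stops of a path resumed after its interruption: \<open>t i\<close>, then
    \<open>e\<close> leftover vertices, and \<open>y i\<close> at \<open>Suc e\<close>.\<close>
  define jv where "jv i r = (if r = 0 then t i else if r \<le> e then jn (i * e + (r - 1)) else y i)" for i r
  have tT: "t i \<in> Tm" if "i < p" for i using t that by (auto simp: bij_betw_def)
  have jnJ: "jn c \<in> J" if "c < p * e" for c using jn that by (auto simp: bij_betw_def)
  have idx: "i * e + (r - 1) < p * e" "(i * e + (r - 1)) div e = i" "(i * e + (r - 1)) mod e = r - 1"
    if "i < p" "r \<noteq> 0" "r \<le> e" for i r
  proof -
    have r: "r - 1 < e" using that by simp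
    have "Suc i * e \<le> p * e" using that by (intro mult_le_mono1) simp
    then show "i * e + (r - 1) < p * e" using r by simp
    show "(i * e + (r - 1)) div e = i" "(i * e + (r - 1)) mod e = r - 1" using r by simp_all
  qed
  have kinds: "Tm \<inter> J = {}" "y i \<notin> Tm" "y i \<notin> J" if "i < M" for i
    using Tm that by (auto simp: J_def TB_def O1_def W_def)
  have jvkind: "jv i r \<in> Tm \<longleftrightarrow> r = 0" "jv i r \<in> J \<longleftrightarrow> r \<noteq> 0 \<and> r \<le> e" if "i < p" for i r
  proof -
    have M: "i < M" using that Mp by simp
    show "jv i r \<in> Tm \<longleftrightarrow> r = 0" "jv i r \<in> J \<longleftrightarrow> r \<noteq> 0 \<and> r \<le> e"
      using tT[OF that] jnJ[OF idx(1)[OF that]] kinds[OF M] by (auto simp: jv_def)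
  qed
  have jvinj: "i = i' \<and> r = r'" if "i < p" "i' < p" "r \<le> Suc e" "r' \<le> Suc e" "jv i r = jv i' r'" for i i' r r'
  proof -
    have k: "r = 0 \<longleftrightarrow> r' = 0" "r \<noteq> 0 \<and> r \<le> e \<longleftrightarrow> r' \<noteq> 0 \<and> r' \<le> e"
    proof -
      have "jv i r \<in> Tm \<longleftrightarrow> jv i' r' \<in> Tm" "jv i r \<in> J \<longleftrightarrow> jv i' r' \<in> J" using that(5) by simp_all
      then show "r = 0 \<longleftrightarrow> r' = 0" "r \<noteq> 0 \<and> r \<le> e \<longleftrightarrow> r' \<noteq> 0 \<and> r' \<le> e"
        unfolding jvkind[OF that(1)] jvkind[OF that(2)] .
    qed
    consider "r = 0" | "r \<noteq> 0" "r \<le> e" | "r = Suc e"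
      using \<open>r \<le> Suc e\<close> by (auto simp: le_Suc_eq)
    then show ?thesis
    proof cases
      case 1
      then have "t i = t i'" using k that(5) by (simp add: jv_def)
      then show ?thesis using 1 k t that by (auto simp: bij_betw_def dest: inj_onD)
    next
      case 2
      then have r': "r' \<noteq> 0" "r' \<le> e" using k by auto
      have "jn (i * e + (r - 1)) = jn (i' * e + (r' - 1))" using 2 r' that(5) by (simp add: jv_def)
      then have "i * e + (r - 1) = i' * e + (r' - 1)"
        using jn idx(1)[OF that(1) 2] idx(1)[OF that(2) r'] by (auto simp: bij_betw_def dest: inj_onD)
      then have "i = i'" "r - 1 = r' - 1"
        using idx(2,3)[OF that(1) 2] idx(2,3)[OF that(2) r'] by metis+
      then show ?thesis using 2 r' by simp
    next
      case 3
      then have "r' = Suc e" using k that(4) by auto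
      then have "y i = y i'" using 3 that(5) by (simp add: jv_def)
      then show ?thesis using 3 \<open>r' = Suc e\<close> yi that Mp by (auto dest: inj_onD)
    qed
  qed
  define FC where "FC = V - Z"
  have ZV: "Z \<subseteq> V" using sub WV by auto
  have VFC: "V - FC = Z" using ZV by (auto simp: FC_def)
  have jvF: "jv i r \<in> V \<inter> FC" if "i < p" for i r
  proof -
    have "Tm \<subseteq> V \<inter> FC" "J \<subseteq> V \<inter> FC" using Tm WV TBV by (auto simp: FC_def O1_def J_def TB_def)
    moreover have "y i \<in> V \<inter> FC" using that Mp yV sub by (auto simp: FC_def W_def)
    ultimately show ?thesis using tT[OF that] jnJ[OF idx(1)[OF that]] by (auto simp: jv_def)
  qed
  have EC: "extendable D FC (\<lambda>_. 0)"
  proof (rule extendable_init)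
    show "Z \<inter> FC = {}" by (auto simp: FC_def)
    show "(2 * D + 2) * m \<le> card (V - FC)" using Zroom unfolding VFC by (simp add: algebra_simps)
  qed (use exp in auto)
  let ?I = "{..<p} \<times> {..<Suc e}"
  let ?a = "\<lambda>ir. jv (fst ir) (snd ir)" and ?b = "\<lambda>ir. jv (fst ir) (Suc (snd ir))"
  have ia: "inj_on ?a ?I"
  proof (rule inj_onI)
    fix u v assume *: "u \<in> ?I" "v \<in> ?I" "?a u = ?a v"
    have "fst u = fst v \<and> snd u = snd v" using * by (intro jvinj) auto
    then show "u = v" by (simp add: prod_eq_iff)
  qed
  have ib: "inj_on ?b ?I"
  proof (rule inj_onI)
    fix u v assume *: "u \<in> ?I" "v \<in> ?I" "?b u = ?b v"
    have "fst u = fst v \<and> Suc (snd u) = Suc (snd v)" using * by (intro jvinj) auto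
    then show "u = v" by (simp add: prod_eq_iff)
  qed
  have "\<exists>H g'. (\<forall>i\<in>?I. length (H i) = 2 * k + 3 - 1 \<and> distinct (H i) \<and> set (H i) \<subseteq> V - FC \<and>
      walk (?a i # H i @ [?b i])) \<and> disjoint_family_on (\<lambda>i. set (H i)) ?I \<and>
    extendable D (FC \<union> (\<Union>i\<in>?I. set (H i))) g' \<and>
    (\<forall>v. g' v = 0 + card {i\<in>?I. ?a i = v} + card {i\<in>?I. ?b i = v} +
        (if v \<in> (\<Union>i\<in>?I. set (H i)) then 1 else 0))"
  proof (rule multi_connect[OF _ EC _ _ _ _ _ D(2)])
    show "0 + card {i\<in>?I. ?a i = v} + card {i\<in>?I. ?b i = v} \<le> D" for v
      using card_fibre_le[OF ia, of v] card_fibre_le[OF ib, of v] D(1) by linarith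
    have "(\<Sum>i\<in>?I. 2 * k + 3 - 1) = p * (e + 1) * (2 * k + 2)" by (simp add: card_cartesian_product)
    then show "(2 * D + 6) * m + 1 + (\<Sum>i\<in>?I. 2 * k + 3 - 1) \<le> card (V - FC)"
      using Zroom unfolding VFC by linarith
    show "?a i \<in> V \<inter> FC" "?b i \<in> V \<inter> FC" if "i \<in> ?I" for i
      using that by (auto intro!: jvF simp del: Int_iff)
  qed (use D in auto)
  then obtain H where H0: "\<forall>i\<in>?I. length (H i) = 2 * k + 3 - 1 \<and> distinct (H i) \<and> set (H i) \<subseteq> V - FC \<and>
      walk (?a i # H i @ [?b i])" and Hd: "disjoint_family_on (\<lambda>i. set (H i)) ?I" by blast
  have H: "length (H (i, r)) = 2 * k + 2" "distinct (H (i, r))" "set (H (i, r)) \<subseteq> Z"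
    "walk (jv i r # H (i, r) @ [jv i (Suc r)])" if "i < p" "r < Suc e" for i r
    using bspec[OF H0, of "(i, r)"] that unfolding VFC by auto
  define UC where "UC = (\<Union>i\<in>?I. set (H i))"
  have UCZ: "UC \<subseteq> Z" using H(3) by (auto simp: UC_def)
  have cUC: "card UC = used"
  proof -
    have "card UC = (\<Sum>i\<in>?I. length (H i))"
      unfolding UC_def using H0 Hd by (intro card_UN_lists) auto
    also have "\<dots> = (\<Sum>i\<in>?I. 2 * k + 2)" using H0 by (intro sum.cong) auto
    finally show ?thesis by (simp add: card_cartesian_product used_def h_def)
  qed
  define Z' where "Z' = Z - UC"
  have cZ': "card Z' = N'"
    using UCZ cUC fins finite_subset[OF UCZ] by (simp add: Z'_def card_Diff_subset N'_def N_def)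
  define S where "S = {i\<in>{..<N}. vtx i \<in> Z'}"
  have SN: "S \<subseteq> {..<N}" by (auto simp: S_def)
  have "vtx ` S = Z'" using vtxZ by (auto simp: S_def bij_betw_def Z'_def)
  moreover have "inj_on vtx S" using vtxZ SN by (auto simp: bij_betw_def intro: inj_on_subset)
  ultimately have cS: "card S = N'" using cZ' card_image by metis
  have "N \<le> 2 ^ L" using L by (simp add: N_def)
  from robust_matching[OF Npos this SN] obtain f where f: "inj_on f {..<K}"
    "\<forall>\<nu><K. f \<nu> \<in> node_choice N R \<nu> ` {..<3} \<and> f \<nu> < R \<and> (f \<nu> < N \<longrightarrow> f \<nu> \<in> S)"
    unfolding cS R_def[symmetric] N_def[symmetric] K_def by blast
  \<comment> \<open>Choices can coincide because of the defaults. Fixing one index makes exactly one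
    of the three absorbers of a node active.\<close>
  define oo where "oo \<nu> = (SOME j. j < 3 \<and> f \<nu> = node_choice N R \<nu> j)" for \<nu>
  have oo: "oo \<nu> < 3" "f \<nu> = node_choice N R \<nu> (oo \<nu>)" if "\<nu> < K" for \<nu>
  proof -
    have "\<exists>j. j < 3 \<and> f \<nu> = node_choice N R \<nu> j" using f(2) that by auto
    then have "oo \<nu> < 3 \<and> f \<nu> = node_choice N R \<nu> (oo \<nu>)" unfolding oo_def by (rule someI_ex)
    then show "oo \<nu> < 3" "f \<nu> = node_choice N R \<nu> (oo \<nu>)" by auto
  qed
  \<comment> \<open>The places whose vertices still have to be absorbed. There are as many as nodes,
    so the injection \<open>f\<close> hits them all.\<close>
  define T where "T = {i\<in>{..<R}. i < N \<longrightarrow> i \<in> S}"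
  have fT: "f ` {..<K} = T"
  proof (rule card_subset_eq)
    show "finite T" by (simp add: T_def)
    show "f ` {..<K} \<subseteq> T" using f(2) by (auto simp: T_def)
    have "T = S \<union> {N..<R}" using SN Req by (auto simp: T_def)
    moreover have "card (S \<union> {N..<R}) = card S + (R - N)"
      using SN finite_subset[OF SN] by (subst card_Un_disjoint) auto
    ultimately show "card (f ` {..<K}) = card T" using f(1) cS Req KN by (simp add: card_image N'_def)
  qed
  define ab where "ab g = (oo (g div 3) = g mod 3)" for g
  define blk where "blk i = concat (map (\<lambda>g. lk g @ gd g (ab g)) [3 * (q * i)..<3 * (q * i + c i)])" for i
  define tail where "tail i = (if i < p then concat (map (\<lambda>r. H (i, r) @ [jv i (Suc r)]) [0..<Suc e]) else [])" for i
  define P where "P i = x i # blk i @ Bq i @ \<tau> i # tail i" for i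
  have blkw: "walk (x i # blk i) \<and> last (x i # blk i) = s i" for i
  proof (cases "c i = 0")
    case True
    then show ?thesis by (simp add: blk_def s_def walk_Cons)
  next
    case False
    have iv: "[3 * (q * i)..<3 * (q * i + c i)] = [i * (3 * q)..<i * (3 * q) + 3 * c i]"
    proof -
      have "3 * (q * i) = i * (3 * q)" "3 * (q * i + c i) = i * (3 * q) + 3 * c i"
        by (simp_all add: algebra_simps)
      then show ?thesis by (simp only:)
    qed
    have le: "i * (3 * q) + 3 * c i \<le> ?n"
    proof -
      have "i * (3 * q) + 3 * c i = 3 * (q * i + c i)" by (simp add: algebra_simps)
      also have "\<dots> \<le> 3 * K" using cK[of i] False by (intro mult_le_mono2) simp
      finally show ?thesis .
    qed
    have "3 * c i \<le> 3 * q" "0 < 3 * q" using cq[of i] qpos by auto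
    from walk_chain[OF le this, of "\<lambda>g. gd g (ab g)" "\<lambda>g. last (gd g False)" x lk]
    have "walk (x i # blk i) \<and> last (x i # blk i) =
      (if 3 * c i = 0 then x i else last (gd (i * (3 * q) + 3 * c i - 1) False))"
      unfolding blk_def iv using lkgd by blast
    moreover have "i * (3 * q) + 3 * c i - 1 = 3 * (q * i + c i) - 1" by (simp add: algebra_simps)
    ultimately show ?thesis using False by (simp add: s_def)
  qed
  have tailw: "walk (\<tau> i # tail i) \<and> last (\<tau> i # tail i) = y i" for i
  proof (cases "i < p")
    case True
    have "walk (jv i 0 # concat (map (\<lambda>r. H (i, r) @ [jv i (Suc r)]) [0..<Suc e])) \<and>
      last (jv i 0 # concat (map (\<lambda>r. H (i, r) @ [jv i (Suc r)]) [0..<Suc e])) = jv i (Suc e)"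
      using H(4)[OF True] by (intro walk_hops) auto
    then show ?thesis using True by (simp only: tail_def \<tau>_def if_True) (simp add: jv_def)
  next
    case False
    then show ?thesis by (simp add: tail_def \<tau>_def walk_Cons)
  qed
  have Pw: "walk (P i) \<and> last (P i) = y i" if i: "i < M" for i
  proof -
    have 1: "walk ((x i # blk i) @ Bq i @ [\<tau> i])" "last ((x i # blk i) @ Bq i @ [\<tau> i]) = \<tau> i"
      using walk_glue[of "x i # blk i" "Bq i @ [\<tau> i]"] blkw[of i] Bq(1) i by auto
    have "walk (((x i # blk i) @ Bq i @ [\<tau> i]) @ tail i)"
      "last (((x i # blk i) @ Bq i @ [\<tau> i]) @ tail i) = y i"
      using walk_glue[of "(x i # blk i) @ Bq i @ [\<tau> i]" "tail i"] 1 tailw[of i] by auto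
    then show ?thesis by (simp add: P_def)
  qed
  have blkl: "length (blk i) = c i * (3 * A + 1)" for i
  proof (cases "c i = 0")
    case False
    have "length (blk i) = (\<Sum>g\<leftarrow>[3 * (q * i)..<3 * (q * i + c i)]. length (lk g @ gd g (ab g)))"
      by (simp add: blk_def length_concat comp_def)
    also have "\<dots> = (\<Sum>g\<leftarrow>[3 * (q * i)..<3 * (q * i + c i)]. A + of_bool (ab g))"
    proof (intro arg_cong[where f = sum_list] map_cong refl)
      fix g assume "g \<in> set [3 * (q * i)..<3 * (q * i + c i)]"
      then have "g < ?n" using cK[of i] False by auto
      then have "length (lk g) = 2 * k + 2" "length (gd g (ab g)) = (k + 1) * (2 * k + 2) + of_bool (ab g)"
        using lkgd by blast+
      then show "length (lk g @ gd g (ab g)) = A + of_bool (ab g)" by (simp add: A_def algebra_simps)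
    qed
    also have "\<dots> = c i * (3 * A + 1)"
    proof (rule sum_nodes)
      fix \<nu> assume "q * i \<le> \<nu>" "\<nu> < q * i + c i"
      then have "oo \<nu> < 3" using cK[of i] False by (intro oo) auto
      then have "oo \<nu> = 0 \<or> oo \<nu> = 1 \<or> oo \<nu> = 2" by linarith
      then show "A + of_bool (ab (3 * \<nu>)) + (A + of_bool (ab (3 * \<nu> + 1))) + (A + of_bool (ab (3 * \<nu> + 2))) = 3 * A + 1"
      proof -
        have d: "3 * \<nu> div 3 = \<nu>" "(3 * \<nu> + 1) div 3 = \<nu>" "(3 * \<nu> + 2) div 3 = \<nu>"
          "3 * \<nu> mod 3 = 0" "(3 * \<nu> + 1) mod 3 = 1" "(3 * \<nu> + 2) mod 3 = 2" by presburger+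
        assume "oo \<nu> = 0 \<or> oo \<nu> = 1 \<or> oo \<nu> = 2"
        then show ?thesis unfolding ab_def d by (elim disjE) simp_all
      qed
    qed
    finally show ?thesis .
  qed (simp add: blk_def)
  have taill: "length (tail i) = fin i" for i
  proof (cases "i < p")
    case True
    have "length (tail i) = (\<Sum>r\<leftarrow>[0..<Suc e]. length (H (i, r) @ [jv i (Suc r)]))"
      using True by (simp only: tail_def if_True length_concat map_map comp_def)
    also have "\<dots> = (\<Sum>r\<leftarrow>[0..<Suc e]. 2 * k + 3)"
    proof (intro arg_cong[where f = sum_list] map_cong refl)
      fix r assume "r \<in> set [0..<Suc e]"
      then show "length (H (i, r) @ [jv i (Suc r)]) = 2 * k + 3" using H(1)[OF True, of r] by auto
    qed
    finally show ?thesis using True by (simp add: fin_def sum_list_triv)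
  qed (simp add: tail_def fin_def)
  have Pl: "length (P i) = l" if i: "i < M" for i
    using lamb[of i] Bq(1) i by (simp add: P_def blkl taill)
  have gmem: "\<exists>i<M. set (lk g @ gd g (ab g)) \<subseteq> set (P i)" if g: "g < ?n" for g
  proof -
    let ?i = "g div 3 div q"
    have gK: "g div 3 < K" using g by simp
    then have i: "?i < M" using KqM qpos by (simp add: less_mult_imp_div_less mult.commute)
    have dm: "q * ?i + g div 3 mod q = g div 3" by simp
    have "g div 3 mod q < q" using qpos by simp
    then have "g div 3 < q * Suc ?i" using dm by (metis add_less_cancel_left add.commute mult_Suc_right)
    then have b: "g div 3 < min (q * Suc ?i) K" using gK by simp
    have a: "q * ?i \<le> g div 3" by (metis dm le_add1)
    have "q * ?i + c ?i = min (q * Suc ?i) K" unfolding c_def using a b by linarith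
    then have "g div 3 < q * ?i + c ?i" using b by simp
    then have "3 * Suc (g div 3) \<le> 3 * (q * ?i + c ?i)" by (intro mult_le_mono2) simp
    moreover have "3 * (q * ?i) \<le> 3 * (g div 3)" using a by (intro mult_le_mono2)
    moreover have "3 * (g div 3) + g mod 3 = g" "g mod 3 < 3" by simp_all
    moreover have "a \<le> g \<and> g < b" if "3 * Suc G \<le> b" "a \<le> 3 * G" "3 * G + r = g" "r < 3" for a b G r
      using that by presburger
    ultimately have "3 * (q * ?i) \<le> g \<and> g < 3 * (q * ?i + c ?i)" by blast
    then have "g \<in> set [3 * (q * ?i)..<3 * (q * ?i + c ?i)]" by simp
    then have "set (lk g @ gd g (ab g)) \<subseteq> set (blk ?i)" unfolding blk_def by auto
    then show ?thesis using i by (intro exI[of _ ?i]) (auto simp: P_def)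
  qed
  have gdF: "set (gd g False) \<subseteq> set (gd g a)" "a \<Longrightarrow> w g \<in> set (gd g a)" if "g < ?n" for g a
  proof -
    have "set (gd g a) = set (gd g False) \<union> (if a then {w g} else {})" using lkgd that by blast
    then show "set (gd g False) \<subseteq> set (gd g a)" "a \<Longrightarrow> w g \<in> set (gd g a)" by auto
  qed
  have cover: "V \<subseteq> (\<Union>i<M. set (P i))"
  proof
    fix v assume v: "v \<in> V"
    consider (x) i where "i < M" "v = x i" | (y) i where "i < M" "v = y i" | (UA) "v \<in> UA"
      | (Tm) "v \<in> Tm" | (UB) "v \<in> UB" | (J) "v \<in> J" | (UC) "v \<in> UC" | (Z) "v \<in> Z' \<union> Vl"
      using v by (auto simp: J_def Z'_def TB_def W_def)
    then show "v \<in> (\<Union>i<M. set (P i))"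
    proof cases
      case x
      then show ?thesis by (auto simp: P_def)
    next
      case y
      have "P i \<noteq> []" by (simp add: P_def)
      then have "last (P i) \<in> set (P i)" by simp
      then show ?thesis using Pw y by auto
    next
      case UA
      then obtain g where g: "g < ?n" "v \<in> set (lk g) \<union> set (gd g False)" by (auto simp: UA_def)
      then have "v \<in> set (lk g @ gd g (ab g))" using gdF(1)[OF g(1), of "ab g"] by auto
      then show ?thesis using gmem[OF g(1)] by blast
    next
      case Tm
      then obtain i where "i < p" "v = t i" using t by (auto simp: bij_betw_def)
      then show ?thesis using Mp by (auto simp: P_def \<tau>_def intro!: bexI[of _ i])
    next
      case UB
      then show ?thesis by (auto simp: UB_def P_def)
    next
      case J
      then obtain d where d: "d < p * e" "v = jn d" using jn by (auto simp: bij_betw_def)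
      have e0: "0 < e" using d by (cases e) auto
      have i: "d div e < p" using d by (simp add: less_mult_imp_div_less)
      have r: "d mod e < e" using e0 by simp
      have "v = jv (d div e) (Suc (d mod e))" using d r by (simp add: jv_def)
      then have "v \<in> set (tail (d div e))" using i r by (auto simp: tail_def)
      then show ?thesis using i Mp by (auto simp: P_def intro!: bexI[of _ "d div e"])
    next
      case UC
      then obtain j where j: "j \<in> ?I" "v \<in> set (H j)" unfolding UC_def by blast
      obtain i r where "j = (i, r)" by (cases j)
      then have ir: "i < p" "r < Suc e" "v \<in> set (H (i, r))" using j by auto
      then have "v \<in> set (tail i)" by (auto simp: tail_def simp del: upt_Suc)
      then show ?thesis using ir Mp by (auto simp: P_def intro!: bexI[of _ i])
    next
      case Z
      then obtain d where d: "d < R" "v = vtx d" using vtxR Z'_def by (auto simp: bij_betw_def)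
      have "d \<in> S" if "d < N"
      proof -
        have "v \<in> Z" using that d vtxZ by (auto simp: bij_betw_def)
        then have "v \<in> Z'" using Z ZVl by auto
        then show ?thesis using that d by (simp add: S_def)
      qed
      then have "d \<in> T" using d by (simp add: T_def)
      then obtain \<nu> where \<nu>: "\<nu> < K" "d = f \<nu>" using fT by auto
      let ?g = "3 * \<nu> + oo \<nu>"
      have g: "?g < ?n" "?g div 3 = \<nu>" "?g mod 3 = oo \<nu>"
        using oo(1)[OF \<nu>(1)] \<nu>(1) by (linarith, simp_all)
      have "w ?g = v" unfolding w_def g(2,3) using d \<nu> oo(2)[OF \<nu>(1)] by simp
      moreover have "ab ?g" unfolding ab_def g(2,3) ..
      ultimately have "v \<in> set (lk ?g @ gd ?g (ab ?g))" using gdF(2)[OF g(1), of "ab ?g"] by auto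
      then show ?thesis using gmem[OF g(1)] by blast
    qed
  qed
  note part = covering_imp_partition[OF Pl finite_V V cover]
  show ?thesis
  proof (rule exI[of _ P], intro conjI allI impI)
    fix i assume i: "i < M"
    show "walk (P i)" "last (P i) = y i" using Pw[OF i] by auto
    show "hd (P i) = x i" "P i \<noteq> []" by (simp_all add: P_def)
    show "length (P i) = l" using Pl[OF i] .
    show "distinct (P i)" using part(2)[OF _ i] by simp
  qed (use part in auto)
qed

end

subsection \<open>The choice of the parameters\<close>

definition expansion_rate :: "real \<Rightarrow> real" where "expansion_rate n = 10 ^ 10 * ln n ^ 4 / ln (ln n)"

text \<open>Collects everything that is true only for large \<open>n\<close>, with roundings such as
  \<open>\<kappa> + 1\<close> for \<open>k\<close> built in. The long sum bounds all vertices bound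
  elsewhere as a fraction of \<open>n\<close>; its main term, nodes times vertices per node, is of
  order \<open>1 / ln L\<close>.\<close>

definition parameter_regime :: "nat \<Rightarrow> bool" where
  "parameter_regime n \<longleftrightarrow> (let L = ln (real n); d = expansion_rate (real n); \<kappa> = L / ln L in
    95 + 88 * (\<kappa> + 1) \<le> L \<and> 1 \<le> ln L \<and> 16 * d \<le> real n \<and> d / (25 * L) \<le> d / (20 * L) - 3 \<and>
    (2 * L + 8) / d + 1 / real n + (2 * L + 1) * (25 * L / d) * (3 * ((\<kappa> + 3) * (2 * \<kappa> + 4)) + 1)
      + 22 / d + 75 * L / d \<le> 1 / 8 \<and>
    3 * ((\<kappa> + 3) * (2 * \<kappa> + 4)) + 1 \<le> L\<^sup>2 \<and> 2 * \<kappa> + 5 \<le> L\<^sup>2 \<and> 4 * L + 6 \<le> L\<^sup>2 \<and>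
    88 * (2 * \<kappa> + 5) \<le> d)"

lemma eventually_parameter_regime: "\<forall>\<^sub>F n in sequentially. parameter_regime n"
  unfolding parameter_regime_def Let_def expansion_rate_def by (intro eventually_conj; real_asymp)

section \<open>From the given graph to the locale, and numerical bounds\<close>

lemma joined_graph_expands:
  assumes G: "pair_graph G" and exp: "expands_into G d W" and W: "W \<subseteq> pverts G" "W \<noteq> {}" and d: "0 < d"
  shows "joined_graph (pverts G) (nbhd G) (nat \<lceil>card W / (2 * d)\<rceil>)"
proof -
  interpret pair_graph G by fact
  have fW: "finite W" using W(1) pair_finite_verts by (rule finite_subset)
  have pos: "0 < \<lceil>card W / (2 * d)\<rceil>" using fW W(2) d by (simp add: card_gt_0_iff)
  show ?thesis
  proof
    show "finite (pverts G)" by (rule pair_finite_verts)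
    show "nbhd G v \<subseteq> pverts G" for v using arc_snd_in_verts by (force simp: nbhd_def)
    show "v \<in> nbhd G u" if "u \<in> nbhd G v" for u v
      using that pair_sym_arcs by (auto simp: nbhd_def symmetric_def sym_def)
    show "1 \<le> nat \<lceil>card W / (2 * d)\<rceil>" using pos by linarith
    fix X Y assume XY: "X \<subseteq> pverts G" "Y \<subseteq> pverts G" "X \<inter> Y = {}"
      "card X = nat \<lceil>card W / (2 * d)\<rceil>" "card Y = nat \<lceil>card W / (2 * d)\<rceil>"
    then have "edges_between G X Y > 0" using exp pos unfolding expands_into_def by auto
    then have "{(x, y) \<in> parcs G. x \<in> X \<and> y \<in> Y} \<noteq> {}" unfolding edges_between_def by (metis card.empty less_irrefl)
    then show "\<exists>x\<in>X. \<exists>y\<in>Y. y \<in> nbhd G x" by (auto simp: nbhd_def)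
  qed
qed

lemma vpath_if_successively:
  assumes "successively (\<lambda>u v. v \<in> nbhd G u) p" "p \<noteq> []" "distinct p" "set p \<subseteq> pverts G"
  shows "vpath p (with_proj G)"
proof -
  have "set (vwalk_arcs p) \<subseteq> parcs G"
    using assms(1) by (induction p rule: vwalk_arcs.induct) (auto simp: nbhd_def)
  then show ?thesis using assms by (intro vpathI vwalkI) auto
qed

lemma le_power_ceiling:
  fixes n b :: real
  assumes "1 < b" "b \<le> real D" "0 < n"
  shows "n \<le> real D ^ nat \<lceil>ln n / ln b\<rceil>"
proof -
  let ?k = "nat \<lceil>ln n / ln b\<rceil>"
  have "n = exp (ln n / ln b * ln b)" using assms by simp
  also have "\<dots> \<le> exp (real ?k * ln b)"
    using assms by (intro iffD2[OF exp_le_cancel_iff] mult_right_mono real_nat_ceiling_ge) auto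
  also have "\<dots> = b ^ ?k" using assms by (simp add: exp_of_nat_mult)
  also have "\<dots> \<le> real D ^ ?k" using assms by (intro power_mono) auto
  finally show ?thesis .
qed

text \<open>The factor \<open>2\<close> is a convenient bound for \<open>1 / ln 2\<close>, in the
  form \<open>exp (1 / 2) <= 2\<close>.\<close>

lemma le_two_power:
  fixes n :: real
  assumes "1 \<le> n"
  shows "n \<le> 2 ^ nat \<lceil>2 * ln n\<rceil>"
proof -
  let ?k = "nat \<lceil>2 * ln n\<rceil>"
  have "exp (1 / 2 :: real) \<le> 2"
  proof -
    have "exp (1 / 2 :: real) \<le> 1 + 1 / 2 + (1 / 2)\<^sup>2" by (rule exp_bound) auto
    then show ?thesis by (simp add: power2_eq_square)
  qed
  have "n = exp (2 * ln n * (1 / 2))" using assms by simp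
  also have "\<dots> \<le> exp (real ?k * (1 / 2))"
    by (intro iffD2[OF exp_le_cancel_iff] mult_right_mono real_nat_ceiling_ge) auto
  also have "\<dots> = exp (1 / 2) ^ ?k" by (simp only: exp_of_nat_mult)
  also have "\<dots> \<le> 2 ^ ?k" using \<open>exp (1 / 2 :: real) \<le> 2\<close> by (intro power_mono) auto
  finally show ?thesis .
qed

text \<open>\<open>B\<close> is chosen so that \<open>d / B\<close> is at least
  \<open>20 * L\<close>: a random colour class then keeps enough neighbours for the expansion factor
  \<open>4 * D\<close>. Applied to \<open>m - 1\<close> vertices, the factor \<open>4\<close> gives
  \<open>3 * D * m <= N\<close>, of which \<open>2 * D * m\<close> is for extendability and
  \<open>D * m\<close> for the other terms of the reservoir bound.\<close>

lemma parameters: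
  fixes n l M m w N c1 c2 :: nat
  defines "L \<equiv> ln (real n)" and "d \<equiv> expansion_rate (real n)"
  defines "D \<equiv> nat \<lceil>L\<rceil>" and "k \<equiv> nat \<lceil>L / ln L\<rceil>" and "kB \<equiv> nat \<lceil>2 * L\<rceil>" and "B \<equiv> nat \<lfloor>d / (20 * L)\<rfloor>"
  defines "A \<equiv> (k + 2) * (2 * k + 2)" and "K \<equiv> kB * N"
  defines "q \<equiv> K div M + 1"
  assumes reg: "parameter_regime n" and n: "n = M * l" "0 < M" and l: "1000 * L\<^sup>2 \<le> real l" and w: "w + 2 * M = n"
    and m: "m = nat \<lceil>w / (2 * d)\<rceil>"
  shows "3 \<le> B" "2 * real B * real n * (2 ^ (4 * D) * exp (- d / (2 * real B))) < 1" "4 \<le> m" "m \<le> n"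
    "20 \<le> D" "m \<le> D ^ k" "n \<le> 2 ^ kB" "0 < d" "0 < w"
    "\<lbrakk>(B - 2) * N \<le> w; (B - 2) * c1 \<le> w; (B - 2) * c2 \<le> w; 4 * D * (m - 1) \<le> N\<rbrakk> \<Longrightarrow> \<exists>p e. p \<le> M \<and>
      (2 * D + 6) * m + 1 + p * (e + 1) * (2 * k + 2) \<le> N \<and>
      K + p + N + c1 + c2 \<le> w \<and>
      (2 * D + 6) * m + 1 + 3 * K * A + K + p + N + c2 \<le> w \<and>
      10 * m + 1 \<le> p * e \<and>
      1 + q * (3 * A + 1) + (e + 1) * (2 * k + 3) + 2 * kB + 3 \<le> l"
proof -
  define \<kappa> where "\<kappa> = L / ln L"
  have r: "183 + 88 * \<kappa> \<le> L" "1 \<le> ln L" "16 * d \<le> real n" "d / (25 * L) \<le> d / (20 * L) - 3"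
    "(2 * L + 8) / d + 1 / real n + (2 * L + 1) * (25 * L / d) * (3 * ((\<kappa> + 3) * (2 * \<kappa> + 4)) + 1)
      + 22 / d + 75 * L / d \<le> 1 / 8"
    "3 * ((\<kappa> + 3) * (2 * \<kappa> + 4)) + 1 \<le> L\<^sup>2" "2 * \<kappa> + 5 \<le> L\<^sup>2" "4 * L + 6 \<le> L\<^sup>2"
    "176 * \<kappa> + 440 \<le> d"
    using reg unfolding parameter_regime_def Let_def L_def[symmetric] d_def[symmetric] \<kappa>_def[symmetric] by auto
  have lnL: "0 < ln L" using r(2) by linarith
  have "0 \<le> L" unfolding L_def by (cases "n = 0") auto
  then have "0 \<le> \<kappa>" unfolding \<kappa>_def using lnL by simp
  then have L0: "0 < L" using r(1) by linarith
  then have \<kappa>0: "0 < \<kappa>" unfolding \<kappa>_def using lnL by simp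
  have L95: "95 \<le> L" using r(1) \<kappa>0 by linarith
  show d0: "0 < d" using r(9) \<kappa>0 by linarith
  have n0: "0 < n" using r(3) d0 by (cases "n = 0") auto
  have expL: "exp L = n" unfolding L_def using n0 by simp
  have l0: "0 < l" using n n0 by simp
  have L2: "L\<^sup>2 \<le> l / 1000" using l by simp
  have lbig: "1000 \<le> real l" using l r(8) L0 by linarith
  have nM: "real n = M * real l" using n by simp
  have wn: "real n / 2 \<le> w" "real w \<le> n"
  proof -
    have "4 * real M \<le> M * real l" using lbig n(2) by (simp add: mult.commute)
    then show "real n / 2 \<le> w" "real w \<le> n" using w nM by linarith+
  qed
  then show "0 < w" using n0 by linarith
  have nd: "16 \<le> n / d" using r(3) d0 by (simp add: field_simps)
  have wd0: "0 \<le> w / (2 * d)" using d0 by simp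
  have mle: "real m \<le> n / d"
  proof -
    have "real m \<le> w / (2 * d) + 1" unfolding m using wd0 by linarith
    also have "w / (2 * d) \<le> n / (2 * d)" using wn d0 by (intro divide_right_mono) auto
    also have "n / (2 * d) + 1 \<le> n / d" using nd d0 by (simp add: field_simps)
    finally show ?thesis by simp
  qed
  have mge: "4 \<le> real m"
  proof -
    have "4 \<le> n / (4 * d)" using nd d0 by (simp add: field_simps)
    also have "\<dots> = (n / 2) / (2 * d)" by simp
    also have "\<dots> \<le> w / (2 * d)" using wn d0 by (intro divide_right_mono) auto
    also have "\<dots> \<le> real m" unfolding m by linarith
    finally show ?thesis .
  qed
  then show m4: "4 \<le> m" by simp
  have d1: "1 \<le> d" using r(9) \<kappa>0 by linarith
  have "n / d \<le> n" using d1 n0 by (simp add: field_simps)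
  then have mn: "real m \<le> n" using mle by linarith
  then show mn': "m \<le> n" by simp
  have DL: "L \<le> D" "D \<le> L + 1" unfolding D_def using L0 by linarith+
  show "20 \<le> D" using DL L95 by linarith
  have kk: "\<kappa> \<le> k" "k \<le> \<kappa> + 1" unfolding k_def \<kappa>_def[symmetric] using \<kappa>0 by linarith+
  have kBL: "2 * L \<le> kB" "kB \<le> 2 * L + 1" unfolding kB_def using L0 by linarith+
  have "real n \<le> real D ^ nat \<lceil>ln n / ln L\<rceil>"
    using L95 DL n0 by (intro le_power_ceiling) auto
  then have "real m \<le> real (D ^ k)" using mn by (simp add: k_def L_def)
  then show "m \<le> D ^ k" by (simp only: of_nat_le_iff)
  have "real n \<le> 2 ^ nat \<lceil>2 * ln n\<rceil>" using n0 by (intro le_two_power) simp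
  then have "real n \<le> real (2 ^ kB)" by (simp add: kB_def L_def)
  then show "n \<le> 2 ^ kB" by (simp only: of_nat_le_iff)
  have dL: "300 * L \<le> d" using r(4) L0 by (simp add: field_simps)
  have Bge: "d / (20 * L) - 1 \<le> B" "real B \<le> d / (20 * L)"
  proof -
    have "0 \<le> d / (20 * L)" using d0 L0 by simp
    then show "d / (20 * L) - 1 \<le> B" "real B \<le> d / (20 * L)" unfolding B_def by linarith+
  qed
  have "15 \<le> d / (20 * L)" using dL L0 by (simp add: field_simps)
  then have B3: "3 \<le> real B" using Bge by linarith
  then show "3 \<le> B" by simp
  \<comment> \<open>In the exponent, \<open>B\<close> and \<open>n\<close> contribute at most
    \<open>L\<close> each and \<open>2 ^ (4 * D)\<close> at most \<open>4 * L + 4\<close>, against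
    \<open>- 10 * L\<close>.\<close>
  show "2 * real B * real n * (2 ^ (4 * D) * exp (- d / (2 * real B))) < 1"
  proof -
    have "(2::real) \<le> exp 1" using exp_ge_add_one_self[of 1] by simp
    then have "(2::real) ^ (4 * D) \<le> exp 1 ^ (4 * D)" by (intro power_mono) auto
    also have "\<dots> = exp (4 * real D)" by (simp add: exp_of_nat_mult[symmetric])
    also have "\<dots> \<le> exp (4 * L + 4)" using DL by simp
    finally have 1: "(2::real) ^ (4 * D) \<le> exp (4 * L + 4)" .
    have "10 * L * (2 * real B) \<le> d" using Bge(2) L0 by (simp add: field_simps)
    then have "- d / (2 * real B) \<le> - 10 * L" using B3 by (simp add: field_simps)
    then have 2: "exp (- d / (2 * real B)) \<le> exp (- 10 * L)" by simp
    have "d / (20 * L) \<le> d" using d0 L95 by (simp add: field_simps)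
    then have 3: "real B \<le> exp L" using Bge(2) r(3) d0 expL by linarith
    have "2 * real B * real n * (2 ^ (4 * D) * exp (- d / (2 * real B)))
        \<le> 2 * exp L * exp L * (exp (4 * L + 4) * exp (- 10 * L))"
      using 1 2 3 expL by (intro mult_mono) auto
    also have "\<dots> = 2 * exp (4 - 4 * L)"
    proof -
      have "L + L + (4 * L + 4) + - 10 * L = 4 - 4 * L" by simp
      moreover have "exp L * exp L * (exp (4 * L + 4) * exp (- 10 * L)) = exp (L + L + (4 * L + 4) + - 10 * L)"
        by (simp only: exp_add mult_ac)
      ultimately show ?thesis by (simp only: mult.assoc)
    qed
    also have "\<dots> < exp (4 * L - 4) * exp (4 - 4 * L)"
    proof (rule mult_strict_right_mono)
      show "2 < exp (4 * L - 4)" using exp_ge_add_one_self[of "4 * L - 4"] L95 by linarith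
    qed simp
    also have "\<dots> = 1" by (simp add: exp_add[symmetric])
    finally show ?thesis .
  qed
  assume N: "(B - 2) * N \<le> w" "(B - 2) * c1 \<le> w" "(B - 2) * c2 \<le> w" "4 * D * (m - 1) \<le> N"
  \<comment> \<open>Common bound for the sizes of the three classes; \<open>25\<close> in place of
    \<open>20\<close> absorbs the rounding in \<open>B - 2\<close>.\<close>
  define X where "X = 25 * L / d * n"
  have cls: "real c \<le> X" if c: "(B - 2) * c \<le> w" for c
  proof -
    have "real (B - 2) = real B - 2" using B3 by (simp add: of_nat_diff)
    then have "d / (25 * L) \<le> real (B - 2)" using Bge(1) r(4) by linarith
    then have "d / (25 * L) * c \<le> real (B - 2) * c" by (intro mult_right_mono) auto
    also have "\<dots> \<le> w" using c by (simp only: of_nat_mult[symmetric] of_nat_le_iff)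
    also have "\<dots> \<le> n" by (rule wn)
    finally show ?thesis using d0 L0 by (simp add: X_def field_simps)
  qed
  have X: "real N \<le> X" "real c1 \<le> X" "real c2 \<le> X" using N cls by auto
  have X0: "0 \<le> X" using L0 d0 by (simp add: X_def)
  define Ar where "Ar = (\<kappa> + 3) * (2 * \<kappa> + 4)"
  have Ale: "real A \<le> Ar" unfolding A_def Ar_def using kk \<kappa>0
    by (simp only: of_nat_mult, intro mult_mono) auto
  have Ar0: "0 \<le> Ar" using \<kappa>0 by (simp add: Ar_def)
  have hle: "2 * real k + 3 \<le> 2 * \<kappa> + 5" using kk by linarith
  have KX: "real K \<le> (2 * L + 1) * X"
    unfolding K_def of_nat_mult using kBL X L0 by (intro mult_mono) auto
  have KA: "real K * (3 * A + 1) \<le> (2 * L + 1) * X * (3 * Ar + 1)"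
    using KX Ale X0 L0 by (intro mult_mono) auto
  have tot0: "((2 * L + 8) / d + 1 / real n + (2 * L + 1) * (25 * L / d) * (3 * Ar + 1) + 22 / d + 75 * L / d) * n \<le> 1 / 8 * n"
    using r(5) unfolding Ar_def by (intro mult_right_mono) auto
  have tot: "(2 * L + 8) * (n / d) + 1 + (2 * L + 1) * X * (3 * Ar + 1) + 22 * (n / d) + 3 * X \<le> n / 8"
  proof -
    have "((2 * L + 8) / d + 1 / real n + (2 * L + 1) * (25 * L / d) * (3 * Ar + 1) + 22 / d + 75 * L / d) * n
      = (2 * L + 8) / d * n + 1 / real n * n + (2 * L + 1) * (25 * L / d) * (3 * Ar + 1) * n + 22 / d * n + 75 * L / d * n"
      by (simp only: distrib_right)
    also have "\<dots> = (2 * L + 8) * (n / d) + 1 + (2 * L + 1) * X * (3 * Ar + 1) + 22 * (n / d) + 3 * X"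
      using n0 d0 by (simp add: X_def field_simps)
    finally show ?thesis using tot0 by simp
  qed
  have nonneg: "0 \<le> (2 * L + 8) * (n / d)" "0 \<le> 22 * (n / d)" using L0 d0 by auto
  have KA8: "real K * (3 * A + 1) \<le> n / 8" using KA tot nonneg X0 by linarith
  define h where "h = 2 * k + 3"
  have h5: "real h \<le> 2 * \<kappa> + 5" using hle by (simp add: h_def)
  have hl: "4 * h \<le> l"
  proof -
    have "4 * real h \<le> real l" using h5 r(7) L2 by linarith
    then show ?thesis by linarith
  qed
  have h0: "0 < h" by (simp add: h_def)
  \<comment> \<open>Each leftover vertex costs its path \<open>h\<close> vertices, so
    \<open>l div (4 * h)\<close> of them take a quarter of it. The target \<open>11 * m\<close>
    exceeds the required \<open>10 * m + 1\<close>, and \<open>e <= 11 * m\<close> keeps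
    \<open>p * e\<close> below \<open>22 * m\<close> after rounding up.\<close>
  define e where "e = min (l div (4 * h)) (11 * m)"
  define p where "p = (11 * m + e - 1) div e"
  have "1 \<le> l div (4 * h)" using hl h0 by (simp add: Suc_le_eq div_greater_zero_iff)
  then have e1: "1 \<le> e" using m4 by (simp add: e_def)
  have pdm: "p * e + (11 * m + e - 1) mod e = 11 * m + e - 1" by (simp add: p_def)
  have "(11 * m + e - 1) mod e < e" using e1 by simp
  then have pe: "11 * m \<le> p * e" "p * e \<le> 11 * m + e - 1" using pdm e1 by linarith+
  have e11: "e \<le> 11 * m" by (simp add: e_def)
  have pe22: "p * e \<le> 22 * m" using pe e11 by linarith
  have ppe: "p \<le> p * e" using e1 by simp
  \<comment> \<open>Otherwise \<open>M * e < 11 * m\<close>. Then \<open>e\<close> is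
    \<open>l div (4 * h)\<close>, so \<open>n = M * l\<close> is less than
    \<open>88 * h * m\<close>, contradicting \<open>m <= n / d\<close> and
    \<open>88 * h <= d\<close>.\<close>
  have pM: "p \<le> M"
  proof (rule ccontr)
    assume "\<not> p \<le> M"
    then have "(M + 1) * e \<le> p * e" by (intro mult_le_mono1) simp
    then have Me: "M * e < 11 * m" using pe(2) e1 by simp
    show False
    proof (cases "e = 11 * m")
      case True
      then show False using Me n(2) m4 by simp
    next
      case False
      then have el: "e = l div (4 * h)" by (simp add: e_def min_def split: if_splits)
      have "l < 4 * h * (e + 1)" unfolding el using h0 dividend_less_times_div[of "4 * h" l] by (simp add: algebra_simps)
      also have "\<dots> \<le> 4 * h * (2 * e)" using e1 by (intro mult_le_mono2) simp
      finally have "M * l \<le> M * (8 * h * e)" by (intro mult_le_mono2) simp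
      also have "\<dots> = 8 * h * (M * e)" by simp
      also have "\<dots> < 8 * h * (11 * m)" using Me h0 by simp
      finally have "n < 88 * h * m" using n by simp
      then have "real n < real (88 * h * m)" by (simp only: of_nat_less_iff)
      also have "\<dots> = 88 * real h * real m" by simp
      also have "\<dots> \<le> 88 * (2 * \<kappa> + 5) * (n / d)" using h5 mle \<kappa>0 by (intro mult_mono) auto
      also have "88 * (2 * \<kappa> + 5) = 176 * \<kappa> + 440" by simp
      also have "(176 * \<kappa> + 440) * (n / d) \<le> d * (n / d)" using r(9) d0 by (intro mult_right_mono) auto
      finally show False using d0 by simp
    qed
  qed
  have Z: "(2 * D + 6) * m + 1 + p * (e + 1) * (2 * k + 2) \<le> N"
  proof -
    have "95 + 88 * real k \<le> D" using kk r(1) DL by linarith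
    then have Dk: "95 + 88 * k \<le> D" by linarith
    have "p * (e + 1) = p * e + p" by simp
    then have "p * (e + 1) \<le> 44 * m" using pe22 ppe by linarith
    then have 1: "p * (e + 1) * (2 * k + 2) \<le> 44 * m * (2 * k + 2)" by (rule mult_le_mono1)
    have "(95 + 88 * k) * m \<le> D * m" using Dk by (rule mult_le_mono1)
    then have 2: "44 * m * (2 * k + 2) + 6 * m + m \<le> D * m" by (simp add: algebra_simps)
    have "3 * m \<le> 4 * (m - 1)" using m4 by simp
    then have "D * (3 * m) \<le> D * (4 * (m - 1))" by (rule mult_le_mono2)
    also have "\<dots> = 4 * D * (m - 1)" by simp
    also have "\<dots> \<le> N" by fact
    finally have 3: "3 * (D * m) \<le> N" by simp
    have "(2 * D + 6) * m = 2 * (D * m) + 6 * m" by (simp add: algebra_simps)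
    then show ?thesis using 1 2 3 m4 by linarith
  qed
  have pn: "real p \<le> 22 * (n / d)"
  proof -
    have "p \<le> 22 * m" using ppe pe22 by linarith
    then have "real p \<le> 22 * real m" by linarith
    then show ?thesis using mle by linarith
  qed
  have Dm: "(2 * real D + 6) * m \<le> (2 * L + 8) * (n / d)"
    using DL mle L0 by (intro mult_mono) auto
  have KAe: "real K * (3 * A + 1) = 3 * real K * A + K" by (simp add: algebra_simps)
  have KAge: "0 \<le> 3 * real K * A" by simp
  have "real ((2 * D + 6) * m + 1 + 3 * K * A + K + p + N + c1 + c2)
      = (2 * real D + 6) * m + 1 + (3 * real K * A + K) + p + N + c1 + c2" by simp
  also have "\<dots> \<le> n / 8" using Dm KA KAe pn X tot by linarith
  also have "\<dots> \<le> w" using wn n0 by linarith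
  finally have total: "(2 * D + 6) * m + 1 + 3 * K * A + K + p + N + c1 + c2 \<le> w" by (simp only: of_nat_le_iff)
  \<comment> \<open>The even share of nodes takes an eighth of \<open>l\<close> and the leftover
    vertices a quarter. The assumption on \<open>l\<close> bounds by \<open>l / 1000\<close> each of
    the extras: the node added by the \<open>+ 1\<close> in \<open>q\<close>, the last connection,
    and the minimal length of the long one.\<close>
  have lr: "1 + q * (3 * A + 1) + (e + 1) * h + 2 * kB + 3 \<le> l"
  proof -
    have "real (K div M) * M \<le> K" by (metis div_times_less_eq_dividend of_nat_le_iff of_nat_mult)
    then have "real (K div M) * M * (3 * A + 1) \<le> real K * (3 * A + 1)" by (intro mult_right_mono) auto
    also have "\<dots> \<le> M * real l / 8" using KA8 nM by simp
    finally have "real M * (real (K div M) * (3 * A + 1)) \<le> real M * (real l / 8)" by (simp add: mult_ac)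
    then have 1: "real (K div M) * (3 * A + 1) \<le> real l / 8"
      by (rule mult_left_le_imp_le) (use n(2) in simp)
    have 2: "3 * real A + 1 \<le> real l / 1000" using Ale r(6) L2 unfolding Ar_def[symmetric] by linarith
    have "e * (4 * h) \<le> l" using div_times_less_eq_dividend[of l "4 * h"] mult_le_mono1[of e "l div (4 * h)" "4 * h"]
      unfolding e_def by linarith
    then have "real (e * (4 * h)) \<le> l" by (simp only: of_nat_le_iff)
    then have 3: "real e * h \<le> real l / 4" by simp
    have 4: "real h \<le> real l / 1000" using h5 r(7) L2 by linarith
    have 5: "4 + 2 * real kB \<le> real l / 1000" using kBL r(8) L2 by linarith
    have "real (1 + q * (3 * A + 1) + (e + 1) * h + 2 * kB + 3) =
      real (K div M) * (3 * A + 1) + (3 * real A + 1) + real e * h + h + (4 + 2 * real kB)"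
      by (simp add: q_def algebra_simps)
    also have "\<dots> \<le> l" using 1 2 3 4 5 lbig by linarith
    finally show ?thesis by (simp only: of_nat_le_iff)
  qed
  show "\<exists>p e. p \<le> M \<and>
      (2 * D + 6) * m + 1 + p * (e + 1) * (2 * k + 2) \<le> N \<and>
      K + p + N + c1 + c2 \<le> w \<and>
      (2 * D + 6) * m + 1 + 3 * K * A + K + p + N + c2 \<le> w \<and>
      10 * m + 1 \<le> p * e \<and>
      1 + q * (3 * A + 1) + (e + 1) * (2 * k + 3) + 2 * kB + 3 \<le> l"
    using pM Z total pe(1) m4 lr unfolding h_def by (intro exI[of _ p] exI[of _ e] conjI; linarith)
qed

theorem theorem4p4:
  shows "\<exists>n0::nat. \<forall>n\<ge>n0. \<forall>l::nat. \<forall>G::'a pair_pre_digraph. \<forall>(x::nat \<Rightarrow> 'a) (y::nat \<Rightarrow> 'a).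
    real l \<ge> 10 ^ 3 * (ln (real n))\<^sup>2 \<longrightarrow>
    l dvd n \<longrightarrow>
    pair_graph G \<longrightarrow>
    card (pverts G) = n \<longrightarrow>
    (\<forall>i\<in>{1..n div l}. x i \<in> pverts G \<and> y i \<in> pverts G \<and> x i \<noteq> y i) \<longrightarrow>
    disjoint_family_on (\<lambda>i. {x i, y i}) {1..n div l} \<longrightarrow>
    expands_into G (10 ^ 10 * ln (real n) ^ 4 / ln (ln (real n)))
      (pverts G - (\<Union>i\<in>{1..n div l}. {x i, y i})) \<longrightarrow>
    (\<exists>P::nat \<Rightarrow> 'a vwalk.
      (\<forall>i\<in>{1..n div l}. vpath (P i) (with_proj G) \<and> vwalk_length (P i) = l - 1 \<and>
         hd (P i) = x i \<and> last (P i) = y i) \<and>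
      disjoint_family_on (\<lambda>i. set (P i)) {1..n div l} \<and>
      (\<Union>i\<in>{1..n div l}. set (P i)) = pverts G)"
proof -
  obtain n0 where n0: "\<And>n. n0 \<le> n \<Longrightarrow> parameter_regime n"
    using eventually_parameter_regime by (auto simp: eventually_sequentially)
  show ?thesis
  proof (rule exI[of _ "max n0 1"], intro allI impI)
    fix n l :: nat and G :: "'a pair_pre_digraph" and x y :: "nat \<Rightarrow> 'a"
    assume "max n0 1 \<le> n" and l: "real l \<ge> 10 ^ 3 * (ln (real n))\<^sup>2" and ln: "l dvd n"
      and G: "pair_graph G" and cV: "card (pverts G) = n"
      and xy: "\<forall>i\<in>{1..n div l}. x i \<in> pverts G \<and> y i \<in> pverts G \<and> x i \<noteq> y i"
      and dis: "disjoint_family_on (\<lambda>i. {x i, y i}) {1..n div l}"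
      and exp: "expands_into G (10 ^ 10 * ln (real n) ^ 4 / ln (ln (real n)))
        (pverts G - (\<Union>i\<in>{1..n div l}. {x i, y i}))"
    then have reg: "parameter_regime n" and npos: "0 < n" using n0 by auto
    define M where "M = n div l"
    have nM: "n = M * l" using ln by (simp add: M_def)
    then have M0: "0 < M" using npos by (cases M) auto
    define x' where "x' i = x (Suc i)" for i
    define y' where "y' i = y (Suc i)" for i
    define V where "V = pverts G"
    define W where "W = V - x' ` {..<M} - y' ` {..<M}"
    have Suc: "Suc i \<in> {1..n div l}" if "i < M" for i using that by (simp add: M_def)
    have img: "f ` {1..n div l} = (\<lambda>i. f (Suc i)) ` {..<M}" for f :: "nat \<Rightarrow> 'b"
      unfolding M_def image_Suc_lessThan[symmetric] by (simp add: image_image)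
    have "(\<Union>i\<in>{1..n div l}. {x i, y i}) = x' ` {..<M} \<union> y' ` {..<M}"
      unfolding img x'_def y'_def by auto
    then have WG: "pverts G - (\<Union>i\<in>{1..n div l}. {x i, y i}) = W" by (auto simp: W_def V_def)
    have finV: "finite V" using cV npos unfolding V_def by (metis card.infinite less_irrefl)
    have xV: "x' ` {..<M} \<subseteq> V" and yV: "y' ` {..<M} \<subseteq> V"
      using xy Suc by (auto simp: x'_def y'_def V_def)
    have dij: "i = j" if "i < M" "j < M" "{x' i, y' i} \<inter> {x' j, y' j} \<noteq> {}" for i j
      using disjoint_family_onD[OF dis Suc[OF that(1)] Suc[OF that(2)]] that(3) by (auto simp: x'_def y'_def)
    have xi: "inj_on x' {..<M}" and yi: "inj_on y' {..<M}"
      by (rule inj_onI, rule dij; simp)+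
    have xy': "x' ` {..<M} \<inter> y' ` {..<M} = {}"
    proof (rule ccontr)
      assume "\<not> ?thesis"
      then obtain i j where ij: "i < M" "j < M" "x' i = y' j" by auto
      then have "i = j" by (intro dij) auto
      then show False using ij xy Suc[OF ij(1)] by (auto simp: x'_def y'_def)
    qed
    have cW: "card W + 2 * M = n"
    proof -
      let ?S = "x' ` {..<M} \<union> y' ` {..<M}"
      have "card ?S = 2 * M"
        using xi yi xy' by (subst card_Un_disjoint) (auto simp: card_image)
      moreover have "W = V - ?S" by (auto simp: W_def)
      moreover have "?S \<subseteq> V" "finite ?S" using xV yV by auto
      ultimately show ?thesis using cV card_mono[OF finV \<open>?S \<subseteq> V\<close>] by (simp add: V_def card_Diff_subset)
    qed
    define L where "L = ln (real n)"
    define d where "d = expansion_rate (real n)"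
    define m where "m = nat \<lceil>card W / (2 * d)\<rceil>"
    define D where "D = nat \<lceil>L\<rceil>"
    define k where "k = nat \<lceil>L / ln L\<rceil>"
    define kB where "kB = nat \<lceil>2 * L\<rceil>"
    define B where "B = nat \<lfloor>d / (20 * L)\<rfloor>"
    have exp': "expands_into G d W" using exp unfolding WG by (simp add: d_def expansion_rate_def)
    have "1000 * (ln (real n))\<^sup>2 \<le> real l" using l by simp
    note par = parameters[OF reg nM M0 this cW, OF m_def[unfolded d_def],
      folded L_def d_def, folded D_def k_def kB_def B_def]
    have WV: "W \<subseteq> pverts G" "W \<noteq> {}"
    proof -
      show "W \<subseteq> pverts G" by (auto simp: W_def V_def)
      show "W \<noteq> {}" using par(9) card_gt_0_iff by blast
    qed
    interpret joined_graph V "nbhd G" m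
      unfolding V_def m_def by (rule joined_graph_expands[OF G exp' WV par(8)])
    have expW: "1 \<le> card U \<and> d * card U \<le> card (nbhds U \<inter> W)"
      if U: "U \<subseteq> V" "1 \<le> card U \<and> card U < m" for U
    proof -
      have "int (card U) < \<lceil>card W / (2 * d)\<rceil>" using U unfolding m_def by linarith
      then have "d * card U \<le> card (ext_nbhd_in G U W)"
        using exp' U unfolding expands_into_def V_def by blast
      also have "card (ext_nbhd_in G U W) \<le> card (nbhds U \<inter> W)"
        by (intro card_mono finite_Int disjI1 finite_nbhds) (auto simp: ext_nbhd_in_def ext_nbhd_def nbhds_def)
      finally show ?thesis using U by simp
    qed
    have "\<exists>Z C1 C2. Z \<subseteq> W \<and> C1 \<subseteq> W \<and> C2 \<subseteq> W \<and> Z \<inter> C1 = {} \<and> Z \<inter> C2 = {} \<and> C1 \<inter> C2 = {} \<and>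
      (B - 2) * card Z \<le> card W \<and> (B - 2) * card C1 \<le> card W \<and> (B - 2) * card C2 \<le> card W \<and>
      (\<forall>C\<in>{Z, C1, C2}. \<forall>U\<subseteq>V. 1 \<le> card U \<and> card U < m \<longrightarrow> 4 * D * card U \<le> card (nbhds U \<inter> C))"
    proof (rule expanding_triple)
      show "W \<subseteq> V" using WV(1) by (simp add: V_def)
      show "2 * real B * real (card V) * (2 ^ (4 * D) * exp (- d / (2 * real B))) < 1"
        using par(2) cV by (simp add: V_def)
    qed (fact finV par(1) expW)+
    then obtain Z C1 C2 where Z: "Z \<subseteq> W" "C1 \<subseteq> W" "C2 \<subseteq> W" "Z \<inter> C1 = {}" "Z \<inter> C2 = {}" "C1 \<inter> C2 = {}"
      "(B - 2) * card Z \<le> card W" "(B - 2) * card C1 \<le> card W" "(B - 2) * card C2 \<le> card W"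
      and expZ: "\<forall>C\<in>{Z, C1, C2}. \<forall>U\<subseteq>V. 1 \<le> card U \<and> card U < m \<longrightarrow> 4 * D * card U \<le> card (nbhds U \<inter> C)"
      by (elim exE conjE) (rule that)
    have finZ: "finite Z" using Z(1) WV(1) finV finite_subset unfolding V_def by metis
    \<comment> \<open>So far \<open>Z\<close> is bounded only from above; the expansion of any
      \<open>m - 1\<close> vertices into it bounds it from below.\<close>
    have "m - 1 \<le> card V" using par(4) cV by (simp add: V_def)
    then obtain U where U: "U \<subseteq> V" "card U = m - 1" using obtain_subset_with_card_n by metis
    then have "4 * D * (m - 1) \<le> card (nbhds U \<inter> Z)" using expZ par(3) by auto
    also have "\<dots> \<le> card Z" using finZ by (intro card_mono) auto
    finally have Zbig: "4 * D * (m - 1) \<le> card Z" .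
    obtain p e where pe: "p \<le> M" "(2 * D + 6) * m + 1 + p * (e + 1) * (2 * k + 2) \<le> card Z"
      "kB * card Z + p + card Z + card C1 + card C2 \<le> card W"
      "(2 * D + 6) * m + 1 + 3 * (kB * card Z) * ((k + 2) * (2 * k + 2)) + kB * card Z + p + card Z + card C2 \<le> card W"
      "10 * m + 1 \<le> p * e"
      "1 + (kB * card Z div M + 1) * (3 * ((k + 2) * (2 * k + 2)) + 1) + (e + 1) * (2 * k + 3) + 2 * kB + 3 \<le> l"
      using par(10)[OF Z(7-9) Zbig] by blast
    have "card Z \<le> n"
      using cW card_mono[OF finite_subset[OF WV(1)[folded V_def] finV] Z(1)] by linarith
    then have Zk: "card Z \<le> 2 ^ kB" "m \<le> 2 ^ kB" using par(4,7) by linarith+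
    have "\<exists>P. (\<forall>i<M. walk (P i) \<and> P i \<noteq> [] \<and> distinct (P i) \<and> length (P i) = l \<and> hd (P i) = x' i \<and> last (P i) = y' i) \<and>
      disjoint_family_on (\<lambda>i. set (P i)) {..<M} \<and> (\<Union>i<M. set (P i)) = V"
    proof (rule path_partition[where Z = Z and ?C1.0 = C1 and ?C2.0 = C2 and D = D and k = k and kB = kB and L = kB and p = p and e = e])
      show "D * card U \<le> card (nbhds U \<inter> C)"
        if "C \<in> {Z, C1, C2}" "U \<subseteq> V" "1 \<le> card U" "card U < m" for C U
      proof -
        have "4 * D * card U \<le> card (nbhds U \<inter> C)" using expZ that by blast
        then show ?thesis by simp
      qed
      show "card V = M * l" using cV nM by (simp add: V_def)
    qed (use Z pe par(5,6) Zk xV yV xi yi xy' M0 in \<open>simp_all add: W_def[symmetric]\<close>)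
    then obtain P where P: "\<And>i. i < M \<Longrightarrow> walk (P i) \<and> P i \<noteq> [] \<and> distinct (P i) \<and> length (P i) = l \<and>
        hd (P i) = x' i \<and> last (P i) = y' i"
      "disjoint_family_on (\<lambda>i. set (P i)) {..<M}" "(\<Union>i<M. set (P i)) = V" by blast
    define P' where "P' i = P (i - 1)" for i
    have idx: "i - 1 < M" "Suc (i - 1) = i" if "i \<in> {1..n div l}" for i using that by (auto simp: M_def)
    have U: "(\<Union>i\<in>{1..n div l}. set (P' i)) = pverts G"
      unfolding img P'_def using P(3) by (simp add: V_def)
    show "\<exists>P::nat \<Rightarrow> 'a vwalk.
      (\<forall>i\<in>{1..n div l}. vpath (P i) (with_proj G) \<and> vwalk_length (P i) = l - 1 \<and>
         hd (P i) = x i \<and> last (P i) = y i) \<and>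
      disjoint_family_on (\<lambda>i. set (P i)) {1..n div l} \<and>
      (\<Union>i\<in>{1..n div l}. set (P i)) = pverts G"
    proof (rule exI[of _ P'], intro conjI ballI)
      fix i assume i: "i \<in> {1..n div l}"
      have Pi: "walk (P' i)" "P' i \<noteq> []" "distinct (P' i)" "length (P' i) = l" "hd (P' i) = x i" "last (P' i) = y i"
        using P(1)[OF idx(1)[OF i]] idx(2)[OF i] by (simp_all add: P'_def x'_def y'_def)
      show "vpath (P' i) (with_proj G)"
        using Pi U i by (intro vpath_if_successively) (auto simp: walk_def)
      show "vwalk_length (P' i) = l - 1" "hd (P' i) = x i" "last (P' i) = y i" using Pi by simp_all
    next
      show "disjoint_family_on (\<lambda>i. set (P' i)) {1..n div l}"
        unfolding disjoint_family_on_def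
      proof (intro ballI impI)
        fix i j assume ij: "i \<in> {1..n div l}" "j \<in> {1..n div l}" "i \<noteq> j"
        then have "i - 1 \<noteq> j - 1" by auto
        then show "set (P' i) \<inter> set (P' j) = {}"
          using disjoint_family_onD[OF P(2), of "i - 1" "j - 1"] idx(1)[OF ij(1)] idx(1)[OF ij(2)]
          by (simp add: P'_def)
      qed
    qed (rule U)
  qed
qed

end
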